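(* Let $X$ be a centered Gaussian random element with values in a separable Hilbert space $(H,\|\cdot\|_H)$, with infinite-dimensional support and Karhunen-Lo\`eve expansion $X=\sum_{i=1}^\infty\lambda_i^{1/2}\cdot Y_i\cdot e_i$, let $\mu$ denote its distribution, and assume that $\lim_{i\to\infty}\lambda_i\cdot i^\beta\cdot(\ln(i))^\alpha\in{]0,\infty[}$ with $\beta>1$ and $\alpha\in\mathbb{R}$. The $n$-th minimal error of restricted Monte Carlo algorithms satisfies $$e_n^{\mathrm{res}}(\mathrm{Lip}_1,\mu)\preceq n^{-\min(1/2,(\beta-1)/2)}\cdot\begin{cases}1,&\text{if }\beta>2,\\(\ln(n))^{\max(0,1-\alpha/2)},&\text{if }\beta=2\wedge\alpha\neq2,\\\ln(\ln(n)),&\text{if }\beta=2\wedge\alpha=2,\\(\ln(n))^{-\alpha/2},&\text{if }\beta<2,\end{cases}$$ uniformly in $n\ge3$. The $n$-th minimal error of Monte Carlo algorithms satisfies $$n^{-(\beta-1)/2}\cdot(\ln(n))^{-\alpha/2}\preceq e_n(\mathrm{Lip}_1,\mu)$$ uniformly in $n\ge3$ if $\beta\le2$, and $$\limsup_{n\to\infty}\left(e_n(\mathrm{Lip}_1,\mu)\cdot\bigl(n^{1/2}\cdot(\ln(n))^{(1+\beta)/2}\cdot(\ln(\ln(n)))^{\alpha/2}\bigr)\right)>0$$ if $\beta>2$.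
   Context: $\mathbb{N}=\{1,2,\dots\}$. For functions $f,g\colon M\to[0,\infty]$ on a set $M$, $f(m)\preceq g(m)$ (uniformly in $m\in M$) means that there is a constant $c>0$ with $f(m)\le c\,g(m)$ for every $m\in M$. In the Karhunen-Lo\`eve expansion, $(e_i)_{i\in\mathbb{N}}$ is an orthonormal system in $H$, $(\lambda_i)_{i\in\mathbb{N}}$ is a non-increasing, summable sequence of strictly positive numbers, $Y_1,Y_2,\dots$ are independent standard normal random variables, and the series converges in mean-square with respect to $\|\cdot\|_H$. $\mathrm{Lip}_1$ is the class of all $f\colon H\to\mathbb{R}$ with $|f(x)-f(y)|\le\|x-y\|_H$ for all $x,y\in H$, and $S(f)=\operatorname{E}(f(X))$. Algorithms and cost (variable subspace sampling): let $H_n=\operatorname{span}\{e_1,\dots,e_n\}$ for $n\in\mathbb{N}$, $\tilde H=\bigcup_{n=1}^\infty H_n$, and $H_0=\emptyset$. A randomized algorithm $A$ on input $f\in\mathrm{Lip}_1$ may (adaptively) evaluate $f$ at points of $\tilde H$, where an evaluation at $x\in H_n\setminus H_{n-1}$ costs $n$; it performs arithmetic operations with real numbers exactly and evaluates elementary functions (including the inverse $\Phi^{-1}$ of the standard normal distribution function), each at unit cost; the numbers $\lambda_i$ are available; and it has access to a random number generator at cost one per call. If the generator provides (independent, uniformly distributed) random bits, $A$ is called a restricted Monte Carlo algorithm; if it provides independent random numbers uniformly distributed on $[0,1]$, $A$ is called a Monte Carlo algorithm. The output $A(f)$ and the cost $\operatorname{cost}(A,f)$, i.e. the sum of the costs of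 all instructions carried out, are assumed to be random variables for each $f$. Put $$e(A,\mathrm{Lip}_1,\mu)=\sup_{f\in\mathrm{Lip}_1}\bigl(\operatorname{E}|S(f)-A(f)|^2\bigr)^{1/2},\qquad\operatorname{cost}(A,\mathrm{Lip}_1)=\sup_{f\in\mathrm{Lip}_1}\operatorname{E}(\operatorname{cost}(A,f)).$$ For $n\in\mathbb{N}$, $e_n^{\mathrm{res}}(\mathrm{Lip}_1,\mu)$ is the infimum of $e(A,\mathrm{Lip}_1,\mu)$ over all restricted Monte Carlo algorithms $A$ with $\operatorname{cost}(A,\mathrm{Lip}_1)\le n$, and $e_n(\mathrm{Lip}_1,\mu)$ is the infimum of $e(A,\mathrm{Lip}_1,\mu)$ over all Monte Carlo algorithms $A$ with $\operatorname{cost}(A,\mathrm{Lip}_1)\le n$. *)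

theory Defs
  imports "HOL-Probability.Probability"
begin

section \<open>Gaussian random elements\<close>

text \<open>Dirac measure at 0 is admitted as the normal distribution with variance 0.\<close>

definition centered_normal_law :: "real measure \<Rightarrow> bool" where
  "centered_normal_law \<nu> \<longleftrightarrow>
     \<nu> = return borel 0 \<or> (\<exists>\<sigma>>0. \<nu> = density lborel (\<lambda>x. ennreal (normal_density 0 \<sigma> x)))"

definition centered_gaussian ::
  "'a measure \<Rightarrow> ('a \<Rightarrow> 'h::{real_inner,polish_space}) \<Rightarrow> bool" where
  "centered_gaussian M X \<longleftrightarrow>
     X \<in> borel_measurable M \<and> (\<forall>h. centered_normal_law (distr M borel (\<lambda>\<omega>. X \<omega> \<bullet> h)))"

definition topological_support :: "'h::topological_space measure \<Rightarrow> 'h set" where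
  "topological_support \<mu> = {x. \<forall>U. open U \<and> x \<in> U \<longrightarrow> 0 < emeasure \<mu> U}"

definition infinite_dim_support :: "'h::real_normed_vector measure \<Rightarrow> bool" where
  "infinite_dim_support \<mu> \<longleftrightarrow> \<not> (\<exists>B. finite B \<and> topological_support \<mu> \<subseteq> span B)"

text \<open>Sequences are indexed by \<open>i \<ge> 1\<close>; their values at index 0 are irrelevant. The series
  converges in mean square.\<close>

definition karhunen_loeve ::
  "'a measure \<Rightarrow> ('a \<Rightarrow> 'h::{real_inner,polish_space}) \<Rightarrow> (nat \<Rightarrow> real) \<Rightarrow> (nat \<Rightarrow> 'a \<Rightarrow> real)
     \<Rightarrow> (nat \<Rightarrow> 'h) \<Rightarrow> bool" where
  "karhunen_loeve M X l Y e \<longleftrightarrow>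
     (\<forall>i\<ge>1. \<forall>j\<ge>1. e i \<bullet> e j = (if i = j then 1 else 0)) \<and>
     (\<forall>i\<ge>1. 0 < l i) \<and> (\<forall>i\<ge>1. l (Suc i) \<le> l i) \<and> summable (\<lambda>i. l (Suc i)) \<and>
     prob_space.indep_vars M (\<lambda>_. borel) Y {1..} \<and>
     (\<forall>i\<ge>1. distributed M lborel (Y i) (\<lambda>x. ennreal (std_normal_density x))) \<and>
     (\<lambda>n. \<integral>\<^sup>+\<omega>. ennreal ((norm (X \<omega> - (\<Sum>i=1..n. (sqrt (l i) * Y i \<omega>) *\<^sub>R e i)))\<^sup>2) \<partial>M)
        \<longlonglongrightarrow> 0"


section \<open>Asymptotic comparison\<close>

definition uniformly_preceq :: "'m set \<Rightarrow> ('m \<Rightarrow> ennreal) \<Rightarrow> ('m \<Rightarrow> ennreal) \<Rightarrow> bool" where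
  "uniformly_preceq A f g \<longleftrightarrow> (\<exists>c::real. 0 < c \<and> (\<forall>m\<in>A. f m \<le> ennreal c * g m))"


section \<open>A real-number machine with oracle and random number generator\<close>

text \<open>Machine: finite programs with jumps, real registers, and a separate set of natural-number
  registers used for loop counters and indirect addressing. Programs may contain arbitrary
  real constants.

  An operand \<open>Dir k\<close> denotes the number \<open>k\<close>, and \<open>Ind j\<close> the content of the index register
  \<open>j\<close>; the number obtained is used as the address of a real register, except in
  \<open>Eigenvalue\<close> (second operand) and \<open>Eval\<close> (third operand).\<close>

datatype operand = Dir nat | Ind nat

datatype binop = Plus | Minus | Times | Divide

datatype elemfun = Exp | Ln | Sqrt | Sin | Cos | Tan | Arcsin | Arccos | Arctan | NormalQuantile

datatype instr =
    Const operand real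
  | Copy operand operand
  | Arith binop operand operand operand
  | Elem elemfun operand operand
  | Eigenvalue operand operand
  | Random operand
  | Eval operand operand operand
  | JumpLess operand operand nat
  | IdxConst nat nat
  | IdxArith binop nat nat nat
  | IdxJumpLess nat nat nat

type_synonym program = "instr list"

record config =
  pc :: nat
  reg :: "nat \<Rightarrow> real"
  idx :: "nat \<Rightarrow> nat"
  calls :: nat

text \<open>Inverse of the standard normal distribution function, extended by 0 outside \<open>]0,1[\<close>. The
  other partial functions (division, logarithm, ...) are likewise totalized as in the library.\<close>

definition normal_quantile :: "real \<Rightarrow> real" where
  "normal_quantile u =
     (if 0 < u \<and> u < 1
      then THE x. cdf (density lborel (\<lambda>t. ennreal (std_normal_density t))) x = u else 0)"

fun elemfun_sem :: "elemfun \<Rightarrow> real \<Rightarrow> real" where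
  "elemfun_sem Exp = exp"
| "elemfun_sem Ln = ln"
| "elemfun_sem Sqrt = sqrt"
| "elemfun_sem Sin = sin"
| "elemfun_sem Cos = cos"
| "elemfun_sem Tan = tan"
| "elemfun_sem Arcsin = arcsin"
| "elemfun_sem Arccos = arccos"
| "elemfun_sem Arctan = arctan"
| "elemfun_sem NormalQuantile = normal_quantile"

fun binop_real :: "binop \<Rightarrow> real \<Rightarrow> real \<Rightarrow> real" where
  "binop_real Plus = (+)"
| "binop_real Minus = (-)"
| "binop_real Times = (*)"
| "binop_real Divide = (/)"

fun binop_nat :: "binop \<Rightarrow> nat \<Rightarrow> nat \<Rightarrow> nat" where
  "binop_nat Plus = (+)"
| "binop_nat Minus = (-)"
| "binop_nat Times = (*)"
| "binop_nat Divide = (div)"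

fun resolve :: "config \<Rightarrow> operand \<Rightarrow> nat" where
  "resolve c (Dir k) = k"
| "resolve c (Ind j) = idx c j"

definition rd :: "config \<Rightarrow> operand \<Rightarrow> real" where
  "rd c a = reg c (resolve c a)"

definition next_instr :: "config \<Rightarrow> config" where
  "next_instr c = c\<lparr>pc := Suc (pc c)\<rparr>"

definition wr :: "operand \<Rightarrow> real \<Rightarrow> config \<Rightarrow> config" where
  "wr a v c = next_instr (c\<lparr>reg := (reg c)(resolve c a := v)\<rparr>)"

definition idx_wr :: "nat \<Rightarrow> nat \<Rightarrow> config \<Rightarrow> config" where
  "idx_wr j k c = next_instr (c\<lparr>idx := (idx c)(j := k)\<rparr>)"

text \<open>The point with coordinates taken from \<open>m\<close> consecutive real registers starting at \<open>b\<close>,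
  where \<open>b\<close> and \<open>m\<close> are the numbers denoted by the two operands.\<close>

definition sample_point :: "(nat \<Rightarrow> 'h::real_inner) \<Rightarrow> config \<Rightarrow> operand \<Rightarrow> operand \<Rightarrow> 'h" where
  "sample_point e c b m = (\<Sum>i=1..resolve c m. reg c (resolve c b + i - 1) *\<^sub>R e i)"

definition subspace_H :: "(nat \<Rightarrow> 'h::real_inner) \<Rightarrow> nat \<Rightarrow> 'h set" where
  "subspace_H e n = (if n = 0 then {} else span (e ` {1..n}))"

text \<open>For \<open>x\<close> in the union of all \<open>subspace_H e n\<close>, this is the unique \<open>n \<ge> 1\<close> with \<open>x\<close> in
  \<open>subspace_H e n - subspace_H e (n - 1)\<close>; in particular, evaluation at 0 costs 1.\<close>

definition eval_cost :: "(nat \<Rightarrow> 'h::real_inner) \<Rightarrow> 'h \<Rightarrow> nat" where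
  "eval_cost e x = (THE n. 1 \<le> n \<and> x \<in> subspace_H e n - subspace_H e (n - 1))"

text \<open>\<open>\<omega> k\<close> is the result of call number \<open>k\<close> (counted from 0) of the generator.\<close>

fun exec :: "(nat \<Rightarrow> 'h::real_inner) \<Rightarrow> (nat \<Rightarrow> real) \<Rightarrow> ('h \<Rightarrow> real) \<Rightarrow> (nat \<Rightarrow> real) \<Rightarrow> instr
    \<Rightarrow> config \<Rightarrow> config" where
  "exec e l f \<omega> (Const a r) c = wr a r c"
| "exec e l f \<omega> (Copy a b) c = wr a (rd c b) c"
| "exec e l f \<omega> (Arith g a b d) c = wr a (binop_real g (rd c b) (rd c d)) c"
| "exec e l f \<omega> (Elem g a b) c = wr a (elemfun_sem g (rd c b)) c"
| "exec e l f \<omega> (Eigenvalue a i) c = wr a (l (resolve c i)) c"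
| "exec e l f \<omega> (Random a) c = (wr a (\<omega> (calls c)) c)\<lparr>calls := Suc (calls c)\<rparr>"
| "exec e l f \<omega> (Eval a b m) c = wr a (f (sample_point e c b m)) c"
| "exec e l f \<omega> (JumpLess a b t) c = (if rd c a < rd c b then c\<lparr>pc := t\<rparr> else next_instr c)"
| "exec e l f \<omega> (IdxConst j k) c = idx_wr j k c"
| "exec e l f \<omega> (IdxArith g j p q) c = idx_wr j (binop_nat g (idx c p) (idx c q)) c"
| "exec e l f \<omega> (IdxJumpLess p q t) c = (if idx c p < idx c q then c\<lparr>pc := t\<rparr> else next_instr c)"

fun instr_cost :: "(nat \<Rightarrow> 'h::real_inner) \<Rightarrow> instr \<Rightarrow> config \<Rightarrow> nat" where
  "instr_cost e (Eval a b m) c = eval_cost e (sample_point e c b m)"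
| "instr_cost e _ c = 1"

text \<open>A program halts when the program counter leaves the program; its output is then the content
  of the real register 0. The step function leaves halted configurations unchanged.\<close>

definition halted :: "program \<Rightarrow> config \<Rightarrow> bool" where
  "halted P c \<longleftrightarrow> length P \<le> pc c"

definition step :: "(nat \<Rightarrow> 'h::real_inner) \<Rightarrow> (nat \<Rightarrow> real) \<Rightarrow> program \<Rightarrow> ('h \<Rightarrow> real)
    \<Rightarrow> (nat \<Rightarrow> real) \<Rightarrow> config \<Rightarrow> config" where
  "step e l P f \<omega> c = (if halted P c then c else exec e l f \<omega> (P ! pc c) c)"

definition initial :: config where
  "initial = \<lparr>pc = 0, reg = (\<lambda>_. 0), idx = (\<lambda>_. 0), calls = 0\<rparr>"

definition config_at :: "(nat \<Rightarrow> 'h::real_inner) \<Rightarrow> (nat \<Rightarrow> real) \<Rightarrow> program \<Rightarrow> ('h \<Rightarrow> real)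
    \<Rightarrow> (nat \<Rightarrow> real) \<Rightarrow> nat \<Rightarrow> config" where
  "config_at e l P f \<omega> k = (step e l P f \<omega> ^^ k) initial"

text \<open>The value 0 for computations that do not halt is a dummy: every instruction costs at least
  1, hence their cost is infinite.\<close>

definition alg_output :: "(nat \<Rightarrow> 'h::real_inner) \<Rightarrow> (nat \<Rightarrow> real) \<Rightarrow> program \<Rightarrow> ('h \<Rightarrow> real)
    \<Rightarrow> (nat \<Rightarrow> real) \<Rightarrow> real" where
  "alg_output e l P f \<omega> =
     (if \<exists>k. halted P (config_at e l P f \<omega> k)
      then reg (config_at e l P f \<omega> (LEAST k. halted P (config_at e l P f \<omega> k))) 0 else 0)"

definition alg_cost :: "(nat \<Rightarrow> 'h::real_inner) \<Rightarrow> (nat \<Rightarrow> real) \<Rightarrow> program \<Rightarrow> ('h \<Rightarrow> real)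
    \<Rightarrow> (nat \<Rightarrow> real) \<Rightarrow> ennreal" where
  "alg_cost e l P f \<omega> =
     (\<Sum>k. let c = config_at e l P f \<omega> k
           in if halted P c then 0 else of_nat (instr_cost e (P ! pc c) c))"


section \<open>Minimal errors\<close>

definition Lip1 :: "('h::real_inner \<Rightarrow> real) set" where
  "Lip1 = {f. 1-lipschitz_on UNIV f}"

definition random_bit :: "real measure" where
  "random_bit = distr (measure_pmf (pmf_of_set {0, 1})) borel (\<lambda>x. x)"

definition random_uniform :: "real measure" where
  "random_uniform = uniform_measure lborel {0..1}"

text \<open>In the following, \<open>\<rho>\<close> is the distribution of a single call of the generator.\<close>

definition generator :: "real measure \<Rightarrow> (nat \<Rightarrow> real) measure" where
  "generator \<rho> = Pi\<^sub>M UNIV (\<lambda>_. \<rho>)"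

definition algorithms :: "real measure \<Rightarrow> (nat \<Rightarrow> 'h::real_inner) \<Rightarrow> (nat \<Rightarrow> real) \<Rightarrow> program set" where
  "algorithms \<rho> e l =
     {P. \<forall>f\<in>Lip1. alg_output e l P f \<in> borel_measurable (generator \<rho>) \<and>
                  alg_cost e l P f \<in> borel_measurable (generator \<rho>)}"

definition ennreal_sqrt :: "ennreal \<Rightarrow> ennreal" where
  "ennreal_sqrt q = (if q = \<infinity> then \<infinity> else ennreal (sqrt (enn2real q)))"

definition worst_error :: "real measure \<Rightarrow> (nat \<Rightarrow> 'h::real_inner) \<Rightarrow> (nat \<Rightarrow> real) \<Rightarrow> 'h measure
    \<Rightarrow> program \<Rightarrow> ennreal" where
  "worst_error \<rho> e l \<mu> P =
     (SUP f\<in>Lip1. ennreal_sqrt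
        (\<integral>\<^sup>+\<omega>. ennreal (\<bar>(\<integral>x. f x \<partial>\<mu>) - alg_output e l P f \<omega>\<bar>\<^sup>2) \<partial>generator \<rho>))"

definition worst_cost :: "real measure \<Rightarrow> (nat \<Rightarrow> 'h::real_inner) \<Rightarrow> (nat \<Rightarrow> real) \<Rightarrow> program
    \<Rightarrow> ennreal" where
  "worst_cost \<rho> e l P = (SUP f\<in>Lip1. \<integral>\<^sup>+\<omega>. alg_cost e l P f \<omega> \<partial>generator \<rho>)"

definition minimal_error :: "real measure \<Rightarrow> (nat \<Rightarrow> 'h::real_inner) \<Rightarrow> (nat \<Rightarrow> real) \<Rightarrow> 'h measure
    \<Rightarrow> nat \<Rightarrow> ennreal" where
  "minimal_error \<rho> e l \<mu> n =
     (INF P\<in>{P \<in> algorithms \<rho> e l. worst_cost \<rho> e l P \<le> of_nat n}. worst_error \<rho> e l \<mu> P)"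

definition minimal_error_res :: "(nat \<Rightarrow> 'h::real_inner) \<Rightarrow> (nat \<Rightarrow> real) \<Rightarrow> 'h measure \<Rightarrow> nat
    \<Rightarrow> ennreal" where
  "minimal_error_res = minimal_error random_bit"

definition minimal_error_MC :: "(nat \<Rightarrow> 'h::real_inner) \<Rightarrow> (nat \<Rightarrow> real) \<Rightarrow> 'h measure \<Rightarrow> nat
    \<Rightarrow> ennreal" where
  "minimal_error_MC = minimal_error random_uniform"

end

theory Submission
  imports Defs "HOL-Real_Asymp.Real_Asymp"
begin

text \<open>
  \<^bold>\<open>Upper bound.\<close> The algorithm is a multilevel one. Level \<open>k\<close> replaces \<open>X\<close> by a random
  element with values in the span of the first \<open>2 ^ k - 1\<close> eigenvectors; its \<open>i\<close>-th coordinate is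
  \<open>sqrt (l i)\<close> times the normal quantile of the midpoint of a dyadic interval of length
  \<open>2 ^ (-b)\<close>, so it is a function of \<open>b\<close> random bits. With \<open>b\<close> proportional to \<open>k\<close> minus the binary
  logarithm of \<open>i\<close>, a sample needs only a number of bits proportional to \<open>2 ^ k\<close>, which is the
  price of an evaluation anyway, and quantization costs no more accuracy than truncation: since
  \<open>b\<close> bits leave a mean-square error of order \<open>2 ^ (-b/2)\<close> (\<open>quantization_error_bound\<close>), the
  mean-square distance of level \<open>k\<close> from \<open>X\<close> is of order
  \<open>\<psi> k = 2 powr (-(\<beta> - 1) k) * (1 + k) powr (-\<alpha>)\<close> (\<open>level_error_bound\<close>). The leading bits of a
  fine sample also make up the coarse sample, so that consecutive levels are coupled and the
  difference of the two integrand values has second moment of order \<open>\<psi> k\<close>. Averaging \<open>N k\<close>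
  independent differences on each level \<open>k = 1, ..., L\<close> gives squared error of order
  \<open>\<psi> L + (\<Sum>k. \<psi> k / N k)\<close> at cost of order \<open>\<Sum>k. N k * 2 ^ k\<close>. The choice of \<open>N k\<close> proportional to
  \<open>sqrt (\<psi> k / 2 ^ k)\<close> turns this into error of order \<open>n powr (-1/2) * (\<Sum>k. sqrt (\<psi> k * 2 ^ k))\<close>,
  where \<open>2 ^ L\<close> is of order \<open>n\<close> (\<open>minimal_error_res_level_sum\<close>). The summands behave like
  \<open>2 powr ((2 - \<beta>) k / 2) * k powr (-\<alpha>/2)\<close>, and the four cases of the bound are the four possible
  growth rates of this sum (\<open>level_sum_bound\<close>).

  \<^bold>\<open>Lower bounds.\<close> A run depends on the integrand only through the values at the points that
  it queries, and there are few of them when the cost is small: with probability at least one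
  half, a run of an algorithm of expected cost at most \<open>n\<close> asks at most \<open>2 * n\<close> queries, all of
  them in the span of \<open>e 1, ..., e (2 * n)\<close>. Integrands are taken of the form
  \<open>\<Sum>p. \<plusminus> g p\<close>; the signs of those \<open>g p\<close> that vanish at all queried points remain hidden, and an
  average over the signs shows that the squared error is at least of the order of the sum of the
  squared integrals of the hidden \<open>g p\<close> (\<open>worst_error_lower_bound\<close>).

  If \<open>g\<close> is a normalized sum of the absolute values of the coordinates \<open>2 * n + 1, ..., 4 * n\<close>, it is
  always hidden. Its integral is at least of order \<open>sqrt (n * l (4 * n))\<close>, which is the lower bound for
  \<open>\<beta> \<le> 2\<close>.

  For \<open>\<beta> > 2\<close>, let \<open>q N\<close> be the smallest mean distance of \<open>X\<close> from \<open>N\<close> points. For a nearly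
  optimal set \<open>P\<close> of \<open>N\<close> points, where \<open>n = N div 4\<close>, let \<open>g p\<close> be half the growth
  of the distance from \<open>P\<close> when \<open>p\<close> is removed. These functions have disjoint supports, so a query reveals at most one sign, and
  by near-optimality each has an integral of at least a quarter of the decrement \<open>q (N - 1) - q N\<close>.
  Hence the error is at least of order \<open>sqrt N * (q (N - 1) - q N)\<close>
  (\<open>minimal_error_MC_ge_increment\<close>). For \<open>N = 2 ^ (2 ^ k)\<close>, small ball
  estimates bound \<open>q N\<close> from below by a multiple of \<open>ln N powr (-(\<beta> - 1)/2) * ln (ln N) powr (-\<alpha>/2)\<close>. Since \<open>q\<close> tends to zero, the
  decrements cannot from some point on all be below a small multiple of those of this function
  (\<open>frequently_large_increment\<close>). As this gives information on infinitely many \<open>N\<close> only, the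
  conclusion is one on the upper limit.
\<close>

section \<open>Power laws along dyadic blocks\<close>

text \<open>The values of \<open>i powr (-b) * ln i powr (-a)\<close> for \<open>2 ^ j \<le> i < 2 ^ (j + 1)\<close>, up to constant factors.
Writing \<open>1 + j\<close> instead of \<open>j\<close> keeps the block \<open>j = 0\<close> regular.\<close>

definition dyadic_rate :: "real \<Rightarrow> real \<Rightarrow> nat \<Rightarrow> real" where
  "dyadic_rate b a j = 2 powr (- (b * real j)) * (1 + real j) powr (- a)"

lemma dyadic_rate_pos: "0 < dyadic_rate b a j"
  by (simp add: dyadic_rate_def)

text \<open>Two numbers of the same order have powers of the same order. The sum of two constants serves
exponents of either sign.\<close>

lemma powr_comparable:
  fixes x y m M a :: real
  assumes "0 < m" "0 < y" "m * y \<le> x" "x \<le> M * y"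
  shows "x powr a \<le> (m powr a + M powr a) * y powr a"
proof -
  have x: "0 < x" using assms by (smt (verit) mult_pos_pos)
  have M: "0 < M" using assms x by (smt (verit) mult_nonpos_nonneg)
  show ?thesis
  proof (cases "0 \<le> a")
    case True
    have "x powr a \<le> (M * y) powr a" using True assms x by (intro powr_mono2) auto
    also have "\<dots> = M powr a * y powr a" using M assms by (simp add: powr_mult)
    finally show ?thesis by (simp add: algebra_simps add_increasing2)
  next
    case False
    have "x powr a \<le> (m * y) powr a" using False assms x by (intro powr_mono2') auto
    also have "\<dots> = m powr a * y powr a" using assms by (simp add: powr_mult)
    finally show ?thesis by (simp add: distrib_right add_increasing2)
  qed
qed

lemma powr_comparable_reverse:
  fixes x y m M a :: real
  assumes "0 < m" "0 < y" "m * y \<le> x" "x \<le> M * y"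
  shows "y powr a \<le> ((1/M) powr a + (1/m) powr a) * x powr a"
proof -
  have x: "0 < x" using assms by (smt (verit) mult_pos_pos)
  have M: "0 < M" using assms x by (smt (verit) mult_nonpos_nonneg)
  show ?thesis
    by (rule powr_comparable) (use assms x M in \<open>auto simp: field_simps\<close>)
qed

lemma one_plus_add_powr_le:
  "(1 + real (j + k)) powr c \<le> (1 + real j) powr c * (1 + real k) powr \<bar>c\<bar>"
proof (cases "0 \<le> c")
  case True
  have "(1 + real (j + k)) powr c \<le> ((1 + real j) * (1 + real k)) powr c"
    using True by (intro powr_mono2) (auto simp: algebra_simps)
  then show ?thesis using True by (simp add: powr_mult)
next
  case False
  have "(1 + real (j + k)) powr c \<le> (1 + real j) powr c"
    using False by (intro powr_mono2') auto
  also have "\<dots> \<le> (1 + real j) powr c * (1 + real k) powr \<bar>c\<bar>"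
    by (simp add: ge_one_powr_ge_zero)
  finally show ?thesis .
qed

lemma one_plus_powr_le_add:
  "(1 + real j) powr c \<le> (1 + real (j + k)) powr c * (1 + real k) powr \<bar>c\<bar>"
proof -
  have "(1 + real (j + k)) powr (-c) \<le> (1 + real j) powr (-c) * (1 + real k) powr \<bar>c\<bar>"
    using one_plus_add_powr_le[of j k "-c"] by simp
  then show ?thesis by (simp add: powr_minus field_simps)
qed

text \<open>As \<open>1 + j + k \<le> (1 + j) * (1 + k)\<close>, moving from \<open>j\<close> to \<open>j + k\<close> changes the rate at most by a factor
that depends on \<open>k\<close> alone. Sums of rates around an index are thereby compared with one fixed series.\<close>

lemma dyadic_rate_add_le:
  "dyadic_rate b a (j + k) \<le> dyadic_rate b a j * dyadic_rate b (- \<bar>a\<bar>) k"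
proof -
  have "2 powr (- (b * real (j + k))) = 2 powr (- (b * real j)) * (2::real) powr (- (b * real k))"
    by (simp add: powr_add[symmetric] algebra_simps)
  moreover have "(1 + real (j + k)) powr (-a) \<le> (1 + real j) powr (-a) * (1 + real k) powr \<bar>a\<bar>"
    using one_plus_add_powr_le[of j k "-a"] by simp
  ultimately show ?thesis by (simp add: dyadic_rate_def mult_ac)
qed

lemma dyadic_rate_le_add:
  "dyadic_rate b a j \<le> dyadic_rate b a (j + k) * dyadic_rate (- b) (- \<bar>a\<bar>) k"
proof -
  have "2 powr (- (b * real j)) = 2 powr (- (b * real (j + k))) * (2::real) powr (b * real k)"
    by (simp add: powr_add[symmetric] algebra_simps)
  moreover have "(1 + real j) powr (-a) \<le> (1 + real (j + k)) powr (-a) * (1 + real k) powr \<bar>a\<bar>"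
    using one_plus_powr_le_add[of j "-a" k] by simp
  ultimately show ?thesis by (simp add: dyadic_rate_def mult_ac)
qed

lemma summable_dyadic_rate:
  assumes "0 < b" shows "summable (dyadic_rate b a)"
proof -
  have "(\<lambda>k. (1 + real k) powr (- a) * 2 powr (- (b * real k / 2))) \<longlonglongrightarrow> 0"
    using assms by real_asymp
  then have "eventually (\<lambda>k. (1 + real k) powr (- a) * 2 powr (- (b * real k / 2)) < 1) sequentially"
    by (rule order_tendstoD) simp
  then have "eventually (\<lambda>k. norm (dyadic_rate b a k) \<le> (2 powr (- (b / 2))) ^ k) sequentially"
  proof (rule eventually_mono)
    fix k assume *: "(1 + real k) powr (- a) * 2 powr (- (b * real k / 2)) < 1"
    have "dyadic_rate b a k = 2 powr (- (b * real k / 2)) *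
        ((1 + real k) powr (- a) * 2 powr (- (b * real k / 2)))"
      by (simp add: dyadic_rate_def powr_add[symmetric])
    also have "\<dots> \<le> 2 powr (- (b * real k / 2)) * 1"
      using * by (intro mult_left_mono) auto
    also have "\<dots> = (2 powr (- (b / 2))) ^ k"
      by (simp add: powr_realpow[symmetric] powr_powr)
    finally show "norm (dyadic_rate b a k) \<le> (2 powr (- (b / 2))) ^ k"
      using dyadic_rate_pos[of b a k] by simp
  qed
  moreover have "summable (\<lambda>k. (2 powr (- (b / 2)) :: real) ^ k)"
    using assms by (intro summable_geometric) (auto simp: powr_less_one)
  ultimately show ?thesis using summable_comparison_test_ev by blast
qed

lemma sum_dyadic_rate_bounded:
  assumes "0 < b" 
  shows "\<exists>C>0. \<forall>n. (\<Sum>k<n. dyadic_rate b a k) \<le> C"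
proof (intro exI conjI allI)
  show "0 < suminf (dyadic_rate b a)" 
    using summable_dyadic_rate[OF assms, of a] dyadic_rate_pos by (intro suminf_pos) auto
  show "(\<Sum>k<n. dyadic_rate b a k) \<le> suminf (dyadic_rate b a)" for n
    using summable_dyadic_rate[OF assms, of a] dyadic_rate_pos
    by (intro sum_le_suminf) (auto simp: less_imp_le)
qed

lemma sum_dyadic_rate_tail:
  assumes "0 < b" 
  shows "\<exists>C>0. \<forall>l n. (\<Sum>j\<in>{l..<n}. dyadic_rate b a j) \<le> C * dyadic_rate b a l"
proof -
  obtain C where C: "C > 0" "\<And>n. (\<Sum>k<n. dyadic_rate b (- \<bar>a\<bar>) k) \<le> C"
    using sum_dyadic_rate_bounded[OF assms] by metis
  have "(\<Sum>j\<in>{l..<n}. dyadic_rate b a j) \<le> C * dyadic_rate b a l" for l n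
  proof -
    have "(\<Sum>j\<in>{l..<n}. dyadic_rate b a j) = (\<Sum>k<n - l. dyadic_rate b a (l + k))"
      by (rule sum.reindex_bij_witness[of _ "\<lambda>k. l + k" "\<lambda>j. j - l"]) auto
    also have "\<dots> \<le> (\<Sum>k<n - l. dyadic_rate b a l * dyadic_rate b (- \<bar>a\<bar>) k)"
      by (intro sum_mono dyadic_rate_add_le)
    also have "\<dots> = dyadic_rate b a l * (\<Sum>k<n - l. dyadic_rate b (- \<bar>a\<bar>) k)"
      by (simp add: sum_distrib_left)
    also have "\<dots> \<le> dyadic_rate b a l * C"
      using C(2) dyadic_rate_pos[of b a l] by (intro mult_left_mono) auto
    finally show ?thesis by (simp add: mult.commute)
  qed
  then show ?thesis using C(1) by blast
qed

text \<open>The weights decay faster towards small \<open>j\<close> than the rate grows, so the last index dominates.\<close>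

lemma sum_dyadic_rate_damped:
  assumes "b < c" 
  shows "\<exists>C>0. \<forall>l. (\<Sum>j<l. dyadic_rate b a j * 2 powr (- (c * real (l - j)))) \<le> C * dyadic_rate b a l"
proof -
  obtain C where C: "C > 0" "\<And>n. (\<Sum>k<n. dyadic_rate (c - b) (- \<bar>a\<bar>) k) \<le> C"
    using sum_dyadic_rate_bounded[of "c - b"] assms by (metis diff_gt_0_iff_gt)
  have "(\<Sum>j<l. dyadic_rate b a j * 2 powr (- (c * real (l - j)))) \<le> C * dyadic_rate b a l" for l
  proof -
    have "dyadic_rate b a j * 2 powr (- (c * real (l - j)))
        \<le> dyadic_rate b a l * dyadic_rate (c - b) (- \<bar>a\<bar>) (l - j)" if "j < l" for j
    proof -
      have "dyadic_rate b a j * 2 powr (- (c * real (l - j)))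
          \<le> dyadic_rate b a l * dyadic_rate (- b) (- \<bar>a\<bar>) (l - j) * 2 powr (- (c * real (l - j)))"
        using dyadic_rate_le_add[of b a j "l - j"] that by (intro mult_right_mono) auto
      also have "\<dots> = dyadic_rate b a l * dyadic_rate (c - b) (- \<bar>a\<bar>) (l - j)"
        by (simp add: dyadic_rate_def powr_add[symmetric] left_diff_distrib powr_diff powr_minus field_simps)
      finally show ?thesis .
    qed
    then have "(\<Sum>j<l. dyadic_rate b a j * 2 powr (- (c * real (l - j))))
       \<le> (\<Sum>j<l. dyadic_rate b a l * dyadic_rate (c - b) (- \<bar>a\<bar>) (l - j))"
      by (intro sum_mono) auto
    also have "\<dots> = dyadic_rate b a l * (\<Sum>j<l. dyadic_rate (c - b) (- \<bar>a\<bar>) (l - j))"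
      by (simp add: sum_distrib_left)
    also have "(\<Sum>j<l. dyadic_rate (c - b) (- \<bar>a\<bar>) (l - j))
        \<le> (\<Sum>j<Suc l. dyadic_rate (c - b) (- \<bar>a\<bar>) j)"
    proof -
      have "(\<Sum>j<l. dyadic_rate (c - b) (- \<bar>a\<bar>) (l - j)) = (\<Sum>j\<in>{1..l}. dyadic_rate (c - b) (- \<bar>a\<bar>) j)"
        by (rule sum.reindex_bij_witness[of _ "\<lambda>k. l - k" "\<lambda>j. l - j"]) auto
      also have "\<dots> \<le> (\<Sum>j<Suc l. dyadic_rate (c - b) (- \<bar>a\<bar>) j)"
        by (intro sum_mono2) (auto intro: less_imp_le[OF dyadic_rate_pos])
      finally show ?thesis .
    qed
    also have "\<dots> \<le> C" by (rule C(2))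
    finally show ?thesis using dyadic_rate_pos[of b a l] by (simp add: mult.commute)
  qed
  then show ?thesis using C(1) by blast
qed

text \<open>A limit controls only almost all terms; the remaining ones are finitely many positive numbers.\<close>

lemma positive_bounds_of_convergent:
  fixes s :: "nat \<Rightarrow> real"
  assumes "s \<longlonglongrightarrow> L" "0 < L" "\<And>i. k \<le> i \<Longrightarrow> 0 < s i"
  shows "\<exists>c>0. \<exists>C. \<forall>i\<ge>k. c \<le> s i \<and> s i \<le> C"
proof -
  have "eventually (\<lambda>i. L / 2 < s i) sequentially" "eventually (\<lambda>i. s i < 2 * L) sequentially"
    using order_tendstoD(1)[OF assms(1), of "L / 2"] order_tendstoD(2)[OF assms(1), of "2 * L"] assms(2) by auto
  then obtain n where n: "\<And>i. n \<le> i \<Longrightarrow> L / 2 < s i \<and> s i < 2 * L"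
    unfolding eventually_sequentially by (metis le_trans linorder_linear)
  let ?A = "insert (L/2) (s ` {k..<n})" and ?B = "insert (2*L) (s ` {k..<n})"
  have "0 < Min ?A" using assms by (subst Min_gr_iff) auto
  moreover have "Min ?A \<le> s i" if "k \<le> i" for i
  proof (cases "i < n")
    case True then show ?thesis using that by (intro Min_le) auto
  next
    case False
    have "Min ?A \<le> L/2" by (rule Min_le) auto
    with n[of i] False show ?thesis by linarith
  qed
  moreover have "s i \<le> Max ?B" if "k \<le> i" for i
  proof (cases "i < n")
    case True then show ?thesis using that by (intro Max_ge) auto
  next
    case False
    have "2*L \<le> Max ?B" by (rule Max_ge) auto
    with n[of i] False show ?thesis by linarith
  qed
  ultimately show ?thesis by blast
qed

lemma power_law_bounds:
  fixes l :: "nat \<Rightarrow> real"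
  assumes "\<And>i. 1 \<le> i \<Longrightarrow> 0 < l i" "L > 0"
    and "(\<lambda>i. l i * real i powr \<beta> * ln (real i) powr \<alpha>) \<longlonglongrightarrow> L"
  shows "\<exists>c>0. \<exists>C>0. \<forall>i\<ge>2. c * (real i powr (-\<beta>) * ln (real i) powr (-\<alpha>)) \<le> l i \<and>
             l i \<le> C * (real i powr (-\<beta>) * ln (real i) powr (-\<alpha>))"
proof -
  have pos: "0 < l i * real i powr \<beta> * ln (real i) powr \<alpha>" if "2 \<le> i" for i
    using assms(1)[of i] that by simp
  obtain c C where c: "c > 0"
    "\<And>i. 2 \<le> i \<Longrightarrow> c \<le> l i * real i powr \<beta> * ln (real i) powr \<alpha> \<and> l i * real i powr \<beta> * ln (real i) powr \<alpha> \<le> C"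
    using positive_bounds_of_convergent[OF assms(3) assms(2) pos] by metis
  have "C > 0" using c(1) c(2)[of 2] by linarith
  moreover have "c * (real i powr (-\<beta>) * ln (real i) powr (-\<alpha>)) \<le> l i \<and>
             l i \<le> C * (real i powr (-\<beta>) * ln (real i) powr (-\<alpha>))" if "2 \<le> i" for i
  proof -
    have "0 < real i powr \<beta>" "0 < ln (real i) powr \<alpha>" using that by auto
    with c(2)[OF that] show ?thesis by (simp add: powr_minus field_simps)
  qed
  ultimately show ?thesis using c(1) by blast
qed

lemma power_law_dyadic_bounds:
  fixes l :: "nat \<Rightarrow> real"
  assumes "\<And>i. 1 \<le> i \<Longrightarrow> 0 < l i" "L > 0"
    and "(\<lambda>i. l i * real i powr \<beta> * ln (real i) powr \<alpha>) \<longlonglongrightarrow> L"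
  shows "\<exists>c>0. \<exists>C>0. \<forall>j i. 2^j \<le> i \<longrightarrow> i < 2^(Suc j) \<longrightarrow>
           c * dyadic_rate \<beta> \<alpha> j \<le> l i \<and> l i \<le> C * dyadic_rate \<beta> \<alpha> j"
proof -
  obtain c C where c: "c > 0" "C > 0"
    "\<And>i. 2 \<le> i \<Longrightarrow> c * (real i powr (-\<beta>) * ln (real i) powr (-\<alpha>)) \<le> l i \<and>
             l i \<le> C * (real i powr (-\<beta>) * ln (real i) powr (-\<alpha>))"
    using power_law_bounds[OF assms] by metis
  define A1 where "A1 = (1::real) powr (-\<beta>) + 2 powr (-\<beta>)"
  define A2 where "A2 = (ln 2 / 2::real) powr (-\<alpha>) + (ln 2) powr (-\<alpha>)"
  define B1 where "B1 = (1/2::real) powr (-\<beta>) + (1/1) powr (-\<beta>)"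
  define B2 where "B2 = (1 / ln 2::real) powr (-\<alpha>) + (1/(ln 2 / 2)) powr (-\<alpha>)"
  have p: "0 < A1" "0 < A2" "0 < B1" "0 < B2" unfolding A1_def A2_def B1_def B2_def by (auto intro!: add_pos_pos)
  have main: "c / (B1 * B2) * dyadic_rate \<beta> \<alpha> j \<le> l i \<and> l i \<le> C * (A1 * A2) * dyadic_rate \<beta> \<alpha> j"
    if "2^j \<le> i" "i < 2^(Suc j)" "1 \<le> j" for i j
  proof -
    have i2: "2 \<le> i" using that power_increasing[of 1 j "2::nat"] by simp
    have r: "2^j \<le> real i" "real i \<le> 2 * 2^j"
      using that(1,2) by (metis of_nat_le_iff of_nat_numeral of_nat_power,
        metis less_imp_le of_nat_le_iff of_nat_numeral of_nat_power power_Suc)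
    have lr: "real j * ln 2 \<le> ln (real i)" "ln (real i) \<le> real (Suc j) * ln 2"
    proof -
      have "ln (2^j) \<le> ln (real i)" using r i2 by (subst ln_le_cancel_iff) auto
      then show "real j * ln 2 \<le> ln (real i)" by (simp add: ln_realpow)
      have "ln (real i) \<le> ln (2^Suc j)" using r i2 by (subst ln_le_cancel_iff) auto
      then show "ln (real i) \<le> real (Suc j) * ln 2" by (simp only: ln_realpow)
    qed
    have lr': "ln 2 / 2 * (1 + real j) \<le> ln (real i)" "ln (real i) \<le> ln 2 * (1 + real j)"
    proof -
      have "ln 2 / 2 * (1 + real j) \<le> real j * ln 2" using that(3) by (simp add: field_simps)
      with lr show "ln 2 / 2 * (1 + real j) \<le> ln (real i)" by linarith
      show "ln (real i) \<le> ln 2 * (1 + real j)" using lr by (simp add: algebra_simps)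
    qed
    have pj: "(2::real)^j = 2 powr real j" by (simp add: powr_realpow)
    have e: "(2^j) powr (-\<beta>) = 2 powr (- (\<beta> * real j))" by (simp add: pj powr_powr mult.commute)
    have u1: "real i powr (-\<beta>) \<le> A1 * (2^j) powr (-\<beta>)" unfolding A1_def using r by (intro powr_comparable) auto
    have u2: "ln (real i) powr (-\<alpha>) \<le> A2 * (1 + real j) powr (-\<alpha>)" unfolding A2_def using lr' by (intro powr_comparable) auto
    have l1: "(2^j) powr (-\<beta>) \<le> B1 * real i powr (-\<beta>)" unfolding B1_def using r by (intro powr_comparable_reverse) auto
    have l2: "(1 + real j) powr (-\<alpha>) \<le> B2 * ln (real i) powr (-\<alpha>)" unfolding B2_def using lr' by (intro powr_comparable_reverse) auto
    have "real i powr (-\<beta>) * ln (real i) powr (-\<alpha>) \<le> (A1 * (2^j) powr (-\<beta>)) * (A2 * (1 + real j) powr (-\<alpha>))"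
      using u1 u2 p by (intro mult_mono) auto
    also have "\<dots> = A1 * A2 * dyadic_rate \<beta> \<alpha> j" by (simp add: dyadic_rate_def e)
    finally have U: "real i powr (-\<beta>) * ln (real i) powr (-\<alpha>) \<le> A1 * A2 * dyadic_rate \<beta> \<alpha> j" .
    have "dyadic_rate \<beta> \<alpha> j \<le> (B1 * real i powr (-\<beta>)) * (B2 * ln (real i) powr (-\<alpha>))"
      unfolding dyadic_rate_def e[symmetric] using l1 l2 p by (intro mult_mono) auto
    then have Lo: "c / (B1 * B2) * dyadic_rate \<beta> \<alpha> j \<le> c * (real i powr (-\<beta>) * ln (real i) powr (-\<alpha>))"
      using c(1) p by (simp add: field_simps)
    have "C * (real i powr (-\<beta>) * ln (real i) powr (-\<alpha>)) \<le> C * (A1 * A2 * dyadic_rate \<beta> \<alpha> j)"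
      using U c(2) by (intro mult_left_mono) auto
    with Lo c(3)[OF i2] show ?thesis by (simp add: mult_ac)
  qed
  have z: "dyadic_rate \<beta> \<alpha> 0 = 1" by (simp add: dyadic_rate_def)
  define c' where "c' = min (c / (B1 * B2)) (l 1)"
  define C' where "C' = max (C * (A1 * A2)) (l 1)"
  have "c' > 0" "C' > 0" unfolding c'_def C'_def using c p assms(1)[of 1] by (auto simp: less_max_iff_disj)
  moreover have "c' * dyadic_rate \<beta> \<alpha> j \<le> l i \<and> l i \<le> C' * dyadic_rate \<beta> \<alpha> j"
    if "2^j \<le> i" "i < 2^(Suc j)" for i j
  proof (cases "j = 0")
    case True
    then have "i = 1" using that by simp
    then show ?thesis using True by (simp add: z c'_def C'_def)
  next
    case False
    have "c' * dyadic_rate \<beta> \<alpha> j \<le> c / (B1 * B2) * dyadic_rate \<beta> \<alpha> j"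
      "C * (A1 * A2) * dyadic_rate \<beta> \<alpha> j \<le> C' * dyadic_rate \<beta> \<alpha> j"
      unfolding c'_def C'_def by (intro mult_right_mono less_imp_le[OF dyadic_rate_pos] min.cobounded1 max.cobounded1)+
    with main[OF that] False show ?thesis by auto
  qed
  ultimately show ?thesis by blast
qed

section \<open>Runs and their queries\<close>

text \<open>Only the set of queried points is recorded: a repeated query costs again but reveals nothing.\<close>

definition queries :: "(nat \<Rightarrow> 'h::real_inner) \<Rightarrow> (nat \<Rightarrow> real) \<Rightarrow> program \<Rightarrow> ('h \<Rightarrow> real)
    \<Rightarrow> (nat \<Rightarrow> real) \<Rightarrow> 'h set" where
  "queries e l P f \<omega> = {sample_point e (config_at e l P f \<omega> k) b m | k a b m.
     \<not> halted P (config_at e l P f \<omega> k) \<and> P ! pc (config_at e l P f \<omega> k) = Eval a b m}"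

lemma config_at_0: "config_at e l P f \<omega> 0 = initial"
  by (simp add: config_at_def)

lemma config_at_Suc: "config_at e l P f \<omega> (Suc k) = step e l P f \<omega> (config_at e l P f \<omega> k)"
  by (simp add: config_at_def)

lemma exec_cong:
  assumes "\<And>a b m. i = Eval a b m \<Longrightarrow> f (sample_point e c b m) = g (sample_point e c b m)"
  shows "exec e l f \<omega> i c = exec e l g \<omega> i c"
  using assms by (cases i) auto

text \<open>The queries may be chosen adaptively, but each of them is determined by the previous answers.\<close>

lemma config_at_cong:
  assumes "\<And>x. x \<in> queries e l P f \<omega> \<Longrightarrow> f x = g x"
  shows "config_at e l P g \<omega> k = config_at e l P f \<omega> k"
proof (induction k)
  case (Suc k)
  let ?c = "config_at e l P f \<omega> k"
  have "exec e l g \<omega> (P ! pc ?c) ?c = exec e l f \<omega> (P ! pc ?c) ?c" if "\<not> halted P ?c"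
    by (rule exec_cong, rule assms[symmetric]) (use that in \<open>auto simp: queries_def\<close>)
  then show ?case by (simp add: config_at_Suc Suc.IH step_def)
qed (simp add: config_at_0)

lemma run_cong:
  assumes "\<And>x. x \<in> queries e l P f \<omega> \<Longrightarrow> f x = g x"
  shows "alg_output e l P g \<omega> = alg_output e l P f \<omega>"
    and "alg_cost e l P g \<omega> = alg_cost e l P f \<omega>"
    and "queries e l P g \<omega> = queries e l P f \<omega>"
proof -
  have "config_at e l P g \<omega> = config_at e l P f \<omega>"
    by (intro ext config_at_cong) (rule assms)
  then show "alg_output e l P g \<omega> = alg_output e l P f \<omega>"
    "alg_cost e l P g \<omega> = alg_cost e l P f \<omega>"
    "queries e l P g \<omega> = queries e l P f \<omega>"
    by (simp_all add: alg_output_def alg_cost_def queries_def)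
qed

text \<open>The description of \<open>eval_cost\<close> is definite because the subspaces increase.\<close>

lemma eval_cost_eqI:
  assumes "1 \<le> n" "x \<in> subspace_H e n" "x \<notin> subspace_H e (n - 1)"
  shows "eval_cost e x = n"
  unfolding eval_cost_def
proof (rule the_equality)
  show "1 \<le> n \<and> x \<in> subspace_H e n - subspace_H e (n - 1)" using assms by blast
  have mono: "subspace_H e p \<subseteq> subspace_H e q" if "p \<le> q" for p q
    using that by (auto simp: subspace_H_def intro!: span_mono image_mono)
  fix m assume m: "1 \<le> m \<and> x \<in> subspace_H e m - subspace_H e (m - 1)"
  have "\<not> m \<le> n - 1" "\<not> n \<le> m - 1" using mono[of m "n - 1"] mono[of n "m - 1"] m assms by auto
  then show "m = n" by linarith
qed

lemma eval_cost_bounds: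
  assumes "x \<in> span (e ` {1..m})" "1 \<le> m"
  shows "1 \<le> eval_cost e x" "eval_cost e x \<le> m" "x \<in> span (e ` {1..eval_cost e x})"
proof -
  define n where "n = (LEAST n. x \<in> subspace_H e n)"
  have xm: "x \<in> subspace_H e m" using assms by (auto simp: subspace_H_def)
  have 1: "x \<in> subspace_H e n" unfolding n_def by (rule LeastI) (rule xm)
  have 2: "n \<le> m" unfolding n_def by (rule Least_le) (rule xm)
  have 3: "n \<noteq> 0" using 1 by (auto simp: subspace_H_def intro!: Nat.gr0I)
  have 4: "x \<notin> subspace_H e (n - 1)" using not_less_Least[of "n - 1" "\<lambda>n. x \<in> subspace_H e n"] 3
    by (auto simp: n_def[symmetric])
  have "eval_cost e x = n" using 1 3 4 by (intro eval_cost_eqI) auto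
  then show "1 \<le> eval_cost e x" "eval_cost e x \<le> m" "x \<in> span (e ` {1..eval_cost e x})"
    using 1 2 3 by (auto simp: subspace_H_def)
qed

lemma sample_point_in_span: "sample_point e c b m \<in> span (e ` {1..max 1 (resolve c m)})"
  unfolding sample_point_def by (intro span_sum span_mul span_base) auto

lemma queries_in_span:
  assumes "x \<in> queries e l P f \<omega>"
  shows "1 \<le> eval_cost e x" "x \<in> span (e ` {1..eval_cost e x})"
proof -
  obtain c b m where "x = sample_point e c b m" using assms by (auto simp: queries_def)
  then have "x \<in> span (e ` {1..max 1 (resolve c m)})" using sample_point_in_span by metis
  from eval_cost_bounds[OF this] show "1 \<le> eval_cost e x" "x \<in> span (e ` {1..eval_cost e x})" by auto
qed

text \<open>Every queried point is charged to one step at which it is queried, and different points are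
charged to different steps.\<close>

lemma sum_eval_cost_le_alg_cost:
  assumes "finite V" "V \<subseteq> queries e l P f \<omega>"
  shows "of_nat (\<Sum>x\<in>V. eval_cost e x) \<le> alg_cost e l P f \<omega>"
proof -
  let ?c = "config_at e l P f \<omega>"
  let ?w = "\<lambda>k. if halted P (?c k) then 0 else of_nat (instr_cost e (P ! pc (?c k)) (?c k)) :: ennreal"
  have "\<exists>k. \<exists>a b m. \<not> halted P (?c k) \<and> P ! pc (?c k) = Eval a b m \<and> x = sample_point e (?c k) b m"
    if "x \<in> V" for x
  proof -
    have "x \<in> queries e l P f \<omega>" using assms(2) that by blast
    then show ?thesis unfolding queries_def by blast
  qed
  then obtain t where t: "\<And>x. x \<in> V \<Longrightarrow>
      \<exists>a b m. \<not> halted P (?c (t x)) \<and> P ! pc (?c (t x)) = Eval a b m \<and> x = sample_point e (?c (t x)) b m"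
    by metis
  have inj: "inj_on t V"
  proof (rule inj_onI)
    fix x y assume "x \<in> V" "y \<in> V" "t x = t y"
    then show "x = y" using t[of x] t[of y] by auto
  qed
  have "of_nat (\<Sum>x\<in>V. eval_cost e x) = (\<Sum>x\<in>V. ?w (t x))"
    unfolding of_nat_sum by (intro sum.cong refl) (use t in force)
  also have "\<dots> = (\<Sum>k\<in>t ` V. ?w k)" using inj by (simp add: sum.reindex)
  also have "\<dots> \<le> (\<Sum>k. ?w k)" using assms(1) by (intro sum_le_suminf) auto
  also have "\<dots> = alg_cost e l P f \<omega>" by (simp add: alg_cost_def Let_def)
  finally show ?thesis .
qed

lemma queries_bounded_by_cost:
  assumes "alg_cost e l P f \<omega> \<le> of_nat n"
  shows "finite (queries e l P f \<omega>)" "card (queries e l P f \<omega>) \<le> n"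
    and "\<And>x. x \<in> queries e l P f \<omega> \<Longrightarrow> x \<in> span (e ` {1..n})"
proof -
  have *: "card V \<le> n" if "finite V" "V \<subseteq> queries e l P f \<omega>" for V
  proof -
    have "card V \<le> (\<Sum>x\<in>V. eval_cost e x)"
      using sum_mono[of V "\<lambda>_. 1" "eval_cost e"] queries_in_span(1) that(2) by fastforce
    also have "\<dots> \<le> n"
      using order_trans[OF sum_eval_cost_le_alg_cost[OF that] assms] by (simp only: of_nat_le_iff)
    finally show ?thesis .
  qed
  show fin: "finite (queries e l P f \<omega>)"
  proof (rule ccontr)
    assume "infinite (queries e l P f \<omega>)"
    then obtain V where "V \<subseteq> queries e l P f \<omega>" "finite V" "card V = Suc n"
      using infinite_arbitrarily_large by blast
    then show False using *[of V] by simp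
  qed
  show "card (queries e l P f \<omega>) \<le> n" using * fin by blast
  fix x assume x: "x \<in> queries e l P f \<omega>"
  have "eval_cost e x \<le> n"
    using order_trans[OF sum_eval_cost_le_alg_cost[of "{x}" e l P f \<omega>] assms] x by simp
  then have "span (e ` {1..eval_cost e x}) \<subseteq> span (e ` {1..n})"
    by (intro span_mono image_mono) auto
  then show "x \<in> span (e ` {1..n})" using queries_in_span(2)[OF x] by blast
qed

section \<open>Averaging over signs\<close>

text \<open>A family of signs indexed by \<open>I\<close> is encoded as the subset of \<open>I\<close> with sign \<open>+1\<close>, so that the
finitely many families form \<open>Pow I\<close>.\<close>

definition sgn_in :: "'i set \<Rightarrow> 'i \<Rightarrow> real" where
  "sgn_in E p = (if p \<in> E then 1 else -1)"

definition flip :: "'i \<Rightarrow> 'i set \<Rightarrow> 'i set" where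
  "flip p E = (if p \<in> E then E - {p} else insert p E)"

lemma flip_flip [simp]: "flip p (flip p E) = E"
  by (cases "p \<in> E") (auto simp: flip_def)

lemma sgn_in_flip: "sgn_in (flip p E) q = (if q = p then - sgn_in E q else sgn_in E q)"
  by (cases "p \<in> E"; cases "q = p") (simp_all add: sgn_in_def flip_def)

lemma sgn_in_squared [simp]: "sgn_in E p * sgn_in E p = 1"
  by (simp add: sgn_in_def)

text \<open>Flipping \<open>p\<close> is an involution of \<open>A\<close> that changes the sign of the summand.\<close>

lemma sum_flip_invariant_eq_0:
  fixes h :: "'i set \<Rightarrow> real"
  assumes "\<And>E. E \<in> A \<Longrightarrow> flip p E \<in> A" "\<And>E. E \<in> A \<Longrightarrow> h (flip p E) = h E"
  shows "(\<Sum>E\<in>A. sgn_in E p * h E) = 0"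
proof -
  have "(\<Sum>E\<in>A. sgn_in E p * h E) = (\<Sum>E\<in>A. - (sgn_in E p * h E))"
    by (rule sum.reindex_bij_witness[of _ "flip p" "flip p"])
      (use assms in \<open>simp_all add: sgn_in_flip\<close>)
  then show ?thesis by (simp add: sum_negf)
qed

text \<open>Here \<open>B E\<close> stands for the output for the integrand with signs \<open>E\<close>, and \<open>R E\<close> for the set of
indices whose signs it does not reveal. The part of the signed sum that belongs to \<open>I - R E\<close> can be
merged with \<open>B E\<close>. When the square is expanded, every mixed term contains a hidden sign to the
first power and cancels in the sum over \<open>A\<close>; what remains are the squares of \<open>a p\<close> for hidden
\<open>p\<close>. The sets \<open>R E\<close> depend on \<open>E\<close>, as the algorithm may be adaptive, but not on the signs of their
own elements.\<close>

lemma sum_squares_under_flips: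
  fixes a :: "'i \<Rightarrow> real" and B :: "'i set \<Rightarrow> real"
  assumes fin: "finite I" "finite A"
    and sub: "\<And>E. E \<in> A \<Longrightarrow> R E \<subseteq> I"
    and inv: "\<And>E p. E \<in> A \<Longrightarrow> p \<in> R E \<Longrightarrow> flip p E \<in> A \<and> R (flip p E) = R E \<and> B (flip p E) = B E"
    and large: "\<And>E. E \<in> A \<Longrightarrow> r \<le> card (R E)"
    and a: "\<And>p. p \<in> I \<Longrightarrow> \<delta> \<le> \<bar>a p\<bar>" "0 \<le> \<delta>"
  shows "real (card A) * (real r * \<delta>\<^sup>2) \<le> (\<Sum>E\<in>A. ((\<Sum>p\<in>I. sgn_in E p * a p) - B E)\<^sup>2)"
proof -
  \<comment> \<open>The output after subtraction of the contribution of the revealed signs.\<close>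
  define C where "C E = B E - (\<Sum>p\<in>I - R E. sgn_in E p * a p)" for E
  \<comment> \<open>The cofactor of the sign of \<open>p\<close> in the mixed terms; it does not contain this sign.\<close>
  define h where "h p E = a p * ((\<Sum>q\<in>R E - {p}. sgn_in E q * a q) - 2 * C E)" for p E
  have finR: "finite (R E)" if "E \<in> A" for E using sub[OF that] fin finite_subset by blast
  have term_eq: "((\<Sum>p\<in>I. sgn_in E p * a p) - B E)\<^sup>2
      = (\<Sum>p\<in>R E. (a p)\<^sup>2) + (\<Sum>p\<in>R E. sgn_in E p * h p E) + (C E)\<^sup>2" if "E \<in> A" for E
  proof -
    let ?S = "\<Sum>p\<in>R E. sgn_in E p * a p"
    have "(\<Sum>p\<in>I. sgn_in E p * a p) = (\<Sum>p\<in>I - R E. sgn_in E p * a p) + ?S"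
      using sub[OF that] fin(1) by (rule sum.subset_diff)
    then have "((\<Sum>p\<in>I. sgn_in E p * a p) - B E)\<^sup>2 = ?S * (?S - 2 * C E) + (C E)\<^sup>2"
      by (simp add: C_def power2_eq_square algebra_simps)
    also have "?S * (?S - 2 * C E) = (\<Sum>p\<in>R E. sgn_in E p * a p * (?S - 2 * C E))"
      by (simp add: sum_distrib_right)
    also have "\<dots> = (\<Sum>p\<in>R E. (a p)\<^sup>2 + sgn_in E p * h p E)"
    proof (rule sum.cong[OF refl])
      fix p assume p: "p \<in> R E"
      have "?S = sgn_in E p * a p + (\<Sum>q\<in>R E - {p}. sgn_in E q * a q)"
        using finR[OF that] p by (rule sum.remove)
      then have "sgn_in E p * a p * (?S - 2 * C E)
          = (sgn_in E p * sgn_in E p) * (a p)\<^sup>2 + sgn_in E p * h p E"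
        unfolding h_def power2_eq_square by algebra
      then show "sgn_in E p * a p * (?S - 2 * C E) = (a p)\<^sup>2 + sgn_in E p * h p E"
        by simp
    qed
    finally show ?thesis by (simp add: sum.distrib)
  qed
  have "(\<Sum>E\<in>A. \<Sum>p\<in>R E. sgn_in E p * h p E) = (\<Sum>E\<in>A. \<Sum>p\<in>{p\<in>I. p \<in> R E}. sgn_in E p * h p E)"
    by (intro sum.cong refl) (use sub in blast)
  also have "\<dots> = (\<Sum>p\<in>I. \<Sum>E\<in>{E\<in>A. p \<in> R E}. sgn_in E p * h p E)"
    using fin by (intro sum.swap_restrict) auto
  also have "\<dots> = 0"
  proof (rule sum.neutral, safe)
    fix p assume "p \<in> I"
    show "(\<Sum>E\<in>{E\<in>A. p \<in> R E}. sgn_in E p * h p E) = 0"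
    proof (rule sum_flip_invariant_eq_0)
      fix E assume "E \<in> {E\<in>A. p \<in> R E}"
      then have E: "E \<in> A" "p \<in> R E" by auto
      note i = inv[OF this]
      then show "flip p E \<in> {E\<in>A. p \<in> R E}" using E by auto
      have "(\<Sum>q\<in>I - R E. sgn_in (flip p E) q * a q) = (\<Sum>q\<in>I - R E. sgn_in E q * a q)"
        by (intro sum.cong refl) (use E in \<open>auto simp: sgn_in_flip\<close>)
      moreover have "(\<Sum>q\<in>R E - {p}. sgn_in (flip p E) q * a q) = (\<Sum>q\<in>R E - {p}. sgn_in E q * a q)"
        by (intro sum.cong refl) (auto simp: sgn_in_flip)
      ultimately show "h p (flip p E) = h p E" using i by (simp add: h_def C_def)
    qed
  qed
  finally have cross: "(\<Sum>E\<in>A. \<Sum>p\<in>R E. sgn_in E p * h p E) = 0" .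
  have "real r * \<delta>\<^sup>2 \<le> (\<Sum>p\<in>R E. (a p)\<^sup>2)" if "E \<in> A" for E
  proof -
    have "real r * \<delta>\<^sup>2 \<le> real (card (R E)) * \<delta>\<^sup>2"
      using large[OF that] by (intro mult_right_mono) auto
    also have "\<dots> = (\<Sum>p\<in>R E. \<delta>\<^sup>2)" by simp
    also have "\<dots> \<le> (\<Sum>p\<in>R E. (a p)\<^sup>2)"
      using a sub[OF that] by (intro sum_mono) (simp add: abs_le_square_iff[symmetric] subset_iff)
    finally show ?thesis .
  qed
  then have "real (card A) * (real r * \<delta>\<^sup>2) \<le> (\<Sum>E\<in>A. \<Sum>p\<in>R E. (a p)\<^sup>2)"
    using sum_mono[of A "\<lambda>_. real r * \<delta>\<^sup>2"] by simp
  also have "\<dots> \<le> (\<Sum>E\<in>A. (\<Sum>p\<in>R E. (a p)\<^sup>2) + (C E)\<^sup>2)"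
    by (intro sum_mono) simp
  also have "\<dots> = (\<Sum>E\<in>A. ((\<Sum>p\<in>I. sgn_in E p * a p) - B E)\<^sup>2)"
    using cross by (simp add: term_eq sum.distrib)
  finally show ?thesis .
qed

section \<open>Hidden summands force errors\<close>

lemma ennreal_sqrt_leD:
  assumes "ennreal_sqrt q \<le> ennreal w" "0 \<le> w"
  shows "q \<le> ennreal (w\<^sup>2)"
proof -
  have "q \<noteq> \<infinity>" using assms by (auto simp: ennreal_sqrt_def top_unique)
  then obtain r where r: "q = ennreal r" "0 \<le> r" by (cases q) auto
  then have "sqrt r \<le> w" using assms by (simp add: ennreal_sqrt_def)
  then have "r \<le> w\<^sup>2" by (metis r(2) real_sqrt_le_iff real_sqrt_pow2 real_sqrt_abs abs_of_nonneg assms(2))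
  then show ?thesis using r by (simp add: ennreal_leI)
qed

lemma prob_space_generator: "prob_space \<rho> \<Longrightarrow> prob_space (generator \<rho>)"
  unfolding generator_def by (intro prob_space_PiM)

lemma (in prob_space) prob_cost_le_twice:
  assumes [measurable]: "u \<in> borel_measurable M" and "(\<integral>\<^sup>+x. u x \<partial>M) \<le> of_nat n" "1 \<le> n"
  shows "ennreal (1/2) \<le> emeasure M {x\<in>space M. u x \<le> of_nat (2 * n)}"
proof -
  let ?B = "{x\<in>space M. u x \<le> of_nat (2 * n)}"
  define c where "c = ennreal (1 / real (2 * n))"
  let ?A = "{x\<in>space M. 1 \<le> c * u x}"
  have "emeasure M ?A \<le> c * (\<integral>\<^sup>+x. u x \<partial>M)"
    using nn_integral_Markov_inequality[of u "space M" M c] by simp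
  also have "\<dots> \<le> c * ennreal (real n)"
    using assms(2) by (intro mult_left_mono) (auto simp: ennreal_of_nat_eq_real_of_nat)
  also have "\<dots> = ennreal (1/2)" using assms(3) by (simp add: c_def ennreal_mult'[symmetric] del: ennreal_half)
  finally have A: "emeasure M ?A \<le> ennreal (1/2)" .
  have "space M - ?B \<subseteq> ?A"
  proof safe
    fix x assume x: "x \<in> space M" "\<not> u x \<le> of_nat (2 * n)"
    have "1 = c * ennreal (real (2 * n))"
      using assms(3) by (simp add: c_def ennreal_mult'[symmetric])
    also have "\<dots> \<le> c * u x"
      using x by (intro mult_left_mono) (auto simp: ennreal_of_nat_eq_real_of_nat)
    finally show "1 \<le> c * u x" .
  qed
  then have "emeasure M (space M - ?B) \<le> emeasure M ?A"
    by (intro emeasure_mono) measurable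
  with A have C: "emeasure M (space M - ?B) \<le> ennreal (1/2)" by simp
  have "prob (space M - ?B) = 1 - prob ?B" by (intro prob_compl) measurable
  moreover have "prob (space M - ?B) \<le> 1/2" using C unfolding emeasure_eq_measure by (subst (asm) ennreal_le_iff) auto
  ultimately have "1/2 \<le> prob ?B" by simp
  then show ?thesis unfolding emeasure_eq_measure by (rule ennreal_leI)
qed

text \<open>The bound is an average over the signs and over the random numbers. By Markov's inequality at least
half of the runs for each integrand cost at most \<open>2 * n\<close>; only these are used. For fixed random
numbers, the sign of a summand that vanishes at all queried points can be flipped without any
effect on the run, so \<open>sum_squares_under_flips\<close> applies.\<close>

lemma worst_error_lower_bound:
  assumes \<rho>: "prob_space \<rho>" "sets \<rho> = sets borel"
    and P: "P \<in> algorithms \<rho> e l" "worst_cost \<rho> e l P \<le> of_nat n" "1 \<le> n"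
    and I: "finite I"
    and lip: "\<And>E. E \<subseteq> I \<Longrightarrow> (\<lambda>x. \<Sum>p\<in>I. sgn_in E p * g p x) \<in> Lip1"
    and int: "\<And>p. p \<in> I \<Longrightarrow> integrable \<mu> (g p)"
    and \<delta>: "0 \<le> \<delta>" "\<And>p. p \<in> I \<Longrightarrow> \<delta> \<le> \<bar>\<integral>x. g p x \<partial>\<mu>\<bar>"
    and unseen: "\<And>V. finite V \<Longrightarrow> card V \<le> 2 * n \<Longrightarrow> V \<subseteq> span (e ` {1..2 * n})
       \<Longrightarrow> r \<le> card {p\<in>I. \<forall>x\<in>V. g p x = 0}"
  shows "ennreal (sqrt (real r / 2) * \<delta>) \<le> worst_error \<rho> e l \<mu> P"
proof -
  define F where "F E = (\<lambda>x. \<Sum>p\<in>I. sgn_in E p * g p x)" for E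
  define a where "a p = (\<integral>x. g p x \<partial>\<mu>)" for p
  let ?out = "\<lambda>E. alg_output e l P (F E)" and ?cost = "\<lambda>E. alg_cost e l P (F E)"
  let ?N = "generator \<rho>"
  interpret N: prob_space ?N using prob_space_generator[OF \<rho>(1)] .
  have FL: "F E \<in> Lip1" if "E \<in> Pow I" for E using lip that by (simp add: F_def)
  have meas[measurable]: "?out E \<in> borel_measurable ?N" "?cost E \<in> borel_measurable ?N" if "E \<in> Pow I" for E
    using P(1) FL[OF that] by (auto simp: algorithms_def)
  have S: "(\<integral>x. F E x \<partial>\<mu>) = (\<Sum>p\<in>I. sgn_in E p * a p)" for E
    unfolding F_def a_def using int by (subst Bochner_Integration.integral_sum) auto
  have pw: "real (card {E\<in>Pow I. ?cost E \<omega> \<le> of_nat (2 * n)}) * (real r * \<delta>\<^sup>2)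
      \<le> (\<Sum>E\<in>{E\<in>Pow I. ?cost E \<omega> \<le> of_nat (2 * n)}. ((\<Sum>p\<in>I. sgn_in E p * a p) - ?out E \<omega>)\<^sup>2)" for \<omega>
  proof (rule sum_squares_under_flips)
    define R where "R E = {p\<in>I. \<forall>x\<in>queries e l P (F E) \<omega>. g p x = 0}" for E
    show "finite I" "finite {E\<in>Pow I. ?cost E \<omega> \<le> of_nat (2 * n)}" using I by auto
    show "R E \<subseteq> I" for E by (auto simp: R_def)
    show "\<delta> \<le> \<bar>a p\<bar>" if "p \<in> I" for p using \<delta>(2)[OF that] by (simp add: a_def)
    show "0 \<le> \<delta>" by fact
    fix E assume "E \<in> {E\<in>Pow I. ?cost E \<omega> \<le> of_nat (2 * n)}"
    then have E: "E \<subseteq> I" "?cost E \<omega> \<le> of_nat (2 * n)" by auto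
    note q = queries_bounded_by_cost[OF E(2)]
    show "r \<le> card (R E)" unfolding R_def using q by (intro unseen) auto
    fix p assume p: "p \<in> R E"
    have eq: "F E x = F (flip p E) x" if "x \<in> queries e l P (F E) \<omega>" for x
      unfolding F_def
    proof (intro sum.cong refl)
      fix q assume "q \<in> I"
      show "sgn_in E q * g q x = sgn_in (flip p E) q * g q x"
        using p that by (auto simp: sgn_in_flip R_def)
    qed
    note c = run_cong[of e l P "F E" \<omega> "F (flip p E)", OF eq]
    have "p \<in> I" using p by (simp add: R_def)
    then have "flip p E \<subseteq> I" using E by (auto simp: flip_def)
    then show "flip p E \<in> {E\<in>Pow I. ?cost E \<omega> \<le> of_nat (2 * n)} \<and> R (flip p E) = R E
       \<and> ?out (flip p E) \<omega> = ?out E \<omega>"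
      using c E by (simp add: R_def)
  qed
  have pw': "(\<Sum>E\<in>Pow I. ennreal (real r * \<delta>\<^sup>2) * indicator {\<omega>\<in>space ?N. ?cost E \<omega> \<le> of_nat (2 * n)} \<omega>)
      \<le> (\<Sum>E\<in>Pow I. ennreal (\<bar>(\<integral>x. F E x \<partial>\<mu>) - ?out E \<omega>\<bar>\<^sup>2))" if "\<omega> \<in> space ?N" for \<omega>
  proof -
    let ?A = "{E\<in>Pow I. ?cost E \<omega> \<le> of_nat (2 * n)}"
    have "(\<Sum>E\<in>Pow I. ennreal (real r * \<delta>\<^sup>2) * indicator {\<omega>\<in>space ?N. ?cost E \<omega> \<le> of_nat (2 * n)} \<omega>)
        = (\<Sum>E\<in>?A. ennreal (real r * \<delta>\<^sup>2))"
      using I that by (intro sum.mono_neutral_cong_right) auto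
    also have "\<dots> = ennreal (real (card ?A) * (real r * \<delta>\<^sup>2))"
      by (simp add: ennreal_mult' ennreal_of_nat_eq_real_of_nat)
    also have "\<dots> \<le> ennreal (\<Sum>E\<in>?A. ((\<Sum>p\<in>I. sgn_in E p * a p) - ?out E \<omega>)\<^sup>2)"
      by (rule ennreal_leI[OF pw])
    also have "\<dots> = (\<Sum>E\<in>?A. ennreal (\<bar>(\<integral>x. F E x \<partial>\<mu>) - ?out E \<omega>\<bar>\<^sup>2))"
      by (simp add: S sum_ennreal)
    also have "\<dots> \<le> (\<Sum>E\<in>Pow I. ennreal (\<bar>(\<integral>x. F E x \<partial>\<mu>) - ?out E \<omega>\<bar>\<^sup>2))"
      using I by (intro sum_mono2) auto
    finally show ?thesis .
  qed
  have half: "ennreal (1/2) \<le> emeasure ?N {\<omega>\<in>space ?N. ?cost E \<omega> \<le> of_nat (2 * n)}" if "E \<in> Pow I" for E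
  proof (rule N.prob_cost_le_twice)
    show "?cost E \<in> borel_measurable ?N" using meas[OF that] by simp
    have "(\<integral>\<^sup>+\<omega>. ?cost E \<omega> \<partial>?N) \<le> worst_cost \<rho> e l P"
      unfolding worst_cost_def using FL[OF that] by (intro SUP_upper)
    then show "(\<integral>\<^sup>+\<omega>. ?cost E \<omega> \<partial>?N) \<le> of_nat n" using P(2) by simp
  qed (use P in simp)
  let ?err = "\<lambda>E. \<integral>\<^sup>+\<omega>. ennreal (\<bar>(\<integral>x. F E x \<partial>\<mu>) - ?out E \<omega>\<bar>\<^sup>2) \<partial>?N"
  have "(\<Sum>E\<in>Pow I. ennreal (real r * \<delta>\<^sup>2) * ennreal (1/2))
      \<le> (\<Sum>E\<in>Pow I. ennreal (real r * \<delta>\<^sup>2) * emeasure ?N {\<omega>\<in>space ?N. ?cost E \<omega> \<le> of_nat (2 * n)})"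
    by (intro sum_mono mult_left_mono half) auto
  also have "\<dots> = (\<integral>\<^sup>+\<omega>. (\<Sum>E\<in>Pow I. ennreal (real r * \<delta>\<^sup>2) * indicator {\<omega>\<in>space ?N. ?cost E \<omega> \<le> of_nat (2 * n)} \<omega>) \<partial>?N)"
    by (subst nn_integral_sum) (auto simp: nn_integral_cmult_indicator)
  also have "\<dots> \<le> (\<integral>\<^sup>+\<omega>. (\<Sum>E\<in>Pow I. ennreal (\<bar>(\<integral>x. F E x \<partial>\<mu>) - ?out E \<omega>\<bar>\<^sup>2)) \<partial>?N)"
    by (intro nn_integral_mono pw')
  also have "\<dots> = (\<Sum>E\<in>Pow I. ?err E)"
    by (subst nn_integral_sum) auto
  finally have total: "(\<Sum>E\<in>Pow I. ennreal (real r * \<delta>\<^sup>2) * ennreal (1/2)) \<le> (\<Sum>E\<in>Pow I. ?err E)" .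
  show ?thesis
  proof (cases "worst_error \<rho> e l \<mu> P")
    case (real w)
    have "?err E \<le> ennreal (w\<^sup>2)" if "E \<in> Pow I" for E
    proof (rule ennreal_sqrt_leD)
      show "ennreal_sqrt (?err E) \<le> ennreal w"
        unfolding real(2)[symmetric] worst_error_def using FL[OF that] by (intro SUP_upper)
    qed fact
    then have "(\<Sum>E\<in>Pow I. ?err E) \<le> (\<Sum>E\<in>Pow I. ennreal (w\<^sup>2))" by (intro sum_mono)
    moreover have "ennreal (real r * \<delta>\<^sup>2) * ennreal (1/2) = ennreal (real r * \<delta>\<^sup>2 / 2)"
      by (subst ennreal_mult'[symmetric]) auto
    ultimately have "(\<Sum>E\<in>Pow I. ennreal (real r * \<delta>\<^sup>2 / 2)) \<le> (\<Sum>E\<in>Pow I. ennreal (w\<^sup>2))"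
      using total by (metis (no_types, lifting) order_trans sum.cong)
    then have "real (card (Pow I)) * (real r * \<delta>\<^sup>2 / 2) \<le> real (card (Pow I)) * w\<^sup>2"
      by (simp add: ennreal_of_nat_eq_real_of_nat ennreal_mult'[symmetric] del: sum_constant_scale)
    then have "real r * \<delta>\<^sup>2 / 2 \<le> w\<^sup>2" using I by (simp add: card_Pow)
    then have "(sqrt (real r / 2) * \<delta>)\<^sup>2 \<le> w\<^sup>2" by (simp add: power_mult_distrib)
    then have "sqrt (real r / 2) * \<delta> \<le> w" using real(1) by (rule power2_le_imp_le)
    then show ?thesis using real by (simp add: ennreal_leI)
  qed simp
qed

lemma minimal_error_lower_bound:
  assumes \<rho>: "prob_space \<rho>" "sets \<rho> = sets borel" "1 \<le> n"
    and "finite I"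
    and "\<And>E. E \<subseteq> I \<Longrightarrow> (\<lambda>x. \<Sum>p\<in>I. sgn_in E p * g p x) \<in> Lip1"
    and "\<And>p. p \<in> I \<Longrightarrow> integrable \<mu> (g p)"
    and "0 \<le> \<delta>" "\<And>p. p \<in> I \<Longrightarrow> \<delta> \<le> \<bar>\<integral>x. g p x \<partial>\<mu>\<bar>"
    and "\<And>V. finite V \<Longrightarrow> card V \<le> 2 * n \<Longrightarrow> V \<subseteq> span (e ` {1..2 * n})
       \<Longrightarrow> r \<le> card {p\<in>I. \<forall>x\<in>V. g p x = 0}"
  shows "ennreal (sqrt (real r / 2) * \<delta>) \<le> minimal_error \<rho> e l \<mu> n"
  unfolding minimal_error_def
proof (rule INF_greatest)
  fix P assume "P \<in> {P \<in> algorithms \<rho> e l. worst_cost \<rho> e l P \<le> of_nat n}"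
  then have P: "P \<in> algorithms \<rho> e l" "worst_cost \<rho> e l P \<le> of_nat n" by auto
  show "ennreal (sqrt (real r / 2) * \<delta>) \<le> worst_error \<rho> e l \<mu> P"
    using worst_error_lower_bound[OF \<rho>(1,2) P \<rho>(3) assms(4-)] by blast
qed

lemma prob_space_random_uniform: "prob_space random_uniform"
  unfolding random_uniform_def by (intro prob_space_uniform_measure) auto

lemma sets_random_uniform: "sets random_uniform = sets borel"
  by (simp add: random_uniform_def)

section \<open>The Gaussian series\<close>

locale gaussian_series = prob_space M for M :: "'a measure" +
  fixes X :: "'a \<Rightarrow> 'h::{real_inner,polish_space}" and l :: "nat \<Rightarrow> real"
    and Y :: "nat \<Rightarrow> 'a \<Rightarrow> real" and e :: "nat \<Rightarrow> 'h"
  assumes X_measurable [measurable]: "X \<in> borel_measurable M"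
    and kl: "karhunen_loeve M X l Y e"
begin

definition partial_sum :: "nat \<Rightarrow> 'a \<Rightarrow> 'h" where
  "partial_sum n \<omega> = (\<Sum>i=1..n. (sqrt (l i) * Y i \<omega>) *\<^sub>R e i)"

lemma orth: "1 \<le> i \<Longrightarrow> 1 \<le> j \<Longrightarrow> e i \<bullet> e j = (if i = j then 1 else 0)"
  using kl by (simp add: karhunen_loeve_def)

lemma l_pos: "1 \<le> i \<Longrightarrow> 0 < l i"
  using kl by (simp add: karhunen_loeve_def)

lemma l_antimono: assumes "1 \<le> i" "i \<le> j" shows "l j \<le> l i"
  using assms(2)
proof (induction j rule: dec_induct)
  case (step n)
  have "l (Suc n) \<le> l n" using kl step assms(1) by (simp add: karhunen_loeve_def)
  then show ?case using step by simp
qed simp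

lemma Y_indep: "indep_vars (\<lambda>_. borel) Y {1..}"
  using kl by (simp add: karhunen_loeve_def)

lemma Y_distributed: "1 \<le> i \<Longrightarrow> distributed M lborel (Y i) (\<lambda>x. ennreal (std_normal_density x))"
  using kl by (simp add: karhunen_loeve_def)

lemma Y_measurable [measurable]: "1 \<le> i \<Longrightarrow> Y i \<in> borel_measurable M"
  using distributed_measurable[OF Y_distributed] by simp

lemma partial_sum_measurable [measurable]: "partial_sum n \<in> borel_measurable M"
  unfolding partial_sum_def[abs_def] by measurable

lemma partial_sum_converges:
  "(\<lambda>n. \<integral>\<^sup>+\<omega>. ennreal ((norm (X \<omega> - partial_sum n \<omega>))\<^sup>2) \<partial>M) \<longlonglongrightarrow> 0"
  using kl by (simp add: karhunen_loeve_def partial_sum_def)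

lemma norm_sum_e_squared:
  assumes "I \<subseteq> {1..}" "finite I"
  shows "(norm (\<Sum>i\<in>I. a i *\<^sub>R e i))\<^sup>2 = (\<Sum>i\<in>I. (a i)\<^sup>2)"
proof -
  have "(norm (\<Sum>i\<in>I. a i *\<^sub>R e i))\<^sup>2 = (\<Sum>i\<in>I. \<Sum>j\<in>I. a i * (a j * (e i \<bullet> e j)))"
    by (simp add: power2_norm_eq_inner inner_sum_left inner_sum_right sum_distrib_left)
      (simp add: inner_commute)
  also have "\<dots> = (\<Sum>i\<in>I. \<Sum>j\<in>I. if i = j then (a i)\<^sup>2 else 0)"
    by (intro sum.cong refl) (use assms in \<open>auto simp: orth power2_eq_square subset_iff\<close>)
  finally show ?thesis using assms by simp
qed

lemma expectation_Y:
  assumes "1 \<le> i" "g \<in> borel_measurable borel"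
  shows "expectation (\<lambda>\<omega>. g (Y i \<omega>)) = (\<integral>x. std_normal_density x * g x \<partial>lborel)"
  using distributed_integral[OF Y_distributed[OF assms(1)], of g] assms(2) by simp

lemma integrable_Y:
  assumes "1 \<le> i" "g \<in> borel_measurable borel"
  shows "integrable M (\<lambda>\<omega>. g (Y i \<omega>)) \<longleftrightarrow> integrable lborel (\<lambda>x. std_normal_density x * g x)"
  using distributed_integrable[OF Y_distributed[OF assms(1)], of g] assms(2) by simp

lemma nn_integral_Y:
  assumes "1 \<le> i" "g \<in> borel_measurable borel"
  shows "(\<integral>\<^sup>+\<omega>. g (Y i \<omega>) \<partial>M) = (\<integral>\<^sup>+x. ennreal (std_normal_density x) * g x \<partial>lborel)"
  using distributed_nn_integral[OF Y_distributed[OF assms(1)], of g] assms(2) by simp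

lemma integrable_Y_power: "1 \<le> i \<Longrightarrow> integrable M (\<lambda>\<omega>. Y i \<omega> ^ k)"
  by (subst integrable_Y[of i "\<lambda>x. x ^ k"]) (auto intro: integrable_std_normal_moment)

lemma expectation_Y_fourth: "1 \<le> i \<Longrightarrow> expectation (\<lambda>\<omega>. Y i \<omega> ^ 4) = 3"
  using expectation_Y[of i "\<lambda>x. x ^ 4"] integral_std_normal_moment_even[of 2]
  by (simp add: fact_numeral)

lemma expectation_abs_Y: "1 \<le> i \<Longrightarrow> expectation (\<lambda>\<omega>. \<bar>Y i \<omega>\<bar>) = sqrt (2 / pi)"
  using expectation_Y[of i "\<lambda>x. \<bar>x\<bar>"] integral_std_normal_moment_abs_odd[of 0] by simp

lemma integrable_norm_partial_sum: "integrable M (\<lambda>\<omega>. (norm (partial_sum n \<omega>))\<^sup>2)"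
  unfolding partial_sum_def
  by (subst norm_sum_e_squared)
     (auto simp: power_mult_distrib intro!: Bochner_Integration.integrable_sum integrable_Y_power)

lemma integrable_norm_X_squared: "integrable M (\<lambda>\<omega>. (norm (X \<omega>))\<^sup>2)"
proof -
  have "eventually (\<lambda>n. (\<integral>\<^sup>+\<omega>. ennreal ((norm (X \<omega> - partial_sum n \<omega>))\<^sup>2) \<partial>M) < 1) sequentially"
    using partial_sum_converges by (rule order_tendstoD) simp
  then obtain n where n: "(\<integral>\<^sup>+\<omega>. ennreal ((norm (X \<omega> - partial_sum n \<omega>))\<^sup>2) \<partial>M) < 1"
    by (auto simp: eventually_sequentially)
  have 1: "integrable M (\<lambda>\<omega>. (norm (X \<omega> - partial_sum n \<omega>))\<^sup>2)"
    by (rule integrableI_bounded) (use n in \<open>auto intro: order.strict_trans\<close>)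
  show ?thesis
  proof (rule Bochner_Integration.integrable_bound)
    show "integrable M (\<lambda>\<omega>. 2 * (norm (X \<omega> - partial_sum n \<omega>))\<^sup>2 + 2 * (norm (partial_sum n \<omega>))\<^sup>2)"
      using 1 integrable_norm_partial_sum by auto
    show "AE \<omega> in M. norm ((norm (X \<omega>))\<^sup>2) \<le>
       norm (2 * (norm (X \<omega> - partial_sum n \<omega>))\<^sup>2 + 2 * (norm (partial_sum n \<omega>))\<^sup>2)"
    proof (rule AE_I2)
      fix \<omega>
      let ?a = "norm (X \<omega> - partial_sum n \<omega>)" and ?b = "norm (partial_sum n \<omega>)"
      have "norm (X \<omega>) \<le> ?a + ?b" by (metis diff_add_cancel norm_triangle_ineq)
      then have "(norm (X \<omega>))\<^sup>2 \<le> (?a + ?b)\<^sup>2" by (intro power_mono) auto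
      also have "\<dots> \<le> 2 * ?a\<^sup>2 + 2 * ?b\<^sup>2" using sum_squares_bound[of ?a ?b] by (simp add: power2_sum)
      finally show "norm ((norm (X \<omega>))\<^sup>2) \<le> norm (2 * ?a\<^sup>2 + 2 * ?b\<^sup>2)" by simp
    qed
  qed simp
qed

lemma integrable_norm_X: "integrable M (\<lambda>\<omega>. norm (X \<omega>))"
  by (rule square_integrable_imp_integrable[OF _ integrable_norm_X_squared]) simp

lemma integrable_Lip1:
  assumes "f \<in> Lip1"
  shows "f \<in> borel_measurable borel" "integrable M (\<lambda>\<omega>. f (X \<omega>))" "integrable (distr M borel X) f"
    and "(\<integral>x. f x \<partial>distr M borel X) = expectation (\<lambda>\<omega>. f (X \<omega>))"
proof -
  have L: "\<bar>f x - f y\<bar> \<le> norm (x - y)" for x y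
    using assms lipschitz_onD[of 1 UNIV f x y] by (simp add: Lip1_def dist_norm)
  have "continuous_on UNIV f" using assms lipschitz_on_continuous_on by (auto simp: Lip1_def)
  then show [measurable]: "f \<in> borel_measurable borel" by (rule borel_measurable_continuous_onI)
  show i: "integrable M (\<lambda>\<omega>. f (X \<omega>))"
  proof (rule Bochner_Integration.integrable_bound)
    show "integrable M (\<lambda>\<omega>. norm (X \<omega>) + \<bar>f 0\<bar>)" using integrable_norm_X by auto
    show "AE \<omega> in M. norm (f (X \<omega>)) \<le> norm (norm (X \<omega>) + \<bar>f 0\<bar>)"
    proof (rule AE_I2)
      fix \<omega> show "norm (f (X \<omega>)) \<le> norm (norm (X \<omega>) + \<bar>f 0\<bar>)" using L[of "X \<omega>" 0] by simp
    qed
  qed simp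
  show "(\<integral>x. f x \<partial>distr M borel X) = expectation (\<lambda>\<omega>. f (X \<omega>))" by (rule integral_distr) auto
  show "integrable (distr M borel X) f" using i by (simp add: integrable_distr_eq)
qed

text \<open>The \<open>i\<close>-th coordinate of the partial sums is eventually constant, and the coordinate is continuous
with respect to mean-square convergence.\<close>

lemma inner_e_eq:
  assumes "1 \<le> i"
  shows "AE \<omega> in M. X \<omega> \<bullet> e i = sqrt (l i) * Y i \<omega>"
proof -
  let ?d = "\<lambda>\<omega>. X \<omega> \<bullet> e i - sqrt (l i) * Y i \<omega>"
  have ne: "norm (e i) = 1" using orth[of i i] assms by (simp add: norm_eq_sqrt_inner)
  have "(\<integral>\<^sup>+\<omega>. ennreal ((?d \<omega>)\<^sup>2) \<partial>M) \<le> (\<integral>\<^sup>+\<omega>. ennreal ((norm (X \<omega> - partial_sum n \<omega>))\<^sup>2) \<partial>M)" if "i \<le> n" for n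
  proof (intro nn_integral_mono ennreal_leI)
    fix \<omega>
    have "partial_sum n \<omega> \<bullet> e i = (\<Sum>j=1..n. if j = i then sqrt (l i) * Y i \<omega> else 0)"
      unfolding partial_sum_def inner_sum_left using assms by (intro sum.cong refl) (auto simp: orth)
    also have "\<dots> = sqrt (l i) * Y i \<omega>" using assms that by simp
    finally have "?d \<omega> = (X \<omega> - partial_sum n \<omega>) \<bullet> e i" by (simp add: inner_diff_left)
    then have "\<bar>?d \<omega>\<bar> \<le> norm (X \<omega> - partial_sum n \<omega>)"
      using Cauchy_Schwarz_ineq2[of "X \<omega> - partial_sum n \<omega>" "e i"] ne by simp
    then show "(?d \<omega>)\<^sup>2 \<le> (norm (X \<omega> - partial_sum n \<omega>))\<^sup>2"
      by (metis abs_ge_zero power2_abs power_mono)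
  qed
  then have "(\<integral>\<^sup>+\<omega>. ennreal ((?d \<omega>)\<^sup>2) \<partial>M) \<le> 0"
    by (intro tendsto_lowerbound[OF partial_sum_converges]) (auto simp: eventually_sequentially)
  then have "AE \<omega> in M. ennreal ((?d \<omega>)\<^sup>2) = 0"
    using assms by (subst (asm) le_zero_eq, subst (asm) nn_integral_0_iff_AE) auto
  then show ?thesis by eventually_elim simp
qed

text \<open>The function \<open>g\<close> below vanishes on the span of the first \<open>2 * n\<close> eigenvectors, so affordable runs do
not distinguish \<open>g\<close> from \<open>-g\<close>. Dividing the sum of \<open>2 * n\<close> coordinates by \<open>sqrt (2 * n)\<close> makes it
Lipschitz with constant one by the Cauchy-Schwarz inequality.\<close>

lemma minimal_error_MC_ge_tail:
  assumes "1 \<le> n"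
  shows "ennreal (sqrt (real n * l (4 * n)) / 2) \<le> minimal_error_MC e l (distr M borel X) n"
proof -
  define m where "m = 2 * n"
  define g where "g x = (\<Sum>i=m+1..2*m. \<bar>x \<bullet> e i\<bar>) / sqrt m" for x
  have m: "0 < m" using assms by (simp add: m_def)
  have ginner: "(\<Sum>i=m+1..2*m. \<bar>x \<bullet> e i\<bar>) \<le> sqrt m * norm x" for x
  proof -
    define s where "s i = sgn (x \<bullet> e i)" for i
    have "(\<Sum>i=m+1..2*m. \<bar>x \<bullet> e i\<bar>) = x \<bullet> (\<Sum>i=m+1..2*m. s i *\<^sub>R e i)"
      by (simp add: inner_sum_right s_def abs_sgn mult.commute)
    also have "\<dots> \<le> norm x * norm (\<Sum>i=m+1..2*m. s i *\<^sub>R e i)"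
      by (rule norm_cauchy_schwarz)
    also have "norm x * norm (\<Sum>i=m+1..2*m. s i *\<^sub>R e i) \<le> norm x * sqrt m"
    proof (rule mult_left_mono)
      show "norm (\<Sum>i=m+1..2*m. s i *\<^sub>R e i) \<le> sqrt m"
      proof (rule real_le_rsqrt)
      have "(norm (\<Sum>i=m+1..2*m. s i *\<^sub>R e i))\<^sup>2 = (\<Sum>i=m+1..2*m. (s i)\<^sup>2)"
        by (rule norm_sum_e_squared) auto
      also have "\<dots> \<le> (\<Sum>i=m+1..2*m. 1)"
        by (intro sum_mono) (auto simp: s_def sgn_if)
      finally show "(norm (\<Sum>i=m+1..2*m. s i *\<^sub>R e i))\<^sup>2 \<le> m" by simp
      qed
    qed simp
    finally show ?thesis by (simp add: mult.commute)
  qed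
  have gL: "\<bar>g x - g y\<bar> \<le> norm (x - y)" for x y
  proof -
    have "\<bar>g x - g y\<bar> = \<bar>\<Sum>i=m+1..2*m. \<bar>x \<bullet> e i\<bar> - \<bar>y \<bullet> e i\<bar>\<bar> / sqrt m"
      by (simp add: g_def diff_divide_distrib[symmetric] sum_subtractf)
    also have "\<dots> \<le> (\<Sum>i=m+1..2*m. \<bar>(x - y) \<bullet> e i\<bar>) / sqrt m"
      by (intro divide_right_mono order_trans[OF sum_abs] sum_mono) (auto simp: inner_diff_left)
    also have "\<dots> \<le> sqrt m * norm (x - y) / sqrt m" by (intro divide_right_mono ginner) simp
    finally show ?thesis using m by simp
  qed
  have gLip: "g \<in> Lip1"
    unfolding Lip1_def by (auto simp: lipschitz_on_def dist_norm gL)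
  have gint: "(\<integral>x. g x \<partial>distr M borel X) = (\<Sum>i=m+1..2*m. sqrt (l i) * sqrt (2 / pi)) / sqrt m"
  proof -
    have "AE \<omega> in M. \<forall>i\<in>{m+1..2*m}. X \<omega> \<bullet> e i = sqrt (l i) * Y i \<omega>"
      by (intro AE_finite_allI inner_e_eq) auto
    then have "AE \<omega> in M. g (X \<omega>) = (\<Sum>i=m+1..2*m. sqrt (l i) * \<bar>Y i \<omega>\<bar>) / sqrt m"
    proof eventually_elim
      case (elim \<omega>)
      have "(\<Sum>i=m+1..2*m. \<bar>X \<omega> \<bullet> e i\<bar>) = (\<Sum>i=m+1..2*m. sqrt (l i) * \<bar>Y i \<omega>\<bar>)"
        using elim l_pos by (intro sum.cong refl) (auto simp: abs_mult less_imp_le)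
      then show ?case by (simp add: g_def)
    qed
    then have "expectation (\<lambda>\<omega>. g (X \<omega>)) = expectation (\<lambda>\<omega>. (\<Sum>i=m+1..2*m. sqrt (l i) * \<bar>Y i \<omega>\<bar>) / sqrt m)"
      using integrable_Lip1(1)[OF gLip] by (intro integral_cong_AE) auto
    also have "\<dots> = (\<Sum>i=m+1..2*m. sqrt (l i) * sqrt (2 / pi)) / sqrt m"
    proof -
      have "integrable M (\<lambda>\<omega>. \<bar>Y i \<omega>\<bar>)" if "1 \<le> i" for i
        using integrable_Y_power[OF that, of 1] by simp
      then show ?thesis by (simp add: expectation_abs_Y Bochner_Integration.integral_sum)
    qed
    finally show ?thesis using integrable_Lip1(4)[OF gLip] by simp
  qed
  define \<delta> where "\<delta> = sqrt (real n * l (4 * n) / 2)"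
  have \<delta>: "\<delta> \<le> (\<integral>x. g x \<partial>distr M borel X)"
  proof -
    have "1/2 \<le> sqrt (2 / pi)"
      using pi_less_4 by (intro real_le_rsqrt) (simp add: field_simps power2_eq_square)
    then have "(\<Sum>i=m+1..2*m. sqrt (l (4 * n)) * (1/2)) \<le> (\<Sum>i=m+1..2*m. sqrt (l i) * sqrt (2 / pi))"
      using assms l_pos[of "4*n"] by (intro sum_mono mult_mono) (auto simp: m_def intro!: l_antimono less_imp_le[OF l_pos])
    then have "m * (sqrt (l (4 * n)) / 2) / sqrt m \<le> (\<integral>x. g x \<partial>distr M borel X)"
      unfolding gint by (intro divide_right_mono) auto
    moreover have "m * (sqrt (l (4 * n)) / 2) / sqrt m = \<delta>"
      using m real_sqrt_mult_self[of "real m"] 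
      by (simp add: \<delta>_def m_def real_sqrt_mult real_sqrt_divide field_simps)
    ultimately show ?thesis by simp
  qed
  have \<delta>0: "0 \<le> \<delta>" using l_pos[of "4*n"] assms by (simp add: \<delta>_def)
  have "ennreal (sqrt (real 1 / 2) * \<delta>) \<le> minimal_error random_uniform e l (distr M borel X) n"
  proof (rule minimal_error_lower_bound[where I = "{()}" and g = "\<lambda>_. g"])
    show "(\<lambda>x. \<Sum>p\<in>{()}. sgn_in E p * g x) \<in> Lip1" for E
    proof -
      have "\<bar>sgn_in E () * g x - sgn_in E () * g y\<bar> \<le> norm (x - y)" for x y
        using gL[of x y] by (auto simp: sgn_in_def)
      then show ?thesis unfolding Lip1_def by (auto simp: lipschitz_on_def dist_norm)
    qed
    show "\<delta> \<le> \<bar>\<integral>x. g x \<partial>distr M borel X\<bar>" using \<delta> by simp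
    fix V assume V: "V \<subseteq> span (e ` {1..2 * n})"
    have "g x = 0" if "x \<in> V" for x
    proof -
      have "x \<in> span (e ` {1..2 * n})" using V that by blast
      then have "orthogonal (e i) x" if "i \<in> {m+1..2*m}" for i
        by (rule orthogonal_to_span) (use that in \<open>auto simp: orthogonal_def orth m_def\<close>)
      then show ?thesis by (simp add: g_def orthogonal_def inner_commute)
    qed
    then have "{p \<in> {()}. \<forall>x\<in>V. g x = 0} = {()}" by auto
    then show "1 \<le> card {p \<in> {()}. \<forall>x\<in>V. g x = 0}" by simp
  qed (use assms \<delta>0 prob_space_random_uniform sets_random_uniform integrable_Lip1[OF gLip] in auto)
  moreover have "sqrt (real 1 / 2) * \<delta> = sqrt (real n * l (4 * n)) / 2"
    by (simp add: \<delta>_def real_sqrt_mult real_sqrt_divide)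
  ultimately show ?thesis unfolding minimal_error_MC_def by metis
qed

end

section \<open>Quantization numbers and hidden cells\<close>

lemma infdist_finite_attained:
  assumes "finite P" "P \<noteq> {}"
  obtains p where "p \<in> P" "infdist x P = dist x p"
proof -
  have "infdist x P = Min (dist x ` P)" using assms by (simp add: infdist_def cInf_eq_Min)
  moreover have "Min (dist x ` P) \<in> dist x ` P" using assms by (intro Min_in) auto
  ultimately show ?thesis using that by auto
qed

text \<open>Where \<open>p\<close> is the nearest point of \<open>P\<close>, this is half the amount by which the distance to \<open>P\<close> grows
when \<open>p\<close> is removed, and elsewhere it is zero. The factor one half is needed for the Lipschitz
constant of signed sums: two points of neighbouring cells may carry opposite signs.\<close>

definition cell_bump :: "'h::metric_space set \<Rightarrow> 'h \<Rightarrow> 'h \<Rightarrow> real" where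
  "cell_bump P p x = (infdist x (P - {p}) - infdist x P) / 2"

lemma cell_bump_eq_0:
  assumes "p \<in> P" "infdist x P = dist x p" "q \<noteq> p" "q \<in> P"
  shows "cell_bump P q x = 0"
proof -
  have "infdist x (P - {q}) \<le> dist x p" using assms by (intro infdist_le) auto
  moreover have "infdist x P \<le> infdist x (P - {q})" using assms by (intro infdist_mono) auto
  ultimately show ?thesis using assms by (simp add: cell_bump_def)
qed

lemma cell_bump_nonneg:
  assumes "P - {p} \<noteq> {}" shows "0 \<le> cell_bump P p x"
  using assms infdist_mono[of "P - {p}" P x] by (simp add: cell_bump_def)

lemma cell_bump_le:
  assumes "infdist x P = dist x p" "q \<in> P" "q \<noteq> p"
  shows "cell_bump P p x \<le> (dist x q - dist x p) / 2"
proof -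
  have "infdist x (P - {p}) \<le> dist x q" using assms by (intro infdist_le) auto
  then show ?thesis using assms by (simp add: cell_bump_def)
qed

lemma cell_bump_lipschitz: "\<bar>cell_bump P p x - cell_bump P p y\<bar> \<le> dist x y"
proof -
  have "\<bar>infdist x A - infdist y A\<bar> \<le> dist x y" for A
    using infdist_triangle[of x A y] infdist_triangle[of y A x] by (simp add: dist_commute abs_le_iff)
  from this[of "P - {p}"] this[of P] show ?thesis
    unfolding cell_bump_def diff_divide_distrib[symmetric] by (simp add: abs_le_iff)
qed

text \<open>At \<open>x\<close> only the bump of its nearest point \<open>p\<close> is present, at \<open>y\<close> only that of its nearest point \<open>q\<close>.
If \<open>p \<noteq> q\<close>, the removal of \<open>p\<close> leaves \<open>q\<close> available to \<open>x\<close> and vice versa; this bounds the sum of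
the two bumps by half the sum of \<open>dist x q - dist y q\<close> and \<open>dist y p - dist x p\<close>.\<close>

lemma signed_cell_bumps_lipschitz:
  assumes "finite P" "P \<noteq> {}"
  shows "\<bar>(\<Sum>p\<in>P. sgn_in E p * cell_bump P p x) - (\<Sum>p\<in>P. sgn_in E p * cell_bump P p y)\<bar> \<le> dist x y"
proof -
  have single: "(\<Sum>q\<in>P. sgn_in E q * cell_bump P q z) = sgn_in E p * cell_bump P p z"
    if "p \<in> P" "infdist z P = dist z p" for p z
    using assms(1) that by (subst sum.remove[of P p]) (auto simp: cell_bump_eq_0 intro!: sum.neutral)
  obtain p where p: "p \<in> P" "infdist x P = dist x p" using infdist_finite_attained[OF assms] .
  obtain q where q: "q \<in> P" "infdist y P = dist y q" using infdist_finite_attained[OF assms] .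
  note s = single[OF p] single[OF q]
  show ?thesis
  proof (cases "p = q")
    case True
    then show ?thesis using s cell_bump_lipschitz[of P p x y] by (auto simp: sgn_in_def)
  next
    case False
    have "\<bar>sgn_in E p * cell_bump P p x - sgn_in E q * cell_bump P q y\<bar> \<le> cell_bump P p x + cell_bump P q y"
    proof -
      have "0 \<le> cell_bump P p x" "0 \<le> cell_bump P q y"
        using False p q by (auto intro!: cell_bump_nonneg)
      then show ?thesis by (auto simp: sgn_in_def)
    qed
    also have "\<dots> \<le> (dist x q - dist x p) / 2 + (dist y p - dist y q) / 2"
      using False p q by (intro add_mono cell_bump_le) auto
    also have "\<dots> \<le> dist x y"
      using dist_triangle[of x q y] dist_triangle[of y p x] by (simp add: dist_commute field_simps)
    finally show ?thesis using s by simp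
  qed
qed

context gaussian_series
begin

definition quantization_error :: "'h set \<Rightarrow> real" where
  "quantization_error P = expectation (\<lambda>\<omega>. infdist (X \<omega>) P)"

definition optimal_quantization_error :: "nat \<Rightarrow> real" where
  "optimal_quantization_error N =
     Inf (quantization_error ` {P. finite P \<and> P \<noteq> {} \<and> card P \<le> N})"

lemma Lip1_infdist: "(\<lambda>x::'h. infdist x P) \<in> Lip1"
proof -
  have "\<bar>infdist x P - infdist y P\<bar> \<le> dist x y" for x y
    using infdist_triangle[of x P y] infdist_triangle[of y P x] by (simp add: dist_commute abs_le_iff)
  then show ?thesis unfolding Lip1_def by (auto simp: lipschitz_on_def dist_real_def)
qed

lemmas integrable_infdist = integrable_Lip1(2)[OF Lip1_infdist]

lemma quantization_error_nonneg: "0 \<le> quantization_error P"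
  unfolding quantization_error_def by (intro integral_nonneg_AE) (simp add: infdist_nonneg)

lemma optimal_quantization_error_le:
  "finite P \<Longrightarrow> P \<noteq> {} \<Longrightarrow> card P \<le> N \<Longrightarrow> optimal_quantization_error N \<le> quantization_error P"
  unfolding optimal_quantization_error_def
  by (intro cInf_lower bdd_belowI2[of _ 0]) (auto simp: quantization_error_nonneg)

lemma optimal_quantization_error_ge:
  assumes "1 \<le> N" "\<And>P. finite P \<Longrightarrow> P \<noteq> {} \<Longrightarrow> card P \<le> N \<Longrightarrow> c \<le> quantization_error P"
  shows "c \<le> optimal_quantization_error N"
  unfolding optimal_quantization_error_def
proof (rule cInf_greatest)
  have "{undefined} \<in> {P::'h set. finite P \<and> P \<noteq> {} \<and> card P \<le> N}" using assms(1) by simp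
  then show "quantization_error ` {P. finite P \<and> P \<noteq> {} \<and> card P \<le> N} \<noteq> {}" by blast
qed (use assms(2) in auto)

lemma near_optimal_quantizer:
  assumes "1 \<le> N" "optimal_quantization_error N < c"
  obtains P where "finite P" "P \<noteq> {}" "card P \<le> N" "quantization_error P < c"
  using optimal_quantization_error_ge[OF assms(1), of c] assms(2) that by fastforce

text \<open>Take a set \<open>P\<close> whose quantization error exceeds the optimum for \<open>N\<close> points by at most half of the
decrement. Removing any one of its points leaves \<open>N - 1\<close> points and therefore loses at least the other
half, which bounds the integral of every bump from below. A query hits the cell of one
point only, so \<open>2 * (N div 4)\<close> queries leave at least \<open>N / 2\<close> signs hidden.\<close>

lemma minimal_error_MC_ge_increment:
  assumes "4 \<le> N"
  shows "ennreal (sqrt (real N) * (optimal_quantization_error (N - 1) - optimal_quantization_error N) / 8)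
     \<le> minimal_error_MC e l (distr M borel X) (N div 4)"
proof (cases "optimal_quantization_error N < optimal_quantization_error (N - 1)")
  case False
  then show ?thesis by (simp add: ennreal_neg mult_nonneg_nonpos)
next
  case True
  define D where "D = optimal_quantization_error (N - 1) - optimal_quantization_error N"
  define n where "n = N div 4"
  have n: "1 \<le> n" "4 * n \<le> N" using assms by (auto simp: n_def)
  have "optimal_quantization_error N < optimal_quantization_error N + D / 2" using True by (simp add: D_def)
  then obtain P where P: "finite P" "P \<noteq> {}" "card P \<le> N"
      "quantization_error P < optimal_quantization_error N + D / 2"
    using near_optimal_quantizer assms by (metis le_trans one_le_numeral)
  have card: "card P = N"
  proof (rule ccontr)
    assume "card P \<noteq> N"
    then have "optimal_quantization_error (N - 1) \<le> quantization_error P"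
      using P by (intro optimal_quantization_error_le) auto
    then show False using P(4) True by (simp add: D_def field_simps)
  qed
  have Lg: "cell_bump P p \<in> Lip1" for p
    using cell_bump_lipschitz[of P p] unfolding Lip1_def by (auto simp: lipschitz_on_def dist_real_def)
  have "ennreal (sqrt (real (N - 2 * n) / 2) * (D / 4)) \<le> minimal_error random_uniform e l (distr M borel X) n"
  proof (rule minimal_error_lower_bound[where I = P and g = "cell_bump P"])
    show "(\<lambda>x. \<Sum>p\<in>P. sgn_in E p * cell_bump P p x) \<in> Lip1" for E
      using signed_cell_bumps_lipschitz[OF P(1,2), of E]
      unfolding Lip1_def by (auto simp: lipschitz_on_def dist_real_def)
    show "integrable (distr M borel X) (cell_bump P p)" for p by (rule integrable_Lip1(3)[OF Lg])
    show "0 \<le> D / 4" using True by (simp add: D_def)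
    fix p assume p: "p \<in> P"
    have "card (P - {p}) = N - 1" using p P card by simp
    moreover have "P - {p} \<noteq> {}"
    proof
      assume "P - {p} = {}"
      with \<open>card (P - {p}) = N - 1\<close> show False using assms by (simp only: card.empty)
    qed
    ultimately have "optimal_quantization_error (N - 1) \<le> quantization_error (P - {p})"
      using P by (intro optimal_quantization_error_le) auto
    then have "D / 4 \<le> (quantization_error (P - {p}) - quantization_error P) / 2"
      using P(4) by (simp add: D_def field_simps)
    also have "\<dots> = (\<integral>x. cell_bump P p x \<partial>distr M borel X)"
      by (subst integrable_Lip1(4)[OF Lg])
        (use integrable_infdist in \<open>simp add: cell_bump_def quantization_error_def\<close>)
    finally show "D / 4 \<le> \<bar>\<integral>x. cell_bump P p x \<partial>distr M borel X\<bar>" by simp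
  next
    fix V :: "'h set" assume V: "finite V" "card V \<le> 2 * n"
    have "\<exists>p. p \<in> P \<and> infdist x P = dist x p" for x :: 'h
      using infdist_finite_attained[OF P(1,2), of x] by blast
    then obtain t where t: "\<And>x. t x \<in> P \<and> infdist x P = dist x (t x)"
      by metis
    have "P - t ` V \<subseteq> {p\<in>P. \<forall>x\<in>V. cell_bump P p x = 0}"
      using t cell_bump_eq_0 by blast
    then have "card (P - t ` V) \<le> card {p\<in>P. \<forall>x\<in>V. cell_bump P p x = 0}"
      using P by (intro card_mono) auto
    moreover have "N - 2 * n \<le> card (P - t ` V)"
      using diff_card_le_card_Diff[of "t ` V" P] card_image_le[of V t] V card by simp
    ultimately show "N - 2 * n \<le> card {p\<in>P. \<forall>x\<in>V. cell_bump P p x = 0}" by simp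
  qed (use P n prob_space_random_uniform sets_random_uniform in auto)
  moreover have "sqrt (real N) * D / 8 \<le> sqrt (real (N - 2 * n) / 2) * (D / 4)"
  proof -
    have "sqrt (real N / 4) \<le> sqrt (real (N - 2 * n) / 2)"
      using n by (intro real_sqrt_le_mono) (simp add: of_nat_diff)
    then have "sqrt (real N) / 2 \<le> sqrt (real (N - 2 * n) / 2)" by (simp add: real_sqrt_divide)
    then have "sqrt (real N) / 2 * (D / 4) \<le> sqrt (real (N - 2 * n) / 2) * (D / 4)"
      using True by (intro mult_right_mono) (simp_all add: D_def)
    then show ?thesis by simp
  qed
  ultimately show ?thesis
    unfolding minimal_error_MC_def D_def[symmetric] n_def[symmetric] by (meson ennreal_leI order_trans)
qed

lemma optimal_quantization_error_small:
  assumes "0 < \<epsilon>"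
  obtains N where "1 \<le> N" "optimal_quantization_error N < \<epsilon>"
proof -
  obtain D :: "'h set" where D: "countable D" "\<And>U. open U \<Longrightarrow> U \<noteq> {} \<Longrightarrow> \<exists>d\<in>D. d \<in> U"
    using countable_dense_setE by blast
  have "D \<noteq> {}" using D(2)[of UNIV] by auto
  define d where "d = from_nat_into D"
  have ran: "range d = D" unfolding d_def using range_from_nat_into[OF \<open>D \<noteq> {}\<close> D(1)] .
  have "(\<lambda>n. expectation (\<lambda>\<omega>. infdist (X \<omega>) (d ` {..n}))) \<longlonglongrightarrow> expectation (\<lambda>\<omega>. 0)"
  proof (rule integral_dominated_convergence)
    show "integrable M (\<lambda>\<omega>. infdist (X \<omega>) {d 0})" by (rule integrable_infdist)
    show "(\<lambda>\<omega>. infdist (X \<omega>) (d ` {..n})) \<in> borel_measurable M" for n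
      using integrable_infdist by (rule borel_measurable_integrable)
    show "AE \<omega> in M. norm (infdist (X \<omega>) (d ` {..n})) \<le> infdist (X \<omega>) {d 0}" for n
      by (intro AE_I2) (simp add: infdist_nonneg del: infdist_singleton, rule infdist_mono, auto)
    show "AE \<omega> in M. (\<lambda>n. infdist (X \<omega>) (d ` {..n})) \<longlonglongrightarrow> 0"
    proof (intro AE_I2 LIMSEQ_I)
      fix \<omega> r assume "0 < (r::real)"
      then obtain m where m: "d m \<in> ball (X \<omega>) r"
        using D(2)[of "ball (X \<omega>) r"] ran by (metis ball_eq_empty imageE not_le open_ball)
      have "norm (infdist (X \<omega>) (d ` {..n}) - 0) < r" if "m \<le> n" for n
      proof -
        have "infdist (X \<omega>) (d ` {..n}) \<le> dist (X \<omega>) (d m)" using that by (intro infdist_le) auto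
        then show ?thesis using m by (simp add: infdist_nonneg)
      qed
      then show "\<exists>no. \<forall>n\<ge>no. norm (infdist (X \<omega>) (d ` {..n}) - 0) < r" by blast
    qed
  qed simp
  then have "eventually (\<lambda>n. quantization_error (d ` {..n}) < \<epsilon>) sequentially"
    using assms unfolding quantization_error_def by (intro order_tendstoD) auto
  then obtain n where n: "quantization_error (d ` {..n}) < \<epsilon>" by (auto simp: eventually_sequentially)
  have "card (d ` {..n}) \<le> Suc n" using card_image_le[of "{..n}" d] by simp
  then have "optimal_quantization_error (Suc n) \<le> quantization_error (d ` {..n})"
    by (intro optimal_quantization_error_le) auto
  then show ?thesis using n that[of "Suc n"] by simp
qed

lemma optimal_quantization_error_antimono:
  assumes "1 \<le> m" "m \<le> n" 
  shows "optimal_quantization_error n \<le> optimal_quantization_error m"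
  using assms by (intro optimal_quantization_error_ge[of m] optimal_quantization_error_le) auto

text \<open>The standard normal density is at most \<open>1 / sqrt (2 * pi)\<close>, hence the bound is independent of the
shift \<open>c\<close>; the remaining integral is that of a normal density with variance \<open>1 / (2 * t)\<close>.\<close>

lemma nn_integral_exp_shifted_square_le:
  assumes "1 \<le> i" "0 < t"
  shows "(\<integral>\<^sup>+\<omega>. ennreal (exp (- t * (Y i \<omega> - c)\<^sup>2)) \<partial>M) \<le> ennreal (1 / sqrt (2 * t))"
proof -
  define \<sigma> where "\<sigma> = 1 / sqrt (2 * t)"
  have \<sigma>: "0 < \<sigma>" "\<sigma>\<^sup>2 = 1 / (2 * t)" using assms(2) by (auto simp: \<sigma>_def power_divide)
  have "(\<integral>\<^sup>+\<omega>. ennreal (exp (- t * (Y i \<omega> - c)\<^sup>2)) \<partial>M)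
      = (\<integral>\<^sup>+x. ennreal (std_normal_density x) * ennreal (exp (- t * (x - c)\<^sup>2)) \<partial>lborel)"
    by (rule nn_integral_Y[OF assms(1)]) simp
  also have "\<dots> \<le> (\<integral>\<^sup>+x. ennreal \<sigma> * ennreal (normal_density c \<sigma> x) \<partial>lborel)"
  proof (intro nn_integral_mono)
    fix x
    have "std_normal_density x * exp (- t * (x - c)\<^sup>2) \<le> 1 / sqrt (2 * pi) * exp (- t * (x - c)\<^sup>2)"
      by (intro mult_right_mono) (auto simp: std_normal_density_def divide_right_mono)
    also have "\<dots> = \<sigma> * normal_density c \<sigma> x"
    proof -
      have "normal_density c \<sigma> x = 1 / (sqrt (2 * pi) * \<sigma>) * exp (- t * (x - c)\<^sup>2)"
        using \<sigma> assms(2) unfolding normal_density_def by (simp add: real_sqrt_mult real_sqrt_divide \<sigma>_def field_simps)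
      then show ?thesis using \<sigma>(1) by simp
    qed
    finally show "ennreal (std_normal_density x) * ennreal (exp (- t * (x - c)\<^sup>2))
        \<le> ennreal \<sigma> * ennreal (normal_density c \<sigma> x)"
      using \<sigma> by (simp add: ennreal_mult'[symmetric] ennreal_leI normal_density_nonneg)
  qed
  also have "\<dots> = ennreal \<sigma> * (\<integral>\<^sup>+x. ennreal (normal_density c \<sigma> x) \<partial>lborel)"
    by (rule nn_integral_cmult) simp
  also have "(\<integral>\<^sup>+x. ennreal (normal_density c \<sigma> x) \<partial>lborel) = 1"
    using prob_space.emeasure_space_1[OF prob_space_normal_density[OF \<sigma>(1), of c]]
    by (simp add: emeasure_density)
  finally show ?thesis by (simp add: \<sigma>_def)
qed

text \<open>Chernoff's bound: in the first \<open>d\<close> coordinates the event forces the sum of the squares of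
\<open>Y i - c i\<close> to be at most \<open>d / 100\<close>. With the weight \<open>t = 100\<close> its probability is at most
\<open>exp d * (1 / sqrt 200) ^ d\<close>, and \<open>4 * exp 1 < sqrt 200\<close>.\<close>

lemma small_ball:
  assumes "1 \<le> d"
  shows "emeasure M {\<omega>\<in>space M. norm (X \<omega> - x) \<le> sqrt (real d * l d) / 10} \<le> ennreal ((1/4) ^ d)"
proof -
  define c where "c i = (x \<bullet> e i) / sqrt (l i)" for i
  define Z where "Z \<omega> = (\<Prod>i=1..d. ennreal (exp (- 100 * (Y i \<omega> - c i)\<^sup>2)))" for \<omega>
  have Zm: "Z \<in> borel_measurable M" unfolding Z_def[abs_def] by measurable
  have "indep_vars (\<lambda>_. borel) (\<lambda>i \<omega>. ennreal (exp (- 100 * (Y i \<omega> - c i)\<^sup>2))) {1..d}"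
    by (rule indep_vars_compose2[OF indep_vars_subset[OF Y_indep], of "{1..d}"
          "\<lambda>i y. ennreal (exp (- 100 * (y - c i)\<^sup>2))" "\<lambda>_. borel"]) auto
  then have "(\<integral>\<^sup>+\<omega>. Z \<omega> \<partial>M) = (\<Prod>i=1..d. \<integral>\<^sup>+\<omega>. ennreal (exp (- 100 * (Y i \<omega> - c i)\<^sup>2)) \<partial>M)"
    unfolding Z_def by (intro indep_vars_nn_integral) auto
  also have "\<dots> \<le> (\<Prod>i=1..d. ennreal (1 / sqrt 200))"
    using nn_integral_exp_shifted_square_le[of _ 100] by (intro prod_mono_ennreal) auto
  finally have Z: "(\<integral>\<^sup>+\<omega>. Z \<omega> \<partial>M) \<le> ennreal ((1 / sqrt 200) ^ d)" by (simp add: ennreal_power)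
  have "AE \<omega> in M. \<forall>i\<in>{1..d}. X \<omega> \<bullet> e i = sqrt (l i) * Y i \<omega>"
    by (intro AE_finite_allI inner_e_eq) auto
  then have sub: "AE \<omega> in M. \<omega> \<in> {\<omega>\<in>space M. norm (X \<omega> - x) \<le> sqrt (real d * l d) / 10}
       \<longrightarrow> \<omega> \<in> {\<omega>\<in>space M. 1 \<le> ennreal (exp d) * Z \<omega>}"
  proof eventually_elim
    case (elim \<omega>)
    show ?case
    proof safe
      assume a: "norm (X \<omega> - x) \<le> sqrt (real d * l d) / 10"
      have ld: "0 < l d" using assms by (rule l_pos)
      have "l d * (\<Sum>i=1..d. (Y i \<omega> - c i)\<^sup>2) \<le> (\<Sum>i=1..d. ((X \<omega> - x) \<bullet> e i)\<^sup>2)"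
        unfolding sum_distrib_left
      proof (intro sum_mono)
        fix i assume i: "i \<in> {1..d}"
        have li: "0 < l i" "l d \<le> l i" using i by (auto intro!: l_pos l_antimono)
        have "x \<bullet> e i = sqrt (l i) * c i" using li by (simp add: c_def)
        then have "(X \<omega> - x) \<bullet> e i = sqrt (l i) * (Y i \<omega> - c i)"
          using elim i by (simp add: inner_diff_left algebra_simps)
        then have "((X \<omega> - x) \<bullet> e i)\<^sup>2 = l i * (Y i \<omega> - c i)\<^sup>2" using li by (simp add: power_mult_distrib)
        then show "l d * (Y i \<omega> - c i)\<^sup>2 \<le> ((X \<omega> - x) \<bullet> e i)\<^sup>2" using li by (simp add: mult_right_mono)
      qed
      also have "\<dots> \<le> (norm (X \<omega> - x))\<^sup>2"
      proof -
        let ?v = "X \<omega> - x" and ?w = "\<Sum>i=1..d. ((X \<omega> - x) \<bullet> e i) *\<^sub>R e i"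
        have n: "(norm ?w)\<^sup>2 = (\<Sum>i=1..d. (?v \<bullet> e i)\<^sup>2)" by (rule norm_sum_e_squared) auto
        have "?v \<bullet> ?w = (\<Sum>i=1..d. (?v \<bullet> e i)\<^sup>2)" by (simp add: inner_sum_right power2_eq_square)
        then have "(norm ?w)\<^sup>2 \<le> norm ?v * norm ?w" using norm_cauchy_schwarz[of ?v ?w] n by simp
        then have "norm ?w \<le> norm ?v" by (cases "norm ?w = 0") (auto simp: power2_eq_square)
        then have "(norm ?w)\<^sup>2 \<le> (norm ?v)\<^sup>2" by (intro power_mono) auto
        then show ?thesis unfolding n .
      qed
      also have "\<dots> \<le> (sqrt (real d * l d) / 10)\<^sup>2" using a by (intro power_mono) auto
      also have "\<dots> = l d * (real d / 100)" using ld by (simp add: power_divide)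
      finally have "(\<Sum>i=1..d. (Y i \<omega> - c i)\<^sup>2) \<le> real d / 100" using ld by simp
      then have "1 \<le> exp (real d + (\<Sum>i=1..d. - 100 * (Y i \<omega> - c i)\<^sup>2))"
        by (simp add: sum_distrib_left[symmetric] sum_negf)
      also have "\<dots> = exp d * (\<Prod>i=1..d. exp (- 100 * (Y i \<omega> - c i)\<^sup>2))"
        by (simp add: exp_add exp_sum)
      finally have "ennreal 1 \<le> ennreal (exp d * (\<Prod>i=1..d. exp (- 100 * (Y i \<omega> - c i)\<^sup>2)))"
        by (rule ennreal_leI)
      then show "1 \<le> ennreal (exp d) * Z \<omega>"
        by (simp add: Z_def prod_ennreal ennreal_mult')
    qed
  qed
  have "emeasure M {\<omega>\<in>space M. norm (X \<omega> - x) \<le> sqrt (real d * l d) / 10}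
      \<le> emeasure M {\<omega>\<in>space M. 1 \<le> ennreal (exp d) * Z \<omega>}"
    using sub Zm by (intro emeasure_mono_AE) auto
  also have "\<dots> \<le> ennreal (exp d) * (\<integral>\<^sup>+\<omega>. Z \<omega> \<partial>M)"
    using nn_integral_Markov_inequality[of Z "space M" M "ennreal (exp d)"] Zm by simp
  also have "\<dots> \<le> ennreal (exp d) * ennreal ((1 / sqrt 200) ^ d)" using Z by (rule mult_left_mono) simp
  also have "\<dots> = ennreal ((exp 1 / sqrt 200) ^ d)"
    by (simp add: ennreal_mult'[symmetric] exp_of_nat_mult[of d 1, simplified] power_divide)
  also have "\<dots> \<le> ennreal ((1/4) ^ d)"
  proof (intro ennreal_leI power_mono)
    have "(12::real) \<le> sqrt 200" by (rule real_le_rsqrt) simp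
    then show "exp 1 / sqrt 200 \<le> (1/4::real)" using e_less_272 by (simp add: field_simps)
  qed auto
  finally show ?thesis .
qed

text \<open>The balls around \<open>2 ^ d\<close> points together have probability at most \<open>2 ^ d * (1/4) ^ d \<le> 1/2\<close>.\<close>

lemma optimal_quantization_error_lower:
  assumes "1 \<le> d"
  shows "sqrt (real d * l d) / 20 \<le> optimal_quantization_error (2 ^ d)"
proof (rule optimal_quantization_error_ge)
  fix P :: "'h set" assume P: "finite P" "P \<noteq> {}" "card P \<le> 2 ^ d"
  define r where "r = sqrt (real d * l d) / 10"
  have r: "0 \<le> r" using l_pos[OF assms] by (simp add: r_def)
  have m[measurable]: "(\<lambda>\<omega>. infdist (X \<omega>) P) \<in> borel_measurable M"
    using integrable_infdist by (rule borel_measurable_integrable)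
  let ?A = "{\<omega>\<in>space M. infdist (X \<omega>) P \<le> r}"
  have "emeasure M ?A \<le> emeasure M (\<Union>p\<in>P. {\<omega>\<in>space M. norm (X \<omega> - p) \<le> r})"
  proof (intro emeasure_mono)
    show "?A \<subseteq> (\<Union>p\<in>P. {\<omega>\<in>space M. norm (X \<omega> - p) \<le> r})"
    proof safe
      fix \<omega> assume a: "\<omega> \<in> space M" "infdist (X \<omega>) P \<le> r"
      obtain p where "p \<in> P" "infdist (X \<omega>) P = dist (X \<omega>) p" using infdist_finite_attained[OF P(1,2)] .
      then show "\<omega> \<in> (\<Union>p\<in>P. {\<omega>\<in>space M. norm (X \<omega> - p) \<le> r})" using a by (auto simp: dist_norm)
    qed
    have "{\<omega>\<in>space M. norm (X \<omega> - p) \<le> r} \<in> events" for p by measurable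
    then show "(\<Union>p\<in>P. {\<omega>\<in>space M. norm (X \<omega> - p) \<le> r}) \<in> events"
      using P(1) by (intro sets.finite_UN) auto
  qed
  also have "\<dots> \<le> (\<Sum>p\<in>P. emeasure M {\<omega>\<in>space M. norm (X \<omega> - p) \<le> r})"
    by (intro emeasure_subadditive_finite) (use P in auto)
  also have "\<dots> \<le> (\<Sum>p\<in>P. ennreal ((1/4) ^ d))"
    unfolding r_def by (intro sum_mono small_ball assms)
  also have "\<dots> = ennreal (card P * (1/4) ^ d)"
    by (simp add: ennreal_of_nat_eq_real_of_nat ennreal_mult')
  also have "\<dots> \<le> ennreal (1/2)"
  proof (intro ennreal_leI)
    have "card P * (1/4::real) ^ d \<le> 2 ^ d * (1/4) ^ d" using P(3) 
      by (intro mult_right_mono) (auto simp: of_nat_le_iff[of _ "2^d", where 'a=real, simplified])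
    also have "\<dots> = (1/2) ^ d" by (simp add: power_mult_distrib[symmetric])
    also have "\<dots> \<le> (1/2) ^ 1" using assms by (intro power_decreasing) auto
    finally show "card P * (1/4::real) ^ d \<le> 1/2" by simp
  qed
  finally have A: "prob ?A \<le> 1/2" unfolding emeasure_eq_measure by (subst (asm) ennreal_le_iff) auto
  have "r * (1 - prob ?A) = r * prob (space M - ?A)" by (subst prob_compl) auto
  also have "\<dots> = expectation (\<lambda>\<omega>. r * indicator (space M - ?A) \<omega>)" by simp
  also have "\<dots> \<le> quantization_error P"
    unfolding quantization_error_def
  proof (intro integral_mono integrable_infdist)
    show "integrable M (\<lambda>\<omega>. r * indicator (space M - ?A) \<omega>)"
      by (intro integrable_mult_right integrable_real_indicator) (auto simp: less_top[symmetric])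
  qed (auto simp: indicator_def infdist_nonneg split: if_splits)
  finally have "r * (1 - prob ?A) \<le> quantization_error P" .
  moreover have "r * (1/2) \<le> r * (1 - prob ?A)" using A r by (intro mult_left_mono) auto
  ultimately show "sqrt (real d * l d) / 20 \<le> quantization_error P" by (simp add: r_def)
qed simp

end

section \<open>Lower bounds in terms of the cost\<close>

text \<open>Iterated logarithms are of constant order on the blocks between consecutive numbers
\<open>2 ^ (2 ^ k)\<close>: there \<open>ln N\<close> is of order \<open>2 ^ k\<close> and \<open>ln (ln N)\<close> of order \<open>k\<close>.\<close>

lemma ln_between_tower:
  assumes "1 \<le> k" "2 ^ (2 ^ k) \<le> N" "N \<le> 2 ^ (2 ^ Suc k)"
  shows "(2/3) * 2 ^ k \<le> ln (real N)" "ln (real N) \<le> 2 * 2 ^ k"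
    and "(1/12) * (1 + real k) \<le> ln (ln (real N))" "ln (ln (real N)) \<le> 1 * (1 + real k)"
proof -
  have N: "(2::real) ^ (2 ^ k) \<le> N" "N \<le> (2::real) ^ (2 ^ Suc k)"
    using assms(2,3) by (metis of_nat_le_iff of_nat_numeral of_nat_power)+
  have pos: "0 < real N" using N(1) by (smt (verit) zero_less_power)
  have l2: "2/3 \<le> ln (2::real)" "ln (2::real) \<le> 1" using ln2_ge_two_thirds ln_2_less_1 by auto
  have "2 ^ k * ln 2 = ln ((2::real) ^ (2 ^ k))" by (simp add: ln_realpow)
  also have "\<dots> \<le> ln (real N)" using N pos by (subst ln_le_cancel_iff) auto
  finally have 1: "2 ^ k * ln 2 \<le> ln (real N)" .
  have "2 ^ k * (2/3) \<le> 2 ^ k * ln (2::real)" using l2 by (intro mult_left_mono) auto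
  then show a: "(2/3) * 2 ^ k \<le> ln (real N)" using 1 by linarith
  have "ln (real N) \<le> ln ((2::real) ^ (2 ^ Suc k))" using N pos by (subst ln_le_cancel_iff) auto
  also have "\<dots> = 2 * 2 ^ k * ln 2" by (simp add: ln_realpow)
  finally have 2: "ln (real N) \<le> 2 * 2 ^ k * ln 2" .
  have "2 * 2 ^ k * ln (2::real) \<le> 2 * 2 ^ k * 1" using l2 by (intro mult_left_mono) auto
  then show b: "ln (real N) \<le> 2 * 2 ^ k" using 2 by linarith
  have lpos: "0 < ln (real N)" using a by (smt (verit) zero_less_power mult_pos_pos divide_pos_pos)
  have "ln ((2/3) * 2 ^ k) \<le> ln (ln (real N))" using a lpos by (subst ln_le_cancel_iff) auto
  moreover have "ln ((2/3) * (2::real) ^ k) = ln (2/3) + real k * ln 2"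
    by (subst ln_mult) (auto simp: ln_realpow)
  moreover have "- (1/2) \<le> ln (2/3 :: real)" using ln_le_minus_one[of "3/2::real"] by (simp add: ln_div)
  moreover have "real k * (2/3) \<le> real k * ln 2" using l2 by (intro mult_left_mono) auto
  ultimately have "real k * (2/3) - 1/2 \<le> ln (ln (real N))" by linarith
  moreover have "(1/12) * (1 + real k) \<le> real k * (2/3) - 1/2" using assms(1) by simp
  ultimately show "(1/12) * (1 + real k) \<le> ln (ln (real N))" by linarith
  have "ln (ln (real N)) \<le> ln (2 ^ Suc k)" using b lpos by (subst ln_le_cancel_iff) auto
  also have "\<dots> = (1 + real k) * ln 2" by (simp only: ln_realpow) simp
  also have "\<dots> \<le> (1 + real k) * 1" using l2 by (intro mult_left_mono) auto
  finally show "ln (ln (real N)) \<le> 1 * (1 + real k)" by simp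
qed

lemma powr_squared: "(x powr a)\<^sup>2 = x powr (2 * a)" for x a :: real
  by (simp add: power2_eq_square powr_add[symmetric])

lemma sum_inverse_le_ln:
  assumes "1 \<le> A" "A \<le> B"
  shows "(\<Sum>N\<in>{A<..B}. 1 / real N) \<le> ln (real B) - ln (real A)"
  using assms(2)
proof (induction B rule: dec_induct)
  case (step n)
  have n: "0 < real n" using step assms by simp
  have "ln (real n / real (Suc n)) \<le> real n / real (Suc n) - 1" using n by (intro ln_le_minus_one) auto
  then have "1 / real (Suc n) \<le> ln (real (Suc n)) - ln (real n)"
    using n by (simp add: ln_div field_simps)
  moreover have "{A<..Suc n} = insert (Suc n) {A<..n}" using step by auto
  ultimately show ?case using step by simp
qed simp

text \<open>Let \<open>\<kappa> N = 1 / N * ln N powr (-(b + 1)) * ln (ln N) powr (-a)\<close>. If the claim failed, the decrements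
would be at most \<open>\<eta> * \<kappa> N\<close> for all large \<open>N\<close>. Over the block from
\<open>2 ^ (2 ^ k)\<close> to \<open>2 ^ (2 ^ (k + 1))\<close>, the numbers \<open>\<kappa> N\<close> sum up to a multiple of \<open>dyadic_rate b a k\<close>,
because the numbers \<open>1 / N\<close> sum up to at most \<open>2 ^ k\<close>. As \<open>q\<close> tends to zero, summation over
all later blocks would bound \<open>q (2 ^ (2 ^ k))\<close> by a small multiple of \<open>dyadic_rate b a k\<close>.\<close>

lemma frequently_large_increment:
  fixes q :: "nat \<Rightarrow> real"
  assumes b: "0 < b" and c: "0 < c"
    and lower: "\<And>k. c * dyadic_rate b a k \<le> q (2 ^ (2 ^ k))"
    and small: "\<And>\<epsilon>. 0 < \<epsilon> \<Longrightarrow> \<exists>N\<ge>1. q N < \<epsilon>"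
    and mono: "\<And>m n. 1 \<le> m \<Longrightarrow> m \<le> n \<Longrightarrow> q n \<le> q m"
  shows "\<exists>\<eta>>0. \<forall>N0. \<exists>N\<ge>N0. \<eta> * (1 / real N * ln N powr (- (b + 1)) * ln (ln N) powr (- a)) < q (N - 1) - q N"
proof -
  define \<kappa> where "\<kappa> N = 1 / real N * ln N powr (- (b + 1)) * ln (ln N) powr (- a)" for N :: nat
  define C1 where "C1 = (2/3::real) powr (- (b + 1)) + 2 powr (- (b + 1))"
  define C2 where "C2 = (1/12::real) powr (- a) + 1 powr (- a)"
  obtain C3 where C3: "0 < C3" "\<And>k m. (\<Sum>j\<in>{k..<m}. dyadic_rate b a j) \<le> C3 * dyadic_rate b a k"
    using sum_dyadic_rate_tail[OF b] by metis
  have Cpos: "0 < C1" "0 < C2" unfolding C1_def C2_def by (auto intro!: add_pos_pos)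
  define \<eta> where "\<eta> = c / (2 * (C1 * C2 * C3))"
  have \<eta>: "0 < \<eta>" using c Cpos C3 by (simp add: \<eta>_def)
  define Q where "Q k = q (2 ^ (2 ^ k))" for k :: nat
  have block: "(\<Sum>N\<in>{2 ^ (2 ^ k)<..2 ^ (2 ^ Suc k)}. \<kappa> N) \<le> C1 * C2 * dyadic_rate b a k"
    if k: "1 \<le> k" for k :: nat
  proof -
    have "\<kappa> N \<le> (C1 * (2 ^ k) powr (- (b + 1)) * (C2 * (1 + real k) powr (- a))) * (1 / real N)"
      if "N \<in> {2 ^ (2 ^ k)<..2 ^ (2 ^ Suc k)}" for N
    proof -
      note ln_between_tower[of k N]
      then have *: "(2/3) * 2 ^ k \<le> ln (real N)" "ln (real N) \<le> 2 * 2 ^ k"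
        "(1/12) * (1 + real k) \<le> ln (ln (real N))" "ln (ln (real N)) \<le> 1 * (1 + real k)"
        using k that by auto
      have "ln N powr (- (b + 1)) \<le> C1 * (2 ^ k) powr (- (b + 1))"
        unfolding C1_def using * by (intro powr_comparable) auto
      moreover have "ln (ln N) powr (- a) \<le> C2 * (1 + real k) powr (- a)"
        unfolding C2_def using * by (intro powr_comparable) auto
      ultimately have "ln N powr (- (b + 1)) * ln (ln N) powr (- a)
          \<le> C1 * (2 ^ k) powr (- (b + 1)) * (C2 * (1 + real k) powr (- a))"
        using Cpos by (intro mult_mono) auto
      then have "ln N powr (- (b + 1)) * ln (ln N) powr (- a) * (1 / real N)
          \<le> C1 * (2 ^ k) powr (- (b + 1)) * (C2 * (1 + real k) powr (- a)) * (1 / real N)"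
        by (rule mult_right_mono) simp
      then show ?thesis by (simp add: \<kappa>_def mult_ac)
    qed
    then have "(\<Sum>N\<in>{2 ^ (2 ^ k)<..2 ^ (2 ^ Suc k)}. \<kappa> N)
       \<le> (\<Sum>N\<in>{2 ^ (2 ^ k)<..2 ^ (2 ^ Suc k)}.
            (C1 * (2 ^ k) powr (- (b + 1)) * (C2 * (1 + real k) powr (- a))) * (1 / real N))"
      by (rule sum_mono)
    also have "\<dots> = (C1 * (2 ^ k) powr (- (b + 1)) * (C2 * (1 + real k) powr (- a))) *
            (\<Sum>N\<in>{2 ^ (2 ^ k)<..2 ^ (2 ^ Suc k)}. 1 / real N)"
      by (simp add: sum_distrib_left)
    also have "\<dots> \<le> (C1 * (2 ^ k) powr (- (b + 1)) * (C2 * (1 + real k) powr (- a))) * 2 ^ k"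
    proof (rule mult_left_mono)
      have "(\<Sum>N\<in>{2 ^ (2 ^ k)<..2 ^ (2 ^ Suc k)}. 1 / real N)
         \<le> ln (real (2 ^ (2 ^ Suc k))) - ln (real (2 ^ (2 ^ k)))"
        by (rule sum_inverse_le_ln) (auto intro!: power_increasing)
      also have "\<dots> = 2 ^ k * ln 2" by (simp add: ln_realpow)
      also have "\<dots> \<le> 2 ^ k * 1" using ln_2_less_1 by (intro mult_left_mono) auto
      finally show "(\<Sum>N\<in>{2 ^ (2 ^ k)<..2 ^ (2 ^ Suc k)}. 1 / real N) \<le> 2 ^ k" by simp
    qed (use Cpos in auto)
    also have "\<dots> = C1 * C2 * (((2 ^ k) powr (- (b + 1)) * (2 ^ k) powr 1) * (1 + real k) powr (- a))"
      by simp
    also have "(2 ^ k) powr (- (b + 1)) * (2 ^ k) powr 1 = (2::real) powr (- (b * real k))"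
      by (simp add: powr_add[symmetric] powr_realpow[symmetric] powr_powr del: powr_one)
        (simp add: algebra_simps)
    finally show ?thesis by (simp add: dyadic_rate_def)
  qed
  show ?thesis
    unfolding \<kappa>_def[symmetric]
  proof (intro exI[of _ \<eta>] conjI \<eta> allI, rule ccontr)
    fix N0 assume "\<not> (\<exists>N\<ge>N0. \<eta> * \<kappa> N < q (N - 1) - q N)"
    then have neg: "q (N - 1) - q N \<le> \<eta> * \<kappa> N" if "N0 \<le> N" for N
      using that by (meson not_le)
    define k where "k = Suc N0"
    have tower: "N0 \<le> 2 ^ (2 ^ j)" if "k \<le> j" for j :: nat
    proof -
      have "N0 < j" using that by (simp add: k_def)
      also have "j < 2 ^ j" by (rule less_exp)
      also have "(2::nat) ^ j < 2 ^ (2 ^ j)" by (rule less_exp)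
      finally show ?thesis by simp
    qed
    have step: "Q j - Q (Suc j) \<le> \<eta> * (C1 * C2) * dyadic_rate b a j" if "k \<le> j" for j
    proof -
      define A B :: nat where "A = 2 ^ (2 ^ j)" and "B = 2 ^ (2 ^ Suc j)"
      have AB: "A \<le> B" unfolding A_def B_def by (intro power_increasing) auto
      have "q A - q B' = (\<Sum>N\<in>{A<..B'}. q (N - 1) - q N)" if "A \<le> B'" for B'
        using that
      proof (induction B' rule: dec_induct)
        case (step n)
        have "{A<..Suc n} = insert (Suc n) {A<..n}" using step by auto
        then show ?case using step by simp
      qed simp
      then have "Q j - Q (Suc j) = (\<Sum>N\<in>{A<..B}. q (N - 1) - q N)"
        using AB by (simp add: Q_def A_def B_def)
      also have "\<dots> \<le> (\<Sum>N\<in>{A<..B}. \<eta> * \<kappa> N)"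
        using tower[OF that] by (intro sum_mono neg) (auto simp: A_def)
      also have "\<dots> = \<eta> * (\<Sum>N\<in>{A<..B}. \<kappa> N)" by (simp add: sum_distrib_left)
      also have "\<dots> \<le> \<eta> * (C1 * C2 * dyadic_rate b a j)"
        unfolding A_def B_def using \<eta> that by (intro mult_left_mono block) (auto simp: k_def)
      finally show ?thesis by simp
    qed
    have tele: "Q k - Q m \<le> \<eta> * (C1 * C2) * (C3 * dyadic_rate b a k)" if "k \<le> m" for m
    proof -
      have "Q k - Q m = (\<Sum>j\<in>{k..<m}. Q j - Q (Suc j))"
        using that by (induction m rule: dec_induct) auto
      also have "\<dots> \<le> (\<Sum>j\<in>{k..<m}. \<eta> * (C1 * C2) * dyadic_rate b a j)" by (intro sum_mono step) auto
      also have "\<dots> = \<eta> * (C1 * C2) * (\<Sum>j\<in>{k..<m}. dyadic_rate b a j)" by (simp add: sum_distrib_left)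
      also have "\<dots> \<le> \<eta> * (C1 * C2) * (C3 * dyadic_rate b a k)"
        using \<eta> Cpos by (intro mult_left_mono C3) auto
      finally show ?thesis .
    qed
    have half: "\<eta> * (C1 * C2) * (C3 * dyadic_rate b a k) = c / 2 * dyadic_rate b a k"
      using Cpos C3 by (simp add: \<eta>_def)
    have "0 < c / 2 * dyadic_rate b a k" using c dyadic_rate_pos by simp
    from small[OF this] obtain N where N: "1 \<le> N" "q N < c / 2 * dyadic_rate b a k" by blast
    define m where "m = max k N"
    have "N \<le> 2 ^ (2 ^ m)"
    proof -
      have "N \<le> m" by (simp add: m_def)
      also have "m < 2 ^ m" by (rule less_exp)
      also have "(2::nat) ^ m < 2 ^ (2 ^ m)" by (rule less_exp)
      finally show ?thesis by simp
    qed
    then have "Q m \<le> q N" unfolding Q_def using N(1) by (intro mono)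
    moreover have "c * dyadic_rate b a k \<le> Q k" unfolding Q_def by (rule lower)
    moreover have "Q k - Q m \<le> c / 2 * dyadic_rate b a k" using tele[of m] half by (simp add: m_def)
    ultimately show False using N(2) by (simp add: field_simps)
  qed
qed

context gaussian_series
begin

text \<open>\<open>minimal_error_MC_ge_tail\<close> with the power law inserted; \<open>4 * n\<close> and \<open>ln (4 * n)\<close> are of the order of
\<open>n\<close> and \<open>ln n\<close>.\<close>

lemma minimal_error_MC_lower_bound:
  assumes "0 < L" "(\<lambda>i. l i * real i powr \<beta> * ln (real i) powr \<alpha>) \<longlonglongrightarrow> L"
  shows "uniformly_preceq {3..}
           (\<lambda>n. ennreal (real n powr (- (\<beta> - 1)/2) * ln (real n) powr (- \<alpha>/2)))
           (minimal_error_MC e l (distr M borel X))"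
proof -
  obtain c where c: "c > 0" "\<And>i. 2 \<le> i \<Longrightarrow> c * (real i powr (-\<beta>) * ln (real i) powr (-\<alpha>)) \<le> l i"
    using power_law_bounds[OF l_pos assms] by metis
  define C1 where "C1 = (1 / 3::real) powr (- \<alpha>) + (1/1) powr (- \<alpha>)"
  define K where "K = sqrt c * sqrt (4 powr (-\<beta>)) / (2 * sqrt C1)"
  have C1: "0 < C1" unfolding C1_def by (auto intro: add_pos_pos)
  have K: "0 < K" using c C1 by (simp add: K_def)
  have main: "K * (real n powr (- (\<beta> - 1)/2) * ln (real n) powr (- \<alpha>/2)) \<le> sqrt (real n * l (4 * n)) / 2"
    if n: "3 \<le> n" for n
  proof -
    have ln1: "1 \<le> ln (real n)"
    proof -
      have "exp 1 \<le> real n" using e_less_272 n by linarith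
      then show ?thesis using n by (simp add: ln_ge_iff)
    qed
    have "ln 4 \<le> 2 * ln (real n)"
    proof -
      have "ln (4::real) = 2 * ln 2" using ln_realpow[of 2 2] by simp
      then show ?thesis using ln1 ln_2_less_1 by linarith
    qed
    then have l4: "1 * ln (real n) \<le> ln (real (4 * n))" "ln (real (4 * n)) \<le> 3 * ln (real n)"
      using n by (auto simp: ln_mult)
    have a: "ln (real n) powr (- \<alpha>) \<le> C1 * ln (real (4 * n)) powr (- \<alpha>)"
      unfolding C1_def using l4 ln1 by (intro powr_comparable_reverse) auto
    have "(K * (real n powr (- (\<beta> - 1)/2) * ln (real n) powr (- \<alpha>/2)))\<^sup>2
        = K\<^sup>2 * (real n powr (- (\<beta> - 1)) * ln (real n) powr (- \<alpha>))"
    proof -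
      have "2 * (- (\<beta> - 1) / 2) = - (\<beta> - 1)" "2 * (- \<alpha> / 2) = - \<alpha>" by auto
      then show ?thesis by (simp only: power_mult_distrib powr_squared)
    qed
    also have "\<dots> \<le> K\<^sup>2 * (real n powr (- (\<beta> - 1)) * (C1 * ln (real (4 * n)) powr (- \<alpha>)))"
      using a by (intro mult_left_mono) auto
    also have "\<dots> = real n powr (- (\<beta> - 1)) * (c * 4 powr (-\<beta>) / 4 * ln (real (4 * n)) powr (- \<alpha>))"
      using C1 c by (simp add: K_def power_mult_distrib power_divide)
    also have "real n powr (- (\<beta> - 1)) = real n * real n powr (-\<beta>)"
      using n by (simp add: powr_mult_base)
    also have "real n * real n powr (-\<beta>) * (c * 4 powr (-\<beta>) / 4 * ln (real (4 * n)) powr (- \<alpha>))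
       = real n / 4 * (c * (real (4 * n) powr (-\<beta>) * ln (real (4 * n)) powr (-\<alpha>)))"
      using n by (simp add: powr_mult)
    also have "\<dots> \<le> real n / 4 * l (4 * n)" using n by (intro mult_left_mono c) auto
    also have "\<dots> = (sqrt (real n * l (4 * n)) / 2)\<^sup>2" using l_pos[of "4 * n"] n by (simp add: power_divide)
    finally show ?thesis by (rule power2_le_imp_le) (use l_pos[of "4 * n"] n in simp)
  qed
  show ?thesis
    unfolding uniformly_preceq_def
  proof (intro exI[of _ "1 / K"] conjI ballI)
    show "0 < 1 / K" using K by simp
    fix n :: nat assume "n \<in> {3..}"
    then have n: "3 \<le> n" by simp
    have "ennreal (real n powr (- (\<beta> - 1)/2) * ln (real n) powr (- \<alpha>/2))
        = ennreal (1 / K) * ennreal (K * (real n powr (- (\<beta> - 1)/2) * ln (real n) powr (- \<alpha>/2)))"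
      using K by (simp add: ennreal_mult'[symmetric])
    also have "\<dots> \<le> ennreal (1 / K) * ennreal (sqrt (real n * l (4 * n)) / 2)"
      using main[OF n] by (intro mult_left_mono ennreal_leI) auto
    also have "\<dots> \<le> ennreal (1 / K) * minimal_error_MC e l (distr M borel X) n"
      using n by (intro mult_left_mono minimal_error_MC_ge_tail) auto
    finally show "ennreal (real n powr (- (\<beta> - 1)/2) * ln (real n) powr (- \<alpha>/2))
        \<le> ennreal (1 / K) * minimal_error_MC e l (distr M borel X) n" .
  qed
qed

text \<open>For \<open>N = 2 ^ d\<close> with \<open>d = 2 ^ k\<close> the quantization error is at least of order \<open>sqrt (d * l d)\<close>, which is
\<open>dyadic_rate ((\<beta> - 1) / 2) (\<alpha> / 2) k\<close>. The resulting large decrements at infinitely many \<open>N\<close> are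
transferred to \<open>n = N div 4\<close>, where the weight \<open>w\<close> has the same order as at \<open>N\<close>.\<close>

lemma minimal_error_MC_limsup:
  assumes "0 < L" "(\<lambda>i. l i * real i powr \<beta> * ln (real i) powr \<alpha>) \<longlonglongrightarrow> L" "1 < \<beta>"
  shows "0 < limsup (\<lambda>n. minimal_error_MC e l (distr M borel X) n *
           ennreal (real n powr (1/2) * ln (real n) powr ((1 + \<beta>)/2) * ln (ln (real n)) powr (\<alpha>/2)))"
proof -
  define b where "b = (\<beta> - 1) / 2"
  define a where "a = \<alpha> / 2"
  let ?q = "optimal_quantization_error"
  let ?E = "minimal_error_MC e l (distr M borel X)"
  define w where "w n = real n powr (1/2) * ln (real n) powr (b + 1) * ln (ln (real n)) powr a" for n :: nat
  obtain c where c: "c > 0" "\<And>j i. 2^j \<le> i \<Longrightarrow> i < 2^(Suc j) \<Longrightarrow> c * dyadic_rate \<beta> \<alpha> j \<le> l i"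
    using power_law_dyadic_bounds[OF l_pos assms(1,2)] by metis
  have lower: "sqrt c / 20 * dyadic_rate b a k \<le> ?q (2 ^ (2 ^ k))" for k
  proof -
    have "(sqrt c * dyadic_rate b a k)\<^sup>2 = c * (2 powr (- (2 * b * real k)) * (1 + real k) powr (- (2 * a)))"
      using c by (simp add: dyadic_rate_def power_mult_distrib powr_squared mult_ac)
    also have "2 powr (- (2 * b * real k)) = 2 ^ k * (2::real) powr (- (\<beta> * real k))"
    proof -
      have "2 * b = \<beta> - 1" by (simp add: b_def)
      then have "- (2 * b * real k) = real k + (- (\<beta> * real k))" by (simp only:) (simp add: algebra_simps)
      then show ?thesis by (simp only: powr_add) (simp add: powr_realpow)
    qed
    also have "c * (2 ^ k * 2 powr (- (\<beta> * real k)) * (1 + real k) powr (- (2 * a)))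
        = 2 ^ k * (c * dyadic_rate \<beta> \<alpha> k)"
      by (simp add: dyadic_rate_def a_def)
    also have "\<dots> \<le> 2 ^ k * l (2 ^ k)" by (intro mult_left_mono c) auto
    finally have "sqrt c * dyadic_rate b a k \<le> sqrt (2 ^ k * l (2 ^ k))" by (rule real_le_rsqrt)
    then have "sqrt c / 20 * dyadic_rate b a k \<le> sqrt (real (2 ^ k) * l (2 ^ k)) / 20" by simp
    also have "\<dots> \<le> ?q (2 ^ (2 ^ k))" by (rule optimal_quantization_error_lower) simp
    finally show ?thesis .
  qed
  have "\<exists>\<eta>>0. \<forall>N0. \<exists>N\<ge>N0. \<eta> * (1 / real N * ln N powr (- (b + 1)) * ln (ln N) powr (- a)) < ?q (N - 1) - ?q N"
  proof (rule frequently_large_increment)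
    show "0 < b" using assms by (simp add: b_def)
    show "0 < sqrt c / 20" using c by simp
    show "\<exists>N\<ge>1. ?q N < \<epsilon>" if "0 < \<epsilon>" for \<epsilon> using optimal_quantization_error_small[OF that] by metis
  qed (use lower optimal_quantization_error_antimono in auto)
  then obtain \<eta> where \<eta>: "\<eta> > 0"
    "\<And>N0. \<exists>N\<ge>N0. \<eta> * (1 / real N * ln N powr (- (b + 1)) * ln (ln N) powr (- a)) < ?q (N - 1) - ?q N"
    by blast
  define D1 where "D1 = (1::real) powr (1/2) + 7 powr (1/2)"
  define D2 where "D2 = (1::real) powr (b + 1) + 3 powr (b + 1)"
  define D3 where "D3 = (1::real) powr a + 3 powr a"
  have D: "0 < D1" "0 < D2" "0 < D3" unfolding D1_def D2_def D3_def by (auto intro: add_pos_pos)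
  define \<delta> where "\<delta> = \<eta> / (8 * (D1 * D2 * D3))"
  have \<delta>: "0 < \<delta>" using \<eta> D by (simp add: \<delta>_def)
  have freq: "\<exists>n\<ge>n0. ennreal \<delta> \<le> ?E n * ennreal (w n)" for n0
  proof -
    \<comment> \<open>From 27 on, \<open>ln n \<ge> 3\<close> and \<open>ln (ln n) \<ge> 1\<close>, so that powers of both can be compared.\<close>
    obtain N where N: "4 * (n0 + 27) \<le> N"
      "\<eta> * (1 / real N * ln N powr (- (b + 1)) * ln (ln N) powr (- a)) < ?q (N - 1) - ?q N"
      using \<eta>(2) by blast
    define n where "n = N div 4"
    define r where "r = N mod 4"
    have r: "N = 4 * n + r" "r < 4" by (auto simp: n_def r_def)
    have n0: "n0 + 27 \<le> n" using r N(1) by presburger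
    then have n: "n0 \<le> n" "27 \<le> n" "4 * n \<le> N" "N \<le> 7 * n" using r by auto
    have nr: "27 \<le> real n" using n by simp
    have l3: "3 \<le> ln (real n)"
    proof -
      have e3: "1 \<le> ln (3::real)" using e_less_272 by (subst ln_ge_iff) auto
      have "3 * ln 3 = ln (27::real)" using ln_realpow[of 3 3] by simp
      also have "\<dots> \<le> ln (real n)" using nr by (subst ln_le_cancel_iff) auto
      finally show ?thesis using e3 by linarith
    qed
    have N1: "1 * real n \<le> real N" "real N \<le> 7 * real n" using n by auto
    have lN: "1 * ln (real n) \<le> ln (real N)" "ln (real N) \<le> 3 * ln (real n)"
    proof -
      show "1 * ln (real n) \<le> ln (real N)" using N1 nr by simp
      have "ln (real N) \<le> ln (real n ^ 3)"
      proof -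
        have "real N \<le> real n ^ 3"
        proof -
          have "7 * real n \<le> (real n * real n) * real n"
            using nr mult_mono[of 27 "real n" 27 "real n"] by (intro mult_right_mono) auto
          then show ?thesis using N1 by (simp add: power3_eq_cube)
        qed
        then show ?thesis using N1 nr by (subst ln_le_cancel_iff) auto
      qed
      then show "ln (real N) \<le> 3 * ln (real n)" using nr by (simp add: ln_realpow)
    qed
    have ll: "1 \<le> ln (ln (real n))"
    proof -
      have "exp 1 \<le> ln (real n)" using l3 e_less_272 by linarith
      then show ?thesis using l3 by (subst ln_ge_iff) auto
    qed
    have llN: "1 * ln (ln (real n)) \<le> ln (ln (real N))" "ln (ln (real N)) \<le> 3 * ln (ln (real n))"
    proof -
      show "1 * ln (ln (real n)) \<le> ln (ln (real N))" using lN l3 by simp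
      have "ln (ln (real N)) \<le> ln (3 * ln (real n))" using lN l3 by (subst ln_le_cancel_iff) auto
      also have "\<dots> = ln 3 + ln (ln (real n))" using l3 by (subst ln_mult) auto
      also have "ln (3::real) \<le> ln 2 + 1/2" using ln_le_minus_one[of "3/2::real"] by (simp add: ln_div)
      also have "ln 2 + 1/2 + ln (ln (real n)) \<le> 3 * ln (ln (real n))" using ll ln_2_less_1 by linarith
      finally show "ln (ln (real N)) \<le> 3 * ln (ln (real n))" by simp
    qed
    have wN: "w N \<le> D1 * D2 * D3 * w n"
    proof -
      have "real N powr (1/2) \<le> D1 * real n powr (1/2)"
        unfolding D1_def using N1 nr by (intro powr_comparable) auto
      moreover have "ln (real N) powr (b + 1) \<le> D2 * ln (real n) powr (b + 1)"
        unfolding D2_def using lN l3 by (intro powr_comparable) auto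
      moreover have "ln (ln (real N)) powr a \<le> D3 * ln (ln (real n)) powr a"
        unfolding D3_def using llN ll by (intro powr_comparable) auto
      ultimately have "w N \<le> D1 * real n powr (1/2) * (D2 * ln (real n) powr (b + 1)) * (D3 * ln (ln (real n)) powr a)"
        unfolding w_def using D by (intro mult_mono) auto
      then show ?thesis by (simp add: w_def mult_ac)
    qed
    have L: "ln (real N) \<noteq> 0" "ln (ln (real N)) \<noteq> 0" using lN(1) l3 llN(1) ll by linarith+
    have wpos: "0 < w n" "0 < w N" using L l3 ll nr N1 by (auto simp: w_def)
    have inv: "sqrt (real N) * (1 / real N * ln N powr (- (b + 1)) * ln (ln N) powr (- a)) = 1 / w N"
    proof -
      have "sqrt (real N) * (1 / real N) = 1 / sqrt (real N)"
        using nr N1 by (simp add: real_div_sqrt field_simps)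
      then have "sqrt (real N) * (1 / real N * ln N powr (- (b + 1)) * ln (ln N) powr (- a))
         = 1 / sqrt (real N) * (1 / ln N powr (b + 1)) * (1 / ln (ln N) powr a)"
        unfolding powr_minus_divide by (simp only: mult.assoc[symmetric])
      then show ?thesis by (simp add: w_def powr_half_sqrt)
    qed
    have "\<delta> / w n = \<eta> / 8 * (1 / (D1 * D2 * D3 * w n))" by (simp add: \<delta>_def)
    also have "\<dots> \<le> \<eta> / 8 * (1 / w N)"
      using wN wpos D \<eta> by (intro mult_left_mono divide_left_mono) auto
    also have "\<dots> = sqrt (real N) * (\<eta> * (1 / real N * ln N powr (- (b + 1)) * ln (ln N) powr (- a))) / 8"
      unfolding inv[symmetric] by (simp only: mult_ac times_divide_eq_left times_divide_eq_right divide_divide_eq_left)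
    also have "\<dots> \<le> sqrt (real N) * (?q (N - 1) - ?q N) / 8"
      using N(2) by (intro divide_right_mono mult_left_mono) auto
    finally have "ennreal (\<delta> / w n) \<le> ennreal (sqrt (real N) * (?q (N - 1) - ?q N) / 8)" by (rule ennreal_leI)
    also have "\<dots> \<le> ?E n" unfolding n_def by (rule minimal_error_MC_ge_increment) (use N(1) in simp)
    finally have "ennreal (\<delta> / w n) * ennreal (w n) \<le> ?E n * ennreal (w n)" by (rule mult_right_mono) simp
    then have "ennreal \<delta> \<le> ?E n * ennreal (w n)"
      using wpos \<delta> by (simp add: ennreal_mult'[symmetric])
    then show ?thesis using n by blast
  qed
  have "ennreal \<delta> \<le> limsup (\<lambda>n. ?E n * ennreal (w n))"
    unfolding limsup_INF_SUP
  proof (rule INF_greatest)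
    fix n0 obtain n where n: "n0 \<le> n" "ennreal \<delta> \<le> ?E n * ennreal (w n)" using freq by blast
    have "?E n * ennreal (w n) \<le> (SUP n\<in>{n0..}. ?E n * ennreal (w n))"
      using n(1) by (intro SUP_upper) auto
    with n(2) show "ennreal \<delta> \<le> (SUP n\<in>{n0..}. ?E n * ennreal (w n))" by (rule order_trans)
  qed
  moreover have "0 < ennreal \<delta>" using \<delta> by simp
  ultimately have "0 < limsup (\<lambda>n. ?E n * ennreal (w n))" by (rule less_le_trans[rotated])
  moreover have "b + 1 = (1 + \<beta>) / 2" by (simp add: b_def field_simps)
  ultimately show ?thesis unfolding w_def a_def by simp
qed

end

section \<open>Dyadic quantization of normal random variables\<close>

definition std_normal_cdf :: "real \<Rightarrow> real" where
  "std_normal_cdf = cdf (density lborel (\<lambda>t. ennreal (std_normal_density t)))"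

lemma real_distribution_std_normal:
  "real_distribution (density lborel (\<lambda>t. ennreal (std_normal_density t)))"
proof -
  interpret prob_space "density lborel (\<lambda>t. ennreal (std_normal_density t))"
    by (rule prob_space_normal_density) simp
  show ?thesis by unfold_locales simp_all
qed

interpretation std_normal: real_distribution "density lborel (\<lambda>t. ennreal (std_normal_density t))"
  by (rule real_distribution_std_normal)

lemma std_normal_null_sets_iff:
  "A \<in> null_sets (density lborel (\<lambda>t. ennreal (std_normal_density t))) \<longleftrightarrow> A \<in> null_sets lborel"
proof -
  have "ennreal (std_normal_density x) \<noteq> 0" for x using normal_density_pos[of 1 0 x] by (simp add: less_le)
  then have "A \<in> null_sets (density lborel (\<lambda>t. ennreal (std_normal_density t)))
     \<longleftrightarrow> A \<in> sets lborel \<and> (AE x in lborel. x \<notin> A)"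
    by (subst null_sets_density_iff) auto
  also have "\<dots> \<longleftrightarrow> A \<in> null_sets lborel" using AE_iff_null_sets[of A lborel] by blast
  finally show ?thesis .
qed

lemma std_normal_cdf_strict_mono:
  assumes "x < y" shows "std_normal_cdf x < std_normal_cdf y"
proof -
  have "{x<..y} \<notin> null_sets lborel"
    using assms by (simp add: null_sets_def)
  then have "{x<..y} \<notin> null_sets (density lborel (\<lambda>t. ennreal (std_normal_density t)))"
    by (simp add: std_normal_null_sets_iff)
  then have "0 < measure (density lborel (\<lambda>t. ennreal (std_normal_density t))) {x<..y}"
    by (auto simp: null_sets_def std_normal.emeasure_eq_measure zero_less_measure_iff)
  then show ?thesis using std_normal.cdf_diff_eq[OF assms] by (simp add: std_normal_cdf_def)
qed

lemma isCont_std_normal_cdf: "isCont std_normal_cdf x"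
proof -
  have "{x} \<in> null_sets (density lborel (\<lambda>t. ennreal (std_normal_density t)))"
    unfolding std_normal_null_sets_iff by (rule countable_imp_null_set_lborel) simp
  then show ?thesis unfolding std_normal_cdf_def std_normal.isCont_cdf
    by (simp add: null_sets_def std_normal.emeasure_eq_measure)
qed

lemma std_normal_cdf_mono: "x \<le> y \<Longrightarrow> std_normal_cdf x \<le> std_normal_cdf y"
  using std_normal_cdf_strict_mono[of x y] by (cases "x = y") auto

lemma std_normal_cdf_bounds: "0 < std_normal_cdf x" "std_normal_cdf x < 1"
proof -
  have "0 \<le> std_normal_cdf (x - 1)" "std_normal_cdf (x + 1) \<le> 1"
    by (auto simp: std_normal_cdf_def std_normal.cdf_nonneg std_normal.cdf_bounded_prob)
  then show "0 < std_normal_cdf x" "std_normal_cdf x < 1"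
    using std_normal_cdf_strict_mono[of "x - 1" x] std_normal_cdf_strict_mono[of x "x + 1"] by auto
qed

lemma std_normal_cdf_measurable [measurable]: "std_normal_cdf \<in> borel_measurable borel"
  by (intro borel_measurable_continuous_onI continuous_at_imp_continuous_on) (simp add: isCont_std_normal_cdf)

lemma std_normal_cdf_surj:
  assumes "0 < u" "u < 1" shows "\<exists>x. std_normal_cdf x = u"
proof -
  have "eventually (\<lambda>x. std_normal_cdf x < u) at_bot"
    unfolding std_normal_cdf_def using std_normal.cdf_lim_at_bot assms by (intro order_tendstoD)
  moreover have "eventually (\<lambda>x. u < std_normal_cdf x) at_top"
    unfolding std_normal_cdf_def using std_normal.cdf_lim_at_top_prob assms by (intro order_tendstoD)
  ultimately obtain a b where "std_normal_cdf a < u" "u < std_normal_cdf b"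
    by (auto simp: eventually_at_bot_linorder eventually_at_top_linorder)
  moreover from this have "a \<le> b" using std_normal_cdf_mono[of b a] by (cases "a \<le> b") auto
  ultimately show ?thesis
    using IVT'[of std_normal_cdf a u b] isCont_std_normal_cdf
    by (auto simp: continuous_at_imp_continuous_on)
qed

lemma normal_quantile_std_normal_cdf [simp]: "normal_quantile (std_normal_cdf x) = x"
proof -
  have "(THE y. std_normal_cdf y = std_normal_cdf x) = x"
  proof (rule the_equality)
    fix y assume "std_normal_cdf y = std_normal_cdf x"
    then show "y = x" using std_normal_cdf_strict_mono[of x y] std_normal_cdf_strict_mono[of y x]
      by (cases x y rule: linorder_cases) auto
  qed simp
  then show ?thesis using std_normal_cdf_bounds[of x]
    unfolding normal_quantile_def by (simp add: std_normal_cdf_def)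
qed

lemma std_normal_cdf_normal_quantile:
  assumes "0 < u" "u < 1" shows "std_normal_cdf (normal_quantile u) = u"
  using std_normal_cdf_surj[OF assms] by auto

lemma normal_quantile_le_iff:
  assumes "0 < u" "u < 1" shows "normal_quantile u \<le> x \<longleftrightarrow> u \<le> std_normal_cdf x"
  using std_normal_cdf_normal_quantile[OF assms] std_normal_cdf_mono[of "normal_quantile u" x]
    std_normal_cdf_strict_mono[of x "normal_quantile u"] by (cases "normal_quantile u \<le> x") auto

lemma normal_quantile_mono:
  assumes "0 < u" "u \<le> v" "v < 1" shows "normal_quantile u \<le> normal_quantile v"
  using assms by (simp add: normal_quantile_le_iff std_normal_cdf_normal_quantile)

lemma normal_quantile_measurable [measurable]: "normal_quantile \<in> borel_measurable borel"
proof (rule borel_measurableI_le)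
  fix a
  have "{w \<in> space borel. normal_quantile w \<le> a} =
     ({0<..<1} \<inter> {..std_normal_cdf a}) \<union> (if 0 \<le> a then - {0<..<1} else {})"
    using normal_quantile_le_iff by (auto simp: normal_quantile_def)
  then show "{w \<in> space borel. normal_quantile w \<le> a} \<in> sets borel" by simp
qed

lemma std_normal_cdf_0: "std_normal_cdf 0 = 1 / 2"
proof -
  let ?N = "density lborel (\<lambda>t. ennreal (std_normal_density t))"
  have "emeasure ?N {..0} = (\<integral>\<^sup>+x. ennreal (std_normal_density x) * indicator {..0} x \<partial>lborel)"
    by (simp add: emeasure_density)
  also have "\<dots> = (\<integral>\<^sup>+x. ennreal (std_normal_density x) * indicator {..0} x \<partial>distr lborel borel uminus)"
    by (simp add: lborel_distr_uminus)
  also have "\<dots> = (\<integral>\<^sup>+x. ennreal (std_normal_density (-x)) * indicator {..0} (-x) \<partial>lborel)"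
    by (subst nn_integral_distr) auto
  also have "\<dots> = (\<integral>\<^sup>+x. ennreal (std_normal_density x) * indicator {0..} x \<partial>lborel)"
    by (intro nn_integral_cong) (auto simp: std_normal_density_def indicator_def)
  also have "\<dots> = emeasure ?N {0..}" by (simp add: emeasure_density)
  finally have eq: "measure ?N {..0} = measure ?N {0..}" by (simp add: std_normal.emeasure_eq_measure)
  have "{0} \<in> null_sets ?N"
    unfolding std_normal_null_sets_iff by (rule countable_imp_null_set_lborel) simp
  then have z: "measure ?N {0} = 0" by (simp add: null_sets_def std_normal.emeasure_eq_measure)
  have "{0..} = {0} \<union> (UNIV - {..0::real})" by auto
  then have "measure ?N {0..} = measure ?N {0} + measure ?N (UNIV - {..0})"
    by (simp only:) (rule std_normal.finite_measure_Union; simp)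
  also have "measure ?N (UNIV - {..0}) = 1 - measure ?N {..0}"
    using std_normal.prob_compl[of "{..0}"] by simp
  finally show ?thesis using eq z by (simp add: std_normal_cdf_def cdf_def)
qed

lemma normal_quantile_half: "normal_quantile (1/2) = 0"
  using normal_quantile_std_normal_cdf[of 0] by (simp add: std_normal_cdf_0)

text \<open>The midpoint of the interval \<open>]k / 2 ^ b, (k + 1) / 2 ^ b]\<close> that contains \<open>u\<close>. Intervals closed on
the right suit distribution functions and make \<open>u = 1\<close> regular.\<close>

definition dyadic_mid :: "nat \<Rightarrow> real \<Rightarrow> real" where
  "dyadic_mid b u = (of_int \<lceil>2 ^ b * u\<rceil> - 1/2) / 2 ^ b"

lemma dyadic_mid_measurable [measurable]: "dyadic_mid b \<in> borel_measurable borel"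
  unfolding dyadic_mid_def[abs_def] by measurable

lemma dyadic_mid_0: assumes "0 < u" "u \<le> 1" shows "dyadic_mid 0 u = 1/2"
proof -
  have "\<lceil>u\<rceil> = 1" using assms by linarith
  then show ?thesis by (simp add: dyadic_mid_def)
qed

lemma dyadic_mid_Suc: "dyadic_mid (Suc b) ((u + of_int z) / 2) = (dyadic_mid b u + of_int z) / 2"
proof -
  have "(2::real) ^ Suc b * ((u + of_int z) / 2) = 2 ^ b * u + of_int (2 ^ b * z)" by (simp add: algebra_simps)
  then have "\<lceil>(2::real) ^ Suc b * ((u + of_int z) / 2)\<rceil> = \<lceil>2 ^ b * u\<rceil> + 2 ^ b * z"
    by (simp only: ceiling_add_of_int)
  then show ?thesis by (simp add: dyadic_mid_def field_simps)
qed

text \<open>The number \<open>ceiling x - 1/2\<close> lies in the same interval between consecutive integers as \<open>x\<close>, and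
multiples of \<open>D\<close> are integers.\<close>

lemma ceiling_div_ceiling:
  fixes x :: real and D :: nat
  assumes "0 < D"
  shows "\<lceil>(of_int \<lceil>x\<rceil> - 1/2) / D\<rceil> = \<lceil>x / D\<rceil>"
proof -
  define m where "m = \<lceil>x / D\<rceil>"
  have m: "of_int m - 1 < x / D" "x / D \<le> of_int m" unfolding m_def by linarith+
  have x: "of_int (int D * (m - 1)) < x" "x \<le> of_int (int D * m)"
    using m assms by (auto simp: field_simps)
  have c: "int D * (m - 1) < \<lceil>x\<rceil>" "\<lceil>x\<rceil> \<le> int D * m"
    using x by (auto simp: less_ceiling_iff ceiling_le_iff simp del: of_int_mult)
  then have "int D * (m - 1) + 1 \<le> \<lceil>x\<rceil>" by simp
  then have "real_of_int (int D * (m - 1) + 1) \<le> of_int \<lceil>x\<rceil>" "real_of_int \<lceil>x\<rceil> \<le> of_int (int D * m)"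
    using c(2) by (simp_all only: of_int_le_iff)
  then have r: "real D * (of_int m - 1) + 1 \<le> of_int \<lceil>x\<rceil>" "of_int \<lceil>x\<rceil> \<le> real D * of_int m" by auto
  show ?thesis unfolding m_def[symmetric]
  proof (rule ceiling_unique)
    show "of_int m - 1 < (of_int \<lceil>x\<rceil> - 1/2) / D" using r assms by (simp add: field_simps)
    show "(of_int \<lceil>x\<rceil> - 1/2) / D \<le> of_int m" using r assms by (simp add: field_simps)
  qed
qed

lemma dyadic_mid_dyadic_mid:
  assumes "b' \<le> b" shows "dyadic_mid b' (dyadic_mid b u) = dyadic_mid b' u"
proof -
  define D :: nat where "D = 2 ^ (b - b')"
  have D: "0 < D" "(2::real) ^ b = 2 ^ b' * real D"
    using assms by (auto simp: D_def power_add[symmetric])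
  have "2 ^ b' * dyadic_mid b u = (of_int \<lceil>2 ^ b * u\<rceil> - 1/2) / D"
    using D by (simp add: dyadic_mid_def)
  moreover have "2 ^ b' * u = 2 ^ b * u / D" using D by simp
  ultimately show ?thesis using ceiling_div_ceiling[OF D(1), of "2 ^ b * u"]
    by (simp add: dyadic_mid_def)
qed

context gaussian_series
begin

text \<open>The distribution function turns \<open>Y i\<close> into a uniformly distributed random variable, whose leading
binary digits are independent fair bits.\<close>

definition unif :: "nat \<Rightarrow> 'a \<Rightarrow> real" where
  "unif i \<omega> = std_normal_cdf (Y i \<omega>)"

lemma unif_measurable [measurable]: "1 \<le> i \<Longrightarrow> unif i \<in> borel_measurable M"
  unfolding unif_def[abs_def] by measurable

lemma unif_bounds: "0 < unif i \<omega>" "unif i \<omega> < 1"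
  by (auto simp: unif_def std_normal_cdf_bounds)

lemma prob_unif_le:
  assumes "1 \<le> i" "0 \<le> x" "x \<le> 1"
  shows "prob {\<omega>\<in>space M. unif i \<omega> \<le> x} = x"
proof -
  consider "x = 0" | "x = 1" | "0 < x" "x < 1" using assms by linarith
  then show ?thesis
  proof cases
    case 1
    then have "{\<omega>\<in>space M. unif i \<omega> \<le> x} = {}" using unif_bounds(1) by (auto simp: not_le)
    then have "prob {\<omega>\<in>space M. unif i \<omega> \<le> x} = prob {}" by (rule arg_cong)
    then show ?thesis using 1 by simp
  next
    case 2
    then have "{\<omega>\<in>space M. unif i \<omega> \<le> x} = space M" using unif_bounds(2) by (auto simp: less_imp_le)
    then show ?thesis using 2 prob_space by simp
  next
    case 3
    have "{\<omega>\<in>space M. unif i \<omega> \<le> x} = Y i -` {..normal_quantile x} \<inter> space M"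
    proof -
      have "unif i \<omega> \<le> x \<longleftrightarrow> Y i \<omega> \<le> normal_quantile x" for \<omega>
        using std_normal_cdf_normal_quantile[OF 3] std_normal_cdf_mono[of "Y i \<omega>" "normal_quantile x"]
          std_normal_cdf_strict_mono[of "normal_quantile x" "Y i \<omega>"]
        by (cases "Y i \<omega> \<le> normal_quantile x") (auto simp: unif_def)
      then show ?thesis by auto
    qed
    then have "prob {\<omega>\<in>space M. unif i \<omega> \<le> x} = measure (distr M lborel (Y i)) {..normal_quantile x}"
      using assms(1) by (subst measure_distr) auto
    also have "\<dots> = std_normal_cdf (normal_quantile x)"
      unfolding distributed_distr_eq_density[OF Y_distributed[OF assms(1)]] by (simp add: std_normal_cdf_def cdf_def)
    finally show ?thesis using std_normal_cdf_normal_quantile[OF 3] by simp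
  qed
qed

lemma prob_unif_interval:
  assumes "1 \<le> i" "0 \<le> x" "x \<le> y" "y \<le> 1"
  shows "prob {\<omega>\<in>space M. x < unif i \<omega> \<and> unif i \<omega> \<le> y} = y - x"
proof -
  have "{\<omega>\<in>space M. x < unif i \<omega> \<and> unif i \<omega> \<le> y}
      = {\<omega>\<in>space M. unif i \<omega> \<le> y} - {\<omega>\<in>space M. unif i \<omega> \<le> x}" by auto
  then show ?thesis using assms by (simp add: finite_measure_Diff prob_unif_le subset_eq)
qed

definition cell :: "nat \<Rightarrow> nat \<Rightarrow> nat \<Rightarrow> 'a set" where
  "cell b i k = {\<omega>\<in>space M. real k / 2 ^ b < unif i \<omega> \<and> unif i \<omega> \<le> real (Suc k) / 2 ^ b}"

lemma cell_measurable [measurable]: "1 \<le> i \<Longrightarrow> cell b i k \<in> events"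
  unfolding cell_def by measurable

lemma prob_cell: "1 \<le> i \<Longrightarrow> k < 2 ^ b \<Longrightarrow> prob (cell b i k) = 1 / 2 ^ b"
  unfolding cell_def
proof (subst prob_unif_interval)
  assume "k < 2 ^ b"
  then have "real (Suc k) \<le> 2 ^ b" by (metis Suc_leI of_nat_le_iff of_nat_numeral of_nat_power)
  then show "real (Suc k) / 2 ^ b \<le> 1" by simp
qed (auto simp: field_simps)

lemma in_cell_iff:
  assumes "\<omega> \<in> space M"
  shows "\<omega> \<in> cell b i k \<longleftrightarrow> \<lceil>2 ^ b * unif i \<omega>\<rceil> = int k + 1"
proof -
  have "\<omega> \<in> cell b i k \<longleftrightarrow> real k < 2 ^ b * unif i \<omega> \<and> 2 ^ b * unif i \<omega> \<le> real (Suc k)"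
    using assms by (simp add: cell_def field_simps)
  also have "\<dots> \<longleftrightarrow> \<lceil>2 ^ b * unif i \<omega>\<rceil> = int k + 1" by (subst ceiling_eq_iff) (simp add: add.commute)
  finally show ?thesis .
qed

lemma cell_exists:
  obtains k where "k < 2 ^ b" "\<lceil>2 ^ b * unif i \<omega>\<rceil> = int k + 1"
proof -
  have "0 < 2 ^ b * unif i \<omega>" using unif_bounds by simp
  then have 1: "1 \<le> \<lceil>2 ^ b * unif i \<omega>\<rceil>" by (simp add: less_ceiling_iff flip: zless_iff_Suc_zadd)
  have "2 ^ b * unif i \<omega> \<le> of_int (2 ^ b)" using unif_bounds(2)[of i \<omega>] by simp
  then have 2: "\<lceil>2 ^ b * unif i \<omega>\<rceil> \<le> 2 ^ b" by (rule ceiling_le)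
  have "nat (\<lceil>2 ^ b * unif i \<omega>\<rceil> - 1) < 2 ^ b" using 1 2 by (simp add: nat_less_iff)
  moreover have "\<lceil>2 ^ b * unif i \<omega>\<rceil> = int (nat (\<lceil>2 ^ b * unif i \<omega>\<rceil> - 1)) + 1" using 1 by simp
  ultimately show ?thesis using that by blast
qed

lemma sum_over_cells:
  fixes c :: "nat \<Rightarrow> 'c::semiring_1"
  assumes "\<omega> \<in> space M" "j < 2 ^ b" "\<lceil>2 ^ b * unif i \<omega>\<rceil> = int j + 1"
  shows "(\<Sum>k<2 ^ b. c k * indicator (cell b i k) \<omega>) = c j"
proof -
  have "(\<Sum>k<2 ^ b. c k * indicator (cell b i k) \<omega>) = (\<Sum>k<2 ^ b. if k = j then c j else 0)"
    by (intro sum.cong refl) (auto simp: indicator_def in_cell_iff[OF assms(1)] assms(3))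
  then show ?thesis using assms(2) by simp
qed

lemma nn_integral_dyadic_mid_unif:
  assumes i: "1 \<le> i" and h: "h \<in> borel_measurable borel"
  shows "(\<integral>\<^sup>+\<omega>. h (dyadic_mid b (unif i \<omega>)) \<partial>M) = (\<Sum>k<2 ^ b. h ((real k + 1/2) / 2 ^ b) * ennreal (1 / 2 ^ b))"
proof -
  have "(\<integral>\<^sup>+\<omega>. h (dyadic_mid b (unif i \<omega>)) \<partial>M)
     = (\<integral>\<^sup>+\<omega>. (\<Sum>k<2 ^ b. h ((real k + 1/2) / 2 ^ b) * indicator (cell b i k) \<omega>) \<partial>M)"
  proof (rule nn_integral_cong)
    fix \<omega> assume \<omega>: "\<omega> \<in> space M"
    obtain j where j: "j < 2 ^ b" "\<lceil>2 ^ b * unif i \<omega>\<rceil> = int j + 1" by (rule cell_exists)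
    have "dyadic_mid b (unif i \<omega>) = (real j + 1/2) / 2 ^ b" by (simp add: dyadic_mid_def j(2))
    then show "h (dyadic_mid b (unif i \<omega>)) = (\<Sum>k<2 ^ b. h ((real k + 1/2) / 2 ^ b) * indicator (cell b i k) \<omega>)"
      using sum_over_cells[OF \<omega> j, of "\<lambda>k. h ((real k + 1/2) / 2 ^ b)"] by simp
  qed
  also have "\<dots> = (\<Sum>k<2 ^ b. h ((real k + 1/2) / 2 ^ b) * emeasure M (cell b i k))"
    using i by (subst nn_integral_sum) (auto simp: nn_integral_cmult_indicator)
  also have "\<dots> = (\<Sum>k<2 ^ b. h ((real k + 1/2) / 2 ^ b) * ennreal (1 / 2 ^ b))"
    using i by (intro sum.cong refl) (simp add: emeasure_eq_measure prob_cell)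
  finally show ?thesis .
qed

definition quantized :: "nat \<Rightarrow> nat \<Rightarrow> 'a \<Rightarrow> real" where
  "quantized b i \<omega> = normal_quantile (dyadic_mid b (unif i \<omega>))"

lemma quantized_measurable [measurable]: "1 \<le> i \<Longrightarrow> quantized b i \<in> borel_measurable M"
  unfolding quantized_def[abs_def] by measurable

lemma quantized_0: "quantized 0 i \<omega> = 0"
  using unif_bounds[of i \<omega>] by (simp add: quantized_def dyadic_mid_0 normal_quantile_half)

text \<open>Let \<open>\<delta> = 2 ^ (-b)\<close> and let \<open>h (unif i)\<close> be \<open>Y i\<close> clamped to the range between the quantiles \<open>s1\<close>
of \<open>\<delta>/2\<close> and \<open>s2\<close> of \<open>1 - \<delta>/2\<close>, which contains all quantized values. Clamping matters with
probability at most \<open>\<delta>\<close>, so its mean-square effect is of order \<open>sqrt \<delta>\<close> by the fourth moment. For the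
rest, the squared error on a cell is at most the total width \<open>W = s2 - s1\<close> times the increment of
the increasing function \<open>h\<close> over the cell; the cells have probability \<open>\<delta>\<close> and the increments
telescope, which gives \<open>\<delta> * W\<^sup>2\<close>. Finally, \<open>W\<^sup>2\<close> is of order \<open>1 / sqrt \<delta>\<close> by Markov's inequality
for the fourth moment.\<close>

lemma quantization_error_bound:
  assumes i: "1 \<le> i"
  shows "integrable M (\<lambda>\<omega>. (Y i \<omega> - quantized b i \<omega>)\<^sup>2)"
    and "expectation (\<lambda>\<omega>. (Y i \<omega> - quantized b i \<omega>)\<^sup>2) \<le> 28 * 2 powr (- (real b / 2))"
proof -
  define \<delta> :: real where "\<delta> = 1 / 2 ^ b"
  have \<delta>: "0 < \<delta>" "\<delta> \<le> 1" by (auto simp: \<delta>_def)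
  define s where "s = sqrt \<delta>"
  have s: "0 < s" "s * s = \<delta>" using \<delta> by (auto simp: s_def)
  define cl where "cl u = max (\<delta>/2) (min (1 - \<delta>/2) u)" for u
  \<comment> \<open>The quantile function with arguments confined to the range that contains all midpoints.\<close>
  define h where "h u = normal_quantile (cl u)" for u
  define s1 where "s1 = normal_quantile (\<delta>/2)"
  define s2 where "s2 = normal_quantile (1 - \<delta>/2)"
  have clb: "\<delta>/2 \<le> cl u" "cl u \<le> 1 - \<delta>/2" "0 < cl u" "cl u < 1" for u using \<delta> by (auto simp: cl_def)
  have hmono: "h u \<le> h v" if "u \<le> v" for u v
    unfolding h_def by (rule normal_quantile_mono) (use clb[of u] clb[of v] that in \<open>auto simp: cl_def\<close>)
  have hb: "s1 \<le> h u" "h u \<le> s2" for u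
    unfolding h_def s1_def s2_def using clb[of u] \<delta> by (auto intro!: normal_quantile_mono)
  have sgn: "s1 \<le> 0" "0 \<le> s2"
    using normal_quantile_mono[of "\<delta>/2" "1/2"] normal_quantile_mono[of "1/2" "1 - \<delta>/2"] \<delta>
    by (auto simp: s1_def s2_def normal_quantile_half)
  define W where "W = s2 - s1"
  have W0: "0 \<le> W" using sgn by (simp add: W_def)
  define A where "A = {\<omega>\<in>space M. unif i \<omega> \<le> \<delta>/2} \<union> {\<omega>\<in>space M. 1 - \<delta>/2 < unif i \<omega> \<and> unif i \<omega> \<le> 1}"
  have A_meas[measurable]: "A \<in> events" unfolding A_def using i by measurable
  have pA: "prob A \<le> \<delta>"
  proof -
    have "prob A \<le> prob {\<omega>\<in>space M. unif i \<omega> \<le> \<delta>/2} + prob {\<omega>\<in>space M. 1 - \<delta>/2 < unif i \<omega> \<and> unif i \<omega> \<le> 1}"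
      unfolding A_def using i by (intro measure_Un_le) measurable
    also have "\<dots> = \<delta>/2 + (1 - (1 - \<delta>/2))"
      using i \<delta> by (intro arg_cong2[where f = "(+)"] prob_unif_le prob_unif_interval) auto
    also have "\<dots> = \<delta>" by simp
    finally show ?thesis .
  qed
  have tail: "s' ^ 4 * (\<delta>/2) \<le> 3"
    if B: "B \<in> events" "prob B = \<delta>/2" "\<And>\<omega>. \<omega> \<in> B \<Longrightarrow> \<bar>s'\<bar> \<le> \<bar>Y i \<omega>\<bar>" for B s'
  proof -
    have "s' ^ 4 * (\<delta>/2) = expectation (\<lambda>\<omega>. s' ^ 4 * indicator B \<omega>)" using B by simp
    also have "\<dots> \<le> expectation (\<lambda>\<omega>. Y i \<omega> ^ 4)"
    proof (intro integral_mono)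
      show "integrable M (\<lambda>\<omega>. s' ^ 4 * indicator B \<omega>)"
        using B by (intro integrable_mult_right integrable_real_indicator) (auto simp: less_top[symmetric])
      show "s' ^ 4 * indicator B \<omega> \<le> Y i \<omega> ^ 4" for \<omega>
      proof (cases "\<omega> \<in> B")
        case True
        then have "\<bar>s'\<bar> ^ 4 \<le> \<bar>Y i \<omega>\<bar> ^ 4" using B(3) by (intro power_mono) auto
        then show ?thesis using True by simp
      qed simp
    qed (rule integrable_Y_power[OF i])
    also have "\<dots> = 3" using i by (rule expectation_Y_fourth)
    finally show ?thesis .
  qed
  have Yq: "Y i \<omega> = normal_quantile (unif i \<omega>)" for \<omega> by (simp add: unif_def)
  have small: "s'\<^sup>2 \<le> 3 / s" if "s' ^ 4 * (\<delta>/2) \<le> 3" for s' :: real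
  proof (rule power2_le_imp_le)
    have "s' ^ 4 \<le> 6 / \<delta>" using that \<delta> by (simp add: field_simps)
    also have "\<dots> \<le> 9 / \<delta>" using \<delta> by (simp add: field_simps)
    also have "\<dots> = (3 / s)\<^sup>2" using s by (simp add: power2_eq_square)
    finally show "(s'\<^sup>2)\<^sup>2 \<le> (3 / s)\<^sup>2" by simp
  qed (use s in simp)
  have "s1\<^sup>2 \<le> 3 / s"
  proof (rule small, rule tail)
    show "{\<omega>\<in>space M. unif i \<omega> \<le> \<delta>/2} \<in> events" using i by measurable
    show "prob {\<omega>\<in>space M. unif i \<omega> \<le> \<delta>/2} = \<delta>/2" using i \<delta> by (intro prob_unif_le) auto
    fix \<omega> assume "\<omega> \<in> {\<omega>\<in>space M. unif i \<omega> \<le> \<delta>/2}"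
    then have "Y i \<omega> \<le> s1" unfolding Yq s1_def using unif_bounds[of i \<omega>] \<delta> by (intro normal_quantile_mono) auto
    then show "\<bar>s1\<bar> \<le> \<bar>Y i \<omega>\<bar>" using sgn by simp
  qed
  moreover have "s2\<^sup>2 \<le> 3 / s"
  proof (rule small, rule tail)
    show "{\<omega>\<in>space M. 1 - \<delta>/2 < unif i \<omega> \<and> unif i \<omega> \<le> 1} \<in> events" using i by measurable
    show "prob {\<omega>\<in>space M. 1 - \<delta>/2 < unif i \<omega> \<and> unif i \<omega> \<le> 1} = \<delta>/2"
      using i \<delta> by (subst prob_unif_interval) auto
    fix \<omega> assume "\<omega> \<in> {\<omega>\<in>space M. 1 - \<delta>/2 < unif i \<omega> \<and> unif i \<omega> \<le> 1}"
    then have "s2 \<le> Y i \<omega>" unfolding Yq s2_def using unif_bounds[of i \<omega>] \<delta> by (intro normal_quantile_mono) auto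
    then show "\<bar>s2\<bar> \<le> \<bar>Y i \<omega>\<bar>" using sgn by simp
  qed
  moreover have "W\<^sup>2 \<le> 2 * s1\<^sup>2 + 2 * s2\<^sup>2"
    unfolding W_def using sum_power2_ge_zero[of "s1 + s2" 0] by (simp add: power2_eq_square algebra_simps)
  ultimately have W2: "W\<^sup>2 \<le> 12 / s" by simp
  have p1: "(Y i \<omega> - h (unif i \<omega>))\<^sup>2 \<le> (s * Y i \<omega> ^ 4 + indicator A \<omega> / s) / 2" if \<omega>: "\<omega> \<in> space M" for \<omega>
  proof (cases "\<omega> \<in> A")
    case False
    then have "cl (unif i \<omega>) = unif i \<omega>" using \<omega> unif_bounds[of i \<omega>] by (auto simp: A_def cl_def)
    then have "h (unif i \<omega>) = Y i \<omega>" by (simp add: h_def Yq)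
    then show ?thesis using s by simp
  next
    case True
    have "\<bar>Y i \<omega> - h (unif i \<omega>)\<bar> \<le> \<bar>Y i \<omega>\<bar>"
    proof (cases "unif i \<omega> \<le> \<delta>/2")
      case True
      then have "Y i \<omega> \<le> s1" unfolding Yq s1_def using unif_bounds[of i \<omega>] \<delta> by (intro normal_quantile_mono) auto
      moreover have "h (unif i \<omega>) = s1" using True \<delta> by (simp add: h_def s1_def cl_def)
      ultimately show ?thesis using sgn by simp
    next
      case False
      then have u: "1 - \<delta>/2 < unif i \<omega>" using \<open>\<omega> \<in> A\<close> by (auto simp: A_def)
      then have "s2 \<le> Y i \<omega>" unfolding Yq s2_def using unif_bounds[of i \<omega>] \<delta> by (intro normal_quantile_mono) auto
      moreover have "h (unif i \<omega>) = s2" using u \<delta> by (simp add: h_def s2_def cl_def)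
      ultimately show ?thesis using sgn by simp
    qed
    then have "(Y i \<omega> - h (unif i \<omega>))\<^sup>2 \<le> (Y i \<omega>)\<^sup>2" by (simp add: abs_le_square_iff)
    \<comment> \<open>Arithmetic-geometric mean inequality, with weights that balance the two expectations.\<close>
    also have "\<dots> \<le> (s * Y i \<omega> ^ 4 + 1 / s) / 2"
    proof -
      have "0 \<le> (s * (Y i \<omega>)\<^sup>2 - 1)\<^sup>2" by simp
      then have "2 * s * (Y i \<omega>)\<^sup>2 \<le> s * s * Y i \<omega> ^ 4 + 1"
        by (simp add: power2_eq_square algebra_simps power4_eq_xxxx)
      then show ?thesis using s(1) by (simp add: field_simps)
    qed
    finally show ?thesis using True by simp
  qed
  define H where "H k = h (real (Suc k) / 2 ^ b) - h (real k / 2 ^ b)" for k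
  have p2: "(h (unif i \<omega>) - quantized b i \<omega>)\<^sup>2 \<le> (\<Sum>k<2 ^ b. (W * H k) * indicator (cell b i k) \<omega>)"
    if \<omega>: "\<omega> \<in> space M" for \<omega>
  proof -
    obtain j where j: "j < 2 ^ b" "\<lceil>2 ^ b * unif i \<omega>\<rceil> = int j + 1" by (rule cell_exists)
    define m where "m = (real j + 1/2) / 2 ^ b"
    have m: "dyadic_mid b (unif i \<omega>) = m" by (simp add: dyadic_mid_def j(2) m_def)
    have jb: "real j + 1 \<le> 2 ^ b" using j(1) by (metis Suc_leI of_nat_Suc of_nat_le_iff of_nat_numeral of_nat_power add.commute)
    have "cl m = m"
    proof -
      have "m = real j / 2 ^ b + \<delta>/2" by (simp add: m_def \<delta>_def add_divide_distrib)
      moreover have "real j / 2 ^ b + \<delta> \<le> 1" using jb by (simp add: \<delta>_def add_divide_distrib[symmetric])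
      ultimately have "\<delta>/2 \<le> m" "m \<le> 1 - \<delta>/2" by simp_all
      then show ?thesis by (simp add: cl_def)
    qed
    then have q: "quantized b i \<omega> = h m" by (simp add: quantized_def m h_def)
    have "\<omega> \<in> cell b i j" using in_cell_iff[OF \<omega>] j by simp
    then have u: "real j / 2 ^ b \<le> unif i \<omega>" "unif i \<omega> \<le> real (Suc j) / 2 ^ b" by (auto simp: cell_def)
    have "real j / 2 ^ b \<le> m" "m \<le> real (Suc j) / 2 ^ b" by (auto simp: m_def divide_right_mono)
    then have "h (real j / 2 ^ b) \<le> h m" "h m \<le> h (real (Suc j) / 2 ^ b)"
      "h (real j / 2 ^ b) \<le> h (unif i \<omega>)" "h (unif i \<omega>) \<le> h (real (Suc j) / 2 ^ b)"
      using u by (auto intro!: hmono)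
    then have d: "\<bar>h (unif i \<omega>) - h m\<bar> \<le> H j" unfolding H_def by linarith
    have "\<bar>h (unif i \<omega>) - h m\<bar> \<le> W" using hb[of m] hb[of "unif i \<omega>"] unfolding W_def by linarith
    then have "\<bar>h (unif i \<omega>) - h m\<bar> * \<bar>h (unif i \<omega>) - h m\<bar> \<le> W * H j"
      using d W0 by (intro mult_mono) auto
    then have "(h (unif i \<omega>) - quantized b i \<omega>)\<^sup>2 \<le> W * H j"
      by (simp add: q power2_eq_square abs_mult[symmetric])
    then show ?thesis using sum_over_cells[OF \<omega> j, of "\<lambda>k. W * H k"] by simp
  qed
  define G where "G \<omega> = (s * Y i \<omega> ^ 4 + indicator A \<omega> / s) + 2 * (\<Sum>k<2 ^ b. (W * H k) * indicator (cell b i k) \<omega>)" for \<omega>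
  have dom: "(Y i \<omega> - quantized b i \<omega>)\<^sup>2 \<le> G \<omega>" if "\<omega> \<in> space M" for \<omega>
  proof -
    have "(Y i \<omega> - quantized b i \<omega>)\<^sup>2 \<le> 2 * (Y i \<omega> - h (unif i \<omega>))\<^sup>2 + 2 * (h (unif i \<omega>) - quantized b i \<omega>)\<^sup>2"
    proof -
      have "(x + y)\<^sup>2 \<le> 2 * x\<^sup>2 + 2 * y\<^sup>2" for x y :: real
        using zero_le_power2[of "x - y"] by (simp add: power2_eq_square algebra_simps)
      from this[of "Y i \<omega> - h (unif i \<omega>)" "h (unif i \<omega>) - quantized b i \<omega>"] show ?thesis by simp
    qed
    moreover have "x \<le> c + 2 * d" if "x \<le> 2 * a + 2 * b" "a \<le> c / 2" "b \<le> d" for x a b c d :: real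
      using that by linarith
    ultimately show ?thesis unfolding G_def using p1[OF that] p2[OF that] by blast
  qed
  have indI: "integrable M (indicator B :: 'a \<Rightarrow> real)" if "B \<in> events" for B
    using that by (intro integrable_real_indicator) (auto simp: less_top[symmetric])
  have ints: "integrable M (\<lambda>\<omega>. s * Y i \<omega> ^ 4)" "integrable M (\<lambda>\<omega>. indicator A \<omega> / s)"
     "\<And>k. integrable M (\<lambda>\<omega>. (W * H k) * indicator (cell b i k) \<omega>)"
    using i by (auto intro!: integrable_mult_right integrable_divide indI integrable_Y_power)
  have Gint: "integrable M G"
    unfolding G_def[abs_def] 
    by (rule Bochner_Integration.integrable_add[OF Bochner_Integration.integrable_add[OF ints(1,2)]
        integrable_mult_right[OF Bochner_Integration.integrable_sum[OF ints(3)]]])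
  show int: "integrable M (\<lambda>\<omega>. (Y i \<omega> - quantized b i \<omega>)\<^sup>2)"
  proof (rule Bochner_Integration.integrable_bound[OF Gint])
    show "AE \<omega> in M. norm ((Y i \<omega> - quantized b i \<omega>)\<^sup>2) \<le> norm (G \<omega>)"
      using dom by (intro AE_I2) fastforce
  qed (use i in measurable)
  have "expectation (\<lambda>\<omega>. (Y i \<omega> - quantized b i \<omega>)\<^sup>2) \<le> expectation G"
    using int Gint dom by (intro integral_mono) auto
  also have "expectation G = (s * 3 + prob A / s) + 2 * (\<Sum>k<2 ^ b. W * H k * \<delta>)"
  proof -
    have "expectation G = expectation (\<lambda>\<omega>. s * Y i \<omega> ^ 4) + expectation (\<lambda>\<omega>. indicator A \<omega> / s)
       + 2 * (\<Sum>k<2 ^ b. expectation (\<lambda>\<omega>. (W * H k) * indicator (cell b i k) \<omega>))"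
    proof -
      have "expectation G = expectation (\<lambda>\<omega>. s * Y i \<omega> ^ 4 + indicator A \<omega> / s)
          + expectation (\<lambda>\<omega>. 2 * (\<Sum>k<2 ^ b. (W * H k) * indicator (cell b i k) \<omega>))"
        unfolding G_def[abs_def]
        by (rule Bochner_Integration.integral_add[OF Bochner_Integration.integrable_add[OF ints(1,2)]
          integrable_mult_right[OF Bochner_Integration.integrable_sum[OF ints(3)]]])
      also have "expectation (\<lambda>\<omega>. s * Y i \<omega> ^ 4 + indicator A \<omega> / s)
          = expectation (\<lambda>\<omega>. s * Y i \<omega> ^ 4) + expectation (\<lambda>\<omega>. indicator A \<omega> / s)"
        by (rule Bochner_Integration.integral_add[OF ints(1,2)])
      also have "expectation (\<lambda>\<omega>. 2 * (\<Sum>k<2 ^ b. (W * H k) * indicator (cell b i k) \<omega>))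
          = 2 * expectation (\<lambda>\<omega>. \<Sum>k<2 ^ b. (W * H k) * indicator (cell b i k) \<omega>)"
        by (rule integral_mult_right_zero)
      also have "expectation (\<lambda>\<omega>. \<Sum>k<2 ^ b. (W * H k) * indicator (cell b i k) \<omega>)
          = (\<Sum>k<2 ^ b. expectation (\<lambda>\<omega>. (W * H k) * indicator (cell b i k) \<omega>))"
        by (rule Bochner_Integration.integral_sum[OF ints(3)])
      finally show ?thesis .
    qed
    also have "(\<Sum>k<2 ^ b. expectation (\<lambda>\<omega>. (W * H k) * indicator (cell b i k) \<omega>)) = (\<Sum>k<2 ^ b. W * H k * \<delta>)"
      using i by (intro sum.cong refl) (simp add: prob_cell \<delta>_def)
    finally show ?thesis using i by (simp add: expectation_Y_fourth)
  qed
  also have "(\<Sum>k<2 ^ b. W * H k * \<delta>) = W * \<delta> * (h 1 - h 0)"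
  proof -
    have "(\<Sum>k<2 ^ b. W * H k * \<delta>) = W * \<delta> * (\<Sum>k<2 ^ b. H k)" by (simp add: sum_distrib_left mult_ac)
    also have "(\<Sum>k<2 ^ b. H k) = h (real (2 ^ b) / 2 ^ b) - h (real 0 / 2 ^ b)"
      unfolding H_def by (rule sum_lessThan_telescope)
    finally show ?thesis by simp
  qed
  also have "h 1 - h 0 = W" using \<delta> by (simp add: h_def cl_def W_def s1_def s2_def)
  also have "(s * 3 + prob A / s) + 2 * (W * \<delta> * W) \<le> (s * 3 + s) + 2 * (12 * s)"
  proof (intro add_mono mult_left_mono)
    show "prob A / s \<le> s" using pA s by (simp add: divide_le_eq)
    have "W * \<delta> * W = \<delta> * W\<^sup>2" by (simp add: power2_eq_square)
    also have "\<dots> \<le> \<delta> * (12 / s)" using W2 \<delta> by (intro mult_left_mono) auto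
    also have "\<dots> = 12 * s" using s by (simp add: s(2)[symmetric])
    finally show "W * \<delta> * W \<le> 12 * s" .
  qed (use s in auto)
  also have "\<dots> = 28 * s" by simp
  also have "s = 2 powr (- (real b / 2))"
    by (simp add: s_def \<delta>_def powr_half_sqrt[symmetric] powr_minus powr_powr powr_realpow[symmetric] powr_divide real_sqrt_divide inverse_eq_divide)
  finally show "expectation (\<lambda>\<omega>. (Y i \<omega> - quantized b i \<omega>)\<^sup>2) \<le> 28 * 2 powr (- (real b / 2))" .
qed

end

section \<open>Random bits\<close>

abbreviation bit_sequences :: "(nat \<Rightarrow> real) measure" where
  "bit_sequences \<equiv> generator random_bit"

lemma prob_space_random_bit: "prob_space random_bit"
  unfolding random_bit_def by (rule prob_space.prob_space_distr) (auto intro: measure_pmf.prob_space_axioms)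

lemma sets_random_bit [measurable_cong, simp]: "sets random_bit = sets borel"
  by (simp add: random_bit_def)

lemma space_random_bit [simp]: "space random_bit = UNIV"
  by (simp add: random_bit_def)

lemma sets_bit_sequences [measurable_cong]: "sets bit_sequences = sets (Pi\<^sub>M UNIV (\<lambda>_. borel))"
  unfolding generator_def by (intro sets_PiM_cong) auto

lemma space_bit_sequences [simp]: "space bit_sequences = UNIV"
  unfolding generator_def by (simp add: space_PiM)

lemma nn_integral_random_bit:
  assumes "h \<in> borel_measurable borel"
  shows "(\<integral>\<^sup>+x. h x \<partial>random_bit) = (h 0 + h 1) * ennreal (1/2)"
proof -
  have "(\<integral>\<^sup>+x. h x \<partial>random_bit) = (\<integral>\<^sup>+x. h x \<partial>measure_pmf (pmf_of_set {0, 1}))"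
    unfolding random_bit_def using assms by (subst nn_integral_distr) auto
  also have "\<dots> = (\<Sum>x\<in>{0,1}. h x) / card {0, 1::real}"
    by (rule nn_integral_pmf_of_set) auto
  finally show ?thesis by (simp add: divide_ennreal_def)
qed

lemma AE_bits: "AE \<omega> in bit_sequences. \<forall>k. \<omega> k = 0 \<or> \<omega> k = 1"
proof -
  have "AE x in random_bit. x = 0 \<or> x = 1"
    unfolding random_bit_def by (subst AE_distr_iff) (auto simp: AE_measure_pmf_iff)
  then have "AE \<omega> in bit_sequences. \<omega> k = 0 \<or> \<omega> k = 1" for k
    unfolding generator_def by (intro AE_PiM_component prob_space_random_bit) auto
  then show ?thesis by (subst AE_all_countable) blast
qed

interpretation bits: prob_space bit_sequences
  by (intro prob_space_generator prob_space_random_bit)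

lemma bits_indep: "bits.indep_vars (\<lambda>_. borel) (\<lambda>i \<omega>. \<omega> i) UNIV"
proof (subst bits.indep_vars_iff_distr_eq_PiM')
  have c: "distr bit_sequences borel (\<lambda>x. x i) = random_bit" for i
  proof -
    have "distr bit_sequences borel (\<lambda>x. x i) = distr bit_sequences random_bit (\<lambda>x. x i)"
      by (intro distr_cong) auto
    also have "\<dots> = random_bit"
      unfolding generator_def by (rule distr_PiM_component) (auto intro: prob_space_random_bit)
    finally show ?thesis .
  qed
  have "distr bit_sequences (Pi\<^sub>M UNIV (\<lambda>i. borel)) (\<lambda>x. \<lambda>i\<in>UNIV. x i) = distr bit_sequences bit_sequences (\<lambda>x. x)"
    by (intro distr_cong) (auto simp: sets_bit_sequences)
  also have "\<dots> = (\<Pi>\<^sub>M i\<in>UNIV. distr bit_sequences borel (\<lambda>x. x i))"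
    unfolding c by (simp add: generator_def)
  finally show "distr bit_sequences (Pi\<^sub>M UNIV (\<lambda>i. borel)) (\<lambda>x. \<lambda>i\<in>UNIV. x i) =
    (\<Pi>\<^sub>M i\<in>UNIV. distr bit_sequences borel (\<lambda>x. x i))" .
qed auto

definition shift_seq :: "nat \<Rightarrow> (nat \<Rightarrow> real) \<Rightarrow> nat \<Rightarrow> real" where
  "shift_seq s \<omega> k = \<omega> (s + k)"

lemma shift_seq_0 [simp]: "shift_seq 0 \<omega> = \<omega>" and shift_seq_shift [simp]: "shift_seq s (shift_seq t \<omega>) = shift_seq (t + s) \<omega>"
  by (auto simp: shift_seq_def fun_eq_iff add.assoc)

lemma shift_seq_measurable_PiM [measurable]:
  "shift_seq s \<in> measurable (Pi\<^sub>M UNIV (\<lambda>_. borel)) (Pi\<^sub>M UNIV (\<lambda>_. borel))"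
  by (rule measurable_PiM_single') (auto simp: shift_seq_def)

lemma shift_seq_measurable [measurable]: "shift_seq s \<in> measurable bit_sequences bit_sequences"
  using shift_seq_measurable_PiM[of s] by (simp cong: measurable_cong_sets add: sets_bit_sequences)

lemma distr_shift: "distr bit_sequences bit_sequences (shift_seq s) = bit_sequences"
  using distr_PiM_reindex[of UNIV "\<lambda>_. random_bit" "\<lambda>k. s + k" UNIV] prob_space_random_bit
  by (simp add: generator_def shift_seq_def[abs_def] inj_on_def restrict_def)

text \<open>Each new bit becomes the leading binary digit and moves the digits read before one place to the
right. The last \<open>t\<close> bits therefore determine the \<open>t\<close> leading digits.\<close>

fun horner :: "real \<Rightarrow> (nat \<Rightarrow> real) \<Rightarrow> nat \<Rightarrow> real" where
  "horner a \<omega> 0 = a"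
| "horner a \<omega> (Suc t) = (horner a \<omega> t + \<omega> t) / 2"

lemma horner_measurable [measurable]: "(\<lambda>\<omega>. horner a \<omega> t) \<in> borel_measurable (Pi\<^sub>M UNIV (\<lambda>_. borel))"
  by (induction t) auto

lemma horner_cong: "(\<And>k. k < t \<Longrightarrow> \<omega> k = \<omega>' k) \<Longrightarrow> horner a \<omega> t = horner a \<omega>' t"
  by (induction t) auto

lemma horner_add: "horner (horner a \<omega> t) (shift_seq t \<omega>) t' = horner a \<omega> (t + t')"
  by (induction t') (auto simp: shift_seq_def)

lemma horner_bounds:
  assumes "\<And>k. \<omega> k = 0 \<or> \<omega> k = 1" "0 < a" "a \<le> 1"
  shows "0 < horner a \<omega> t" "horner a \<omega> t \<le> 1"
proof (induction t)
  case (Suc t)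
  have "0 \<le> \<omega> t" "\<omega> t \<le> 1" using assms(1)[of t] by auto
  with Suc show "0 < horner a \<omega> (Suc t)" "horner a \<omega> (Suc t) \<le> 1" by auto
qed (use assms in auto)

lemma dyadic_mid_horner:
  assumes "\<And>k. \<omega> k = 0 \<or> \<omega> k = 1" "0 < a" "a \<le> 1"
  shows "dyadic_mid t (horner a \<omega> t) = horner (1/2) \<omega> t"
proof (induction t)
  case 0
  then show ?case using assms by (simp add: dyadic_mid_0)
next
  case (Suc t)
  obtain z :: int where "\<omega> t = of_int z" using assms(1)[of t] by (metis of_int_0 of_int_1)
  then show ?case using dyadic_mid_Suc[of t "horner a \<omega> t" z] Suc by simp
qed

text \<open>Reading only the last \<open>t\<close> of \<open>K + t\<close> bits yields the quantization with \<open>t\<close> bits of the number formed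
by all of them. This couples a coarse sample with a fine one.\<close>

lemma horner_suffix:
  assumes "\<And>k. \<omega> k = 0 \<or> \<omega> k = 1"
  shows "horner (1/2) (shift_seq K \<omega>) t = dyadic_mid t (horner (1/2) \<omega> (K + t))"
proof -
  have "dyadic_mid t (horner (horner (1/2) \<omega> K) (shift_seq K \<omega>) t) = horner (1/2) (shift_seq K \<omega>) t"
    using horner_bounds[OF assms, where a = "1/2" and t = K] assms by (intro dyadic_mid_horner) (auto simp: shift_seq_def)
  then show ?thesis by (simp add: horner_add)
qed

text \<open>The first \<open>N\<close> bits are independent of the remaining ones, which again form a bit sequence.\<close>

lemma nn_integral_bits_split:
  assumes [measurable]: "H \<in> borel_measurable bit_sequences"
  shows "(\<integral>\<^sup>+\<omega>. H \<omega> \<partial>bit_sequences) = (\<integral>\<^sup>+\<omega>. \<integral>\<^sup>+\<omega>'. H (comb_seq N \<omega> \<omega>') \<partial>bit_sequences \<partial>bit_sequences)"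
proof -
  interpret R: prob_space random_bit by (rule prob_space_random_bit)
  interpret S: sequence_space random_bit ..
  have m: "(\<lambda>(\<omega>, \<omega>'). comb_seq N \<omega> \<omega>') \<in> measurable (bit_sequences \<Otimes>\<^sub>M bit_sequences) bit_sequences"
    unfolding generator_def by (rule measurable_comb_seq)
  have "(\<integral>\<^sup>+\<omega>. H \<omega> \<partial>bit_sequences)
      = (\<integral>\<^sup>+\<omega>. H \<omega> \<partial>distr (bit_sequences \<Otimes>\<^sub>M bit_sequences) bit_sequences (\<lambda>(\<omega>, \<omega>'). comb_seq N \<omega> \<omega>'))"
    using S.PiM_comb_seq[of N] by (simp add: generator_def)
  also have "\<dots> = (\<integral>\<^sup>+p. H (case p of (\<omega>, \<omega>') \<Rightarrow> comb_seq N \<omega> \<omega>') \<partial>(bit_sequences \<Otimes>\<^sub>M bit_sequences))"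
    by (subst nn_integral_distr[OF m]) auto
  also have "\<dots> = (\<integral>\<^sup>+\<omega>. \<integral>\<^sup>+\<omega>'. H (comb_seq N \<omega> \<omega>') \<partial>bit_sequences \<partial>bit_sequences)"
    using measurable_compose[OF m assms] by (subst bits.nn_integral_fst[symmetric]) auto
  finally show ?thesis .
qed

text \<open>The result of reading \<open>b\<close> bits is uniformly distributed on the \<open>2 ^ b\<close> midpoints: the last bit decides
between the lower and the upper half.\<close>

lemma nn_integral_horner:
  assumes "h \<in> borel_measurable borel"
  shows "(\<integral>\<^sup>+\<omega>. h (horner (1/2) \<omega> b) \<partial>bit_sequences) = (\<Sum>k<2 ^ b. h ((real k + 1/2) / 2 ^ b) * ennreal (1 / 2 ^ b))"
  using assms
proof (induction b arbitrary: h)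
  case 0
  then show ?case using bits.emeasure_space_1 by simp
next
  case (Suc b)
  note [measurable] = Suc.prems
  have bit: "(\<integral>\<^sup>+\<omega>'. g (\<omega>' 0) \<partial>bit_sequences) = (g 0 + g 1) * ennreal (1/2)" if "g \<in> borel_measurable borel" for g
  proof -
    have "distr bit_sequences random_bit (\<lambda>x. x 0) = random_bit"
      unfolding generator_def by (rule distr_PiM_component) (auto intro: prob_space_random_bit)
    moreover have "(\<lambda>x. x 0) \<in> measurable bit_sequences random_bit"
      unfolding generator_def by (rule measurable_component_singleton) simp
    ultimately have "(\<integral>\<^sup>+\<omega>'. g (\<omega>' 0) \<partial>bit_sequences) = (\<integral>\<^sup>+x. g x \<partial>random_bit)"
      using nn_integral_distr[of "\<lambda>x. x 0" bit_sequences random_bit g] that by simp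
    then show ?thesis using nn_integral_random_bit[OF that] by simp
  qed
  have "(\<integral>\<^sup>+\<omega>. h (horner (1/2) \<omega> (Suc b)) \<partial>bit_sequences)
     = (\<integral>\<^sup>+\<omega>. \<integral>\<^sup>+\<omega>'. h (horner (1/2) (comb_seq b \<omega> \<omega>') (Suc b)) \<partial>bit_sequences \<partial>bit_sequences)"
    by (rule nn_integral_bits_split) measurable
  also have "\<dots> = (\<integral>\<^sup>+\<omega>. \<integral>\<^sup>+\<omega>'. h ((horner (1/2) \<omega> b + \<omega>' 0) / 2) \<partial>bit_sequences \<partial>bit_sequences)"
  proof (intro nn_integral_cong)
    fix \<omega> \<omega>'
    have "horner (1/2) (comb_seq b \<omega> \<omega>') b = horner (1/2) \<omega> b" by (rule horner_cong) (simp add: comb_seq_less)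
    moreover have "comb_seq b \<omega> \<omega>' b = \<omega>' 0" by (simp add: comb_seq_def)
    ultimately show "h (horner (1/2) (comb_seq b \<omega> \<omega>') (Suc b)) = h ((horner (1/2) \<omega> b + \<omega>' 0) / 2)" by simp
  qed
  also have "\<dots> = (\<integral>\<^sup>+\<omega>. (h (horner (1/2) \<omega> b / 2) + h ((horner (1/2) \<omega> b + 1) / 2)) * ennreal (1/2) \<partial>bit_sequences)"
    by (intro nn_integral_cong, subst bit) auto
  also have "\<dots> = (\<Sum>k<2 ^ b. (h ((real k + 1/2) / 2 ^ b / 2) + h (((real k + 1/2) / 2 ^ b + 1) / 2)) * ennreal (1/2) * ennreal (1 / 2 ^ b))"
    by (rule Suc.IH) measurable
  also have "\<dots> = (\<Sum>k<2 ^ b. h ((real k + 1/2) / 2 ^ Suc b) * ennreal (1 / 2 ^ Suc b)) +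
      (\<Sum>k<2 ^ b. h ((real (2 ^ b + k) + 1/2) / 2 ^ Suc b) * ennreal (1 / 2 ^ Suc b))"
    unfolding sum.distrib[symmetric]
  proof (rule sum.cong[OF refl])
    fix k
    have 1: "(real k + 1/2) / 2 ^ b / 2 = (real k + 1/2) / 2 ^ Suc b" by simp
    have 2: "((real k + 1/2) / 2 ^ b + 1) / 2 = (real (2 ^ b + k) + 1/2) / 2 ^ Suc b" by (simp add: field_simps)
    have 3: "ennreal (1/2) * ennreal (1 / 2 ^ b) = ennreal (1 / 2 ^ Suc b)" by (subst ennreal_mult'[symmetric]) auto
    show "(h ((real k + 1/2) / 2 ^ b / 2) + h (((real k + 1/2) / 2 ^ b + 1) / 2)) * ennreal (1/2) * ennreal (1 / 2 ^ b)
       = h ((real k + 1/2) / 2 ^ Suc b) * ennreal (1 / 2 ^ Suc b) + h ((real (2 ^ b + k) + 1/2) / 2 ^ Suc b) * ennreal (1 / 2 ^ Suc b)"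
      unfolding 1 2 mult.assoc 3 by (rule distrib_right)
  qed
  also have "\<dots> = (\<Sum>k<2 ^ Suc b. h ((real k + 1/2) / 2 ^ Suc b) * ennreal (1 / 2 ^ Suc b))"
  proof -
    let ?F = "\<lambda>k. h ((real k + 1/2) / 2 ^ Suc b) * ennreal (1 / 2 ^ Suc b)"
    have "sum ?F {..<2 ^ Suc b} = sum ?F {..<2 ^ b} + sum ?F {2 ^ b..<2 ^ Suc b}"
      by (subst sum.union_disjoint[symmetric]) (auto intro!: sum.cong)
    also have "sum ?F {2 ^ b..<2 ^ Suc b} = (\<Sum>k<2 ^ b. ?F (2 ^ b + k))"
      by (rule sum.reindex_bij_witness[of _ "\<lambda>k. 2 ^ b + k" "\<lambda>k. k - 2 ^ b"]) auto
    finally show ?thesis by simp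
  qed
  finally show ?case .
qed

text \<open>The summands use consecutive blocks of bits and are therefore independent. The function \<open>acc\<close> is
characterized by its recursion along the list, in which the bits used by the first summand are
dropped for the others.\<close>

lemma sum_independent_blocks:
  fixes D :: "'x \<Rightarrow> (nat \<Rightarrow> real) \<Rightarrow> real" and B :: "'x \<Rightarrow> nat"
  fixes acc :: "'x list \<Rightarrow> (nat \<Rightarrow> real) \<Rightarrow> real"
  assumes acc: "\<And>\<omega>. acc [] \<omega> = 0" "\<And>x xs \<omega>. acc (x # xs) \<omega> = D x \<omega> + acc xs (shift_seq (B x) \<omega>)"
    and meas: "\<And>x. x \<in> set xs \<Longrightarrow> D x \<in> borel_measurable bit_sequences"
    and local: "\<And>x \<omega> \<omega>'. x \<in> set xs \<Longrightarrow> (\<And>k. k < B x \<Longrightarrow> \<omega> k = \<omega>' k) \<Longrightarrow> D x \<omega> = D x \<omega>'"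
    and sq: "\<And>x. x \<in> set xs \<Longrightarrow> integrable bit_sequences (\<lambda>\<omega>. (D x \<omega>)\<^sup>2)"
  shows "acc xs \<in> borel_measurable bit_sequences \<and> integrable bit_sequences (\<lambda>\<omega>. (acc xs \<omega>)\<^sup>2)
    \<and> bits.expectation (acc xs) = (\<Sum>x\<leftarrow>xs. bits.expectation (D x))
    \<and> bits.variance (acc xs) \<le> (\<Sum>x\<leftarrow>xs. bits.expectation (\<lambda>\<omega>. (D x \<omega>)\<^sup>2))"
  using meas local sq
proof (induction xs)
  case Nil
  have "acc [] = (\<lambda>_. 0)" using acc by auto
  then show ?case by simp
next
  case (Cons x xs)
  define N where "N = B x"
  define A where "A = acc xs"
  have IH: "A \<in> borel_measurable bit_sequences" "integrable bit_sequences (\<lambda>\<omega>. (A \<omega>)\<^sup>2)"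
    "bits.expectation A = (\<Sum>x\<leftarrow>xs. bits.expectation (D x))"
    "bits.variance A \<le> (\<Sum>x\<leftarrow>xs. bits.expectation (\<lambda>\<omega>. (D x \<omega>)\<^sup>2))"
  proof -
    have "acc xs \<in> borel_measurable bit_sequences \<and> integrable bit_sequences (\<lambda>\<omega>. (acc xs \<omega>)\<^sup>2)
      \<and> bits.expectation (acc xs) = (\<Sum>x\<leftarrow>xs. bits.expectation (D x))
      \<and> bits.variance (acc xs) \<le> (\<Sum>x\<leftarrow>xs. bits.expectation (\<lambda>\<omega>. (D x \<omega>)\<^sup>2))"
    proof (rule Cons.IH)
      fix y assume y: "y \<in> set xs"
      then have y': "y \<in> set (x # xs)" by simp
      show "D y \<in> borel_measurable bit_sequences" by (rule Cons.prems(1)[OF y'])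
      show "integrable bit_sequences (\<lambda>\<omega>. (D y \<omega>)\<^sup>2)" by (rule Cons.prems(3)[OF y'])
      show "D y \<omega> = D y \<omega>'" if "\<And>k. k < B y \<Longrightarrow> \<omega> k = \<omega>' k" for \<omega> \<omega>'
        by (rule Cons.prems(2)[OF y' that])
    qed
    then show "A \<in> borel_measurable bit_sequences" "integrable bit_sequences (\<lambda>\<omega>. (A \<omega>)\<^sup>2)"
      "bits.expectation A = (\<Sum>x\<leftarrow>xs. bits.expectation (D x))"
      "bits.variance A \<le> (\<Sum>x\<leftarrow>xs. bits.expectation (\<lambda>\<omega>. (D x \<omega>)\<^sup>2))"
      unfolding A_def by blast+
  qed
  have Dm[measurable]: "D x \<in> borel_measurable bit_sequences" and Dsq: "integrable bit_sequences (\<lambda>\<omega>. (D x \<omega>)\<^sup>2)"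
    using Cons.prems(1)[of x] Cons.prems(3)[of x] by simp_all
  note [measurable] = IH(1)
  define A' where "A' \<omega> = A (shift_seq N \<omega>)" for \<omega>
  have A'm[measurable]: "A' \<in> borel_measurable bit_sequences" unfolding A'_def[abs_def] by measurable
  have trans: "integrable bit_sequences (\<lambda>\<omega>. g (shift_seq N \<omega>)) \<longleftrightarrow> integrable bit_sequences g"
    "bits.expectation (\<lambda>\<omega>. g (shift_seq N \<omega>)) = bits.expectation g"
    if [measurable]: "g \<in> borel_measurable bit_sequences" for g :: "_ \<Rightarrow> real"
    using integrable_distr_eq[of "shift_seq N" bit_sequences bit_sequences g]
      integral_distr[of "shift_seq N" bit_sequences bit_sequences g] by (auto simp: distr_shift)
  have A'sq: "integrable bit_sequences (\<lambda>\<omega>. (A' \<omega>)\<^sup>2)"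
    unfolding A'_def using IH(2) by (subst trans) auto
  have A'e: "bits.expectation A' = bits.expectation A" unfolding A'_def[abs_def] by (rule trans) measurable
  have A'v: "bits.variance A' = bits.variance A"
    unfolding A'e unfolding A'_def[abs_def] by (rule trans) measurable
  have Dint: "integrable bit_sequences (D x)" by (rule bits.square_integrable_imp_integrable[OF Dm Dsq])
  have A'int: "integrable bit_sequences A'" by (rule bits.square_integrable_imp_integrable[OF A'm A'sq])
  have ind: "bits.indep_var borel (D x) borel A'"
  proof -
    have i: "bits.indep_var (PiM {..<N} (\<lambda>_. borel)) (\<lambda>\<omega>. restrict (\<lambda>i. \<omega> i) {..<N})
        (PiM {N..} (\<lambda>_. borel)) (\<lambda>\<omega>. restrict (\<lambda>i. \<omega> i) {N..})"
      by (rule bits.indep_var_restrict[OF bits_indep]) auto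
    have m1: "(\<lambda>r. D x (\<lambda>k. if k < N then r k else 0)) \<in> borel_measurable (PiM {..<N} (\<lambda>_. borel))"
    proof (rule measurable_compose[OF _ Dm])
      have "(\<lambda>r k. if k < N then r k else 0) \<in> measurable (PiM {..<N} (\<lambda>_. borel)) (PiM UNIV (\<lambda>_. borel :: real measure))"
      proof (rule measurable_PiM_single')
        show "(\<lambda>r. if k < N then r k else 0) \<in> borel_measurable (PiM {..<N} (\<lambda>_. borel))" for k
          by (cases "k < N") auto
      qed auto
      then show "(\<lambda>r k. if k < N then r k else 0) \<in> measurable (PiM {..<N} (\<lambda>_. borel)) bit_sequences"
        by (simp cong: measurable_cong_sets add: sets_bit_sequences)
    qed
    have m2: "(\<lambda>r. A (\<lambda>k. r (N + k))) \<in> borel_measurable (PiM {N..} (\<lambda>_. borel))"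
    proof (rule measurable_compose[OF _ IH(1)])
      have "(\<lambda>r k. r (N + k)) \<in> measurable (PiM {N..} (\<lambda>_. borel)) (PiM UNIV (\<lambda>_. borel :: real measure))"
        by (rule measurable_PiM_single') auto
      then show "(\<lambda>r k. r (N + k)) \<in> measurable (PiM {N..} (\<lambda>_. borel)) bit_sequences"
        by (simp cong: measurable_cong_sets add: sets_bit_sequences)
    qed
    have "(\<lambda>r. D x (\<lambda>k. if k < N then r k else 0)) \<circ> (\<lambda>\<omega>. restrict (\<lambda>i. \<omega> i) {..<N}) = D x"
    proof
      fix \<omega> show "((\<lambda>r. D x (\<lambda>k. if k < N then r k else 0)) \<circ> (\<lambda>\<omega>. restrict (\<lambda>i. \<omega> i) {..<N})) \<omega> = D x \<omega>"
        unfolding comp_def by (rule Cons.prems(2)) (auto simp: N_def)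
    qed
    moreover have "(\<lambda>r. A (\<lambda>k. r (N + k))) \<circ> (\<lambda>\<omega>. restrict (\<lambda>i. \<omega> i) {N..}) = A'"
      by (auto simp: A'_def shift_seq_def[abs_def])
    ultimately show ?thesis using bits.indep_var_compose[OF i m1 m2] by simp
  qed
  have prodint: "integrable bit_sequences (\<lambda>\<omega>. D x \<omega> * A' \<omega>)"
    and prodexp: "bits.expectation (\<lambda>\<omega>. D x \<omega> * A' \<omega>) = bits.expectation (D x) * bits.expectation A'"
    using bits.indep_var_integrable[OF ind Dint A'int] bits.indep_var_lebesgue_integral[OF ind Dint A'int] by auto
  have eq: "acc (x # xs) = (\<lambda>\<omega>. D x \<omega> + A' \<omega>)" using acc(2) by (simp add: A'_def A_def N_def fun_eq_iff)
  have sqi: "integrable bit_sequences (\<lambda>\<omega>. (D x \<omega> + A' \<omega>)\<^sup>2)"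
    unfolding power2_sum using Dsq A'sq prodint by (intro Bochner_Integration.integrable_add) (auto simp: mult.assoc)
  have e: "bits.expectation (\<lambda>\<omega>. D x \<omega> + A' \<omega>) = bits.expectation (D x) + bits.expectation A'"
    using Dint A'int by simp
  have "bits.variance (\<lambda>\<omega>. D x \<omega> + A' \<omega>) = bits.expectation (\<lambda>\<omega>. (D x \<omega> + A' \<omega>)\<^sup>2) - (bits.expectation (D x) + bits.expectation A')\<^sup>2"
    using bits.variance_eq[OF _ sqi] Dint A'int e by simp
  also have "bits.expectation (\<lambda>\<omega>. (D x \<omega> + A' \<omega>)\<^sup>2) =
     bits.expectation (\<lambda>\<omega>. (D x \<omega>)\<^sup>2) + bits.expectation (\<lambda>\<omega>. (A' \<omega>)\<^sup>2) + 2 * (bits.expectation (D x) * bits.expectation A')"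
    unfolding power2_sum prodexp[symmetric] using Dsq A'sq prodint by (simp add: mult.assoc)
  finally have "bits.variance (\<lambda>\<omega>. D x \<omega> + A' \<omega>) = bits.expectation (\<lambda>\<omega>. (D x \<omega>)\<^sup>2) - (bits.expectation (D x))\<^sup>2 + bits.variance A'"
    using bits.variance_eq[OF A'int A'sq] by (simp add: power2_sum)
  also have "\<dots> \<le> bits.expectation (\<lambda>\<omega>. (D x \<omega>)\<^sup>2) + (\<Sum>x\<leftarrow>xs. bits.expectation (\<lambda>\<omega>. (D x \<omega>)\<^sup>2))"
    using IH(4) A'v zero_le_power2[of "bits.expectation (D x)"] by linarith
  finally show ?case unfolding eq using sqi e IH(3) A'e by simp
qed

context gaussian_series
begin

lemma distr_horner_eq:
  assumes "1 \<le> i"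
  shows "distr bit_sequences borel (\<lambda>\<omega>. horner (1/2) (shift_seq s \<omega>) b) = distr M borel (\<lambda>\<omega>. dyadic_mid b (unif i \<omega>))"
proof (rule measure_eqI)
  have hm: "(\<lambda>\<omega>. horner (1/2) (shift_seq s \<omega>) b) \<in> borel_measurable bit_sequences" by measurable
  fix A :: "real set" assume "A \<in> sets (distr bit_sequences borel (\<lambda>\<omega>. horner (1/2) (shift_seq s \<omega>) b))"
  then have A[measurable]: "A \<in> sets borel" by simp
  have "emeasure (distr bit_sequences borel (\<lambda>\<omega>. horner (1/2) (shift_seq s \<omega>) b)) A
      = (\<integral>\<^sup>+\<omega>. indicator A (horner (1/2) (shift_seq s \<omega>) b) \<partial>bit_sequences)"
    using nn_integral_distr[of "\<lambda>\<omega>. horner (1/2) (shift_seq s \<omega>) b" bit_sequences borel "indicator A"] by simp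
  also have "\<dots> = (\<integral>\<^sup>+\<omega>. indicator A (horner (1/2) \<omega> b) \<partial>distr bit_sequences bit_sequences (shift_seq s))"
    by (subst nn_integral_distr) auto
  also have "\<dots> = (\<integral>\<^sup>+\<omega>. indicator A (horner (1/2) \<omega> b) \<partial>bit_sequences)" by (simp add: distr_shift)
  also have "\<dots> = (\<integral>\<^sup>+\<omega>. indicator A (dyadic_mid b (unif i \<omega>)) \<partial>M)"
    using assms by (subst nn_integral_horner, simp, subst nn_integral_dyadic_mid_unif) auto
  also have "\<dots> = emeasure (distr M borel (\<lambda>\<omega>. dyadic_mid b (unif i \<omega>))) A"
    using nn_integral_distr[of "\<lambda>\<omega>. dyadic_mid b (unif i \<omega>)" M borel "indicator A"] assms by simp
  finally show "emeasure (distr bit_sequences borel (\<lambda>\<omega>. horner (1/2) (shift_seq s \<omega>) b)) A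
      = emeasure (distr M borel (\<lambda>\<omega>. dyadic_mid b (unif i \<omega>))) A" .
qed simp

text \<open>Both sides are product measures with equal factors: on the left because disjoint blocks of bits are
independent, on the right because the \<open>Y i\<close> are.\<close>

lemma distr_horner_vector_eq:
  fixes I :: "nat set" and b s :: "nat \<Rightarrow> nat"
  assumes I: "I \<noteq> {}" "I \<subseteq> {1..}"
    and disj: "disjoint_family_on (\<lambda>i. {s i..<s i + b i}) I"
  shows "distr bit_sequences (Pi\<^sub>M I (\<lambda>_. borel)) (\<lambda>\<omega>. \<lambda>i\<in>I. horner (1/2) (shift_seq (s i) \<omega>) (b i))
       = distr M (Pi\<^sub>M I (\<lambda>_. borel)) (\<lambda>\<omega>. \<lambda>i\<in>I. dyadic_mid (b i) (unif i \<omega>))"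
proof -
  have ind1: "bits.indep_vars (\<lambda>_. borel) (\<lambda>i \<omega>. horner (1/2) (shift_seq (s i) \<omega>) (b i)) I"
  proof -
    let ?K = "\<lambda>i. {s i..<s i + b i}"
    have 1: "bits.indep_vars (\<lambda>i. PiM (?K i) (\<lambda>_. borel)) (\<lambda>i \<omega>. restrict (\<lambda>k. \<omega> k) (?K i)) I"
      by (rule bits.indep_vars_restrict[OF bits_indep _ disj]) auto
    let ?h = "\<lambda>i r. horner (1/2) (\<lambda>k. if k < b i then r (s i + k) else 0) (b i)"
    have 2: "?h i \<in> borel_measurable (PiM (?K i) (\<lambda>_. borel))" for i
    proof (rule measurable_compose[OF _ horner_measurable])
      show "(\<lambda>r k. if k < b i then r (s i + k) else 0) \<in> measurable (PiM (?K i) (\<lambda>_. borel)) (PiM UNIV (\<lambda>_. borel :: real measure))"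
      proof (rule measurable_PiM_single')
        show "(\<lambda>r. if k < b i then r (s i + k) else 0) \<in> borel_measurable (PiM (?K i) (\<lambda>_. borel))" for k
          by (cases "k < b i") auto
      qed auto
    qed
    have "bits.indep_vars (\<lambda>_. borel) (\<lambda>i \<omega>. ?h i (restrict (\<lambda>k. \<omega> k) (?K i))) I"
      by (rule bits.indep_vars_compose2[OF 1]) (rule 2)
    moreover have "?h i (restrict (\<lambda>k. \<omega> k) (?K i)) = horner (1/2) (shift_seq (s i) \<omega>) (b i)" for i \<omega>
      by (rule horner_cong) (auto simp: shift_seq_def)
    ultimately show ?thesis by simp
  qed
  have ind2: "indep_vars (\<lambda>_. borel) (\<lambda>i \<omega>. dyadic_mid (b i) (unif i \<omega>)) I"
    unfolding unif_def
    by (rule indep_vars_compose2[OF indep_vars_subset[OF Y_indep I(2)], of "\<lambda>i y. dyadic_mid (b i) (std_normal_cdf y)" "\<lambda>_. borel"]) auto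
  have "distr bit_sequences (Pi\<^sub>M I (\<lambda>_. borel)) (\<lambda>\<omega>. \<lambda>i\<in>I. horner (1/2) (shift_seq (s i) \<omega>) (b i))
      = (\<Pi>\<^sub>M i\<in>I. distr bit_sequences borel (\<lambda>\<omega>. horner (1/2) (shift_seq (s i) \<omega>) (b i)))"
    using ind1 by (subst (asm) bits.indep_vars_iff_distr_eq_PiM') (use I in auto)
  also have "\<dots> = (\<Pi>\<^sub>M i\<in>I. distr M borel (\<lambda>\<omega>. dyadic_mid (b i) (unif i \<omega>)))"
    using I by (intro PiM_cong refl distr_horner_eq) auto
  also have "\<dots> = distr M (Pi\<^sub>M I (\<lambda>_. borel)) (\<lambda>\<omega>. \<lambda>i\<in>I. dyadic_mid (b i) (unif i \<omega>))"
    using ind2 by (subst (asm) indep_vars_iff_distr_eq_PiM') (use I in auto)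
  finally show ?thesis .
qed

end

section \<open>Straight-line programs\<close>

text \<open>The length of a program is free of charge, so loops can be unrolled completely. Without jumps, the
instructions are carried out once each in the order of the list, and a program is the composition
of its instructions. The dimension in every evaluation is fixed, which yields a bound on the cost
independent of the input; measurability of the elementary functions that occur makes the output a
random variable.\<close>

definition straight_line :: "program \<Rightarrow> bool" where
  "straight_line P \<longleftrightarrow> (\<forall>i\<in>set P. case i of JumpLess _ _ _ \<Rightarrow> False | IdxJumpLess _ _ _ \<Rightarrow> False
     | Eval _ _ (Ind _) \<Rightarrow> False | Elem g _ _ \<Rightarrow> elemfun_sem g \<in> borel_measurable borel | _ \<Rightarrow> True)"

definition static_cost :: "instr \<Rightarrow> nat" where
  "static_cost i = (case i of Eval _ _ (Dir m) \<Rightarrow> max 1 m | _ \<Rightarrow> 1)"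

lemma straight_line_append [simp]: "straight_line (P @ Q) \<longleftrightarrow> straight_line P \<and> straight_line Q"
  by (auto simp: straight_line_def)

lemma straight_line_concat [simp]: "straight_line (concat Ps) \<longleftrightarrow> (\<forall>P\<in>set Ps. straight_line P)"
  by (auto simp: straight_line_def)

lemma pc_exec:
  assumes "straight_line [i]" shows "pc (exec e l f \<omega> i c) = Suc (pc c)"
  using assms by (cases i) (auto simp: straight_line_def wr_def next_instr_def idx_wr_def)

lemma instr_cost_le_static_cost:
  assumes "straight_line [i]" shows "instr_cost e i c \<le> static_cost i"
proof (cases i)
  case (Eval a b m)
  then obtain k where m: "m = Dir k" using assms by (cases m) (auto simp: straight_line_def)
  have "eval_cost e (sample_point e c b (Dir k)) \<le> max 1 k"
    using eval_cost_bounds(2)[OF sample_point_in_span[of e c b "Dir k"]] by simp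
  then show ?thesis using Eval m by (simp add: static_cost_def)
qed (auto simp: static_cost_def)

lemma config_at_straight_line:
  assumes "straight_line P" "k \<le> length P"
  shows "config_at e l P f \<omega> k = fold (exec e l f \<omega>) (take k P) initial \<and> pc (config_at e l P f \<omega> k) = k"
  using assms(2)
proof (induction k)
  case 0
  then show ?case by (simp add: config_at_0 initial_def)
next
  case (Suc k)
  then have IH: "config_at e l P f \<omega> k = fold (exec e l f \<omega>) (take k P) initial" "pc (config_at e l P f \<omega> k) = k"
    by auto
  have i: "straight_line [P ! k]" using assms(1) Suc.prems by (auto simp: straight_line_def)
  have "config_at e l P f \<omega> (Suc k) = exec e l f \<omega> (P ! k) (config_at e l P f \<omega> k)"
    using Suc.prems IH(2) by (simp add: config_at_Suc step_def halted_def)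
  moreover have "take (Suc k) P = take k P @ [P ! k]" using Suc.prems by (simp add: take_Suc_conv_app_nth)
  ultimately show ?case using IH by (simp add: pc_exec[OF i])
qed

lemmas fold_config_at = config_at_straight_line[THEN conjunct1]
lemmas pc_config_at = config_at_straight_line[THEN conjunct2]

lemma config_at_straight_line_halted:
  assumes "straight_line P" "length P \<le> k"
  shows "halted P (config_at e l P f \<omega> k)"
  using assms(2)
proof (induction k rule: dec_induct)
  case base
  then show ?case by (simp add: halted_def pc_config_at[OF assms(1) order_refl])
next
  case (step k)
  then show ?case by (simp add: config_at_Suc step_def)
qed

lemma halted_straight_line_iff:
  assumes "straight_line P"
  shows "halted P (config_at e l P f \<omega> k) \<longleftrightarrow> length P \<le> k"
proof
  assume h: "halted P (config_at e l P f \<omega> k)"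
  show "length P \<le> k"
  proof (rule ccontr)
    assume "\<not> length P \<le> k"
    then show False using h by (simp add: halted_def pc_config_at[OF assms])
  qed
qed (rule config_at_straight_line_halted[OF assms])

lemma alg_output_straight_line:
  assumes "straight_line P"
  shows "alg_output e l P f \<omega> = reg (fold (exec e l f \<omega>) P initial) 0"
proof -
  have "(LEAST k. length P \<le> k) = length P" by (rule Least_equality) auto
  then show ?thesis
    using fold_config_at[OF assms order_refl, of e l f \<omega>]
    by (auto simp: alg_output_def halted_straight_line_iff[OF assms])
qed

lemma alg_cost_straight_line:
  assumes "straight_line P"
  shows "alg_cost e l P f \<omega> = of_nat (\<Sum>k<length P. instr_cost e (P ! k) (config_at e l P f \<omega> k))"
proof -
  have pc: "pc (config_at e l P f \<omega> k) = k" if "k < length P" for k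
    by (rule pc_config_at[OF assms]) (use that in simp)
  have "alg_cost e l P f \<omega> = (\<Sum>k<length P. let c = config_at e l P f \<omega> k
           in if halted P c then 0 else of_nat (instr_cost e (P ! pc c) c))"
    unfolding alg_cost_def by (rule suminf_finite) (auto simp: halted_straight_line_iff[OF assms] Let_def)
  also have "\<dots> = (\<Sum>k<length P. of_nat (instr_cost e (P ! k) (config_at e l P f \<omega> k)))"
    by (intro sum.cong refl) (auto simp: halted_straight_line_iff[OF assms] Let_def pc)
  finally show ?thesis by simp
qed

lemma alg_cost_straight_line_le:
  assumes "straight_line P"
  shows "alg_cost e l P f \<omega> \<le> of_nat (\<Sum>i\<leftarrow>P. static_cost i)"
proof -
  have "(\<Sum>k<length P. instr_cost e (P ! k) (config_at e l P f \<omega> k)) \<le> (\<Sum>k<length P. static_cost (P ! k))"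
    by (intro sum_mono instr_cost_le_static_cost) (use assms in \<open>auto simp: straight_line_def\<close>)
  also have "\<dots> = (\<Sum>i\<leftarrow>P. static_cost i)" by (simp add: sum_list_sum_nth atLeast0LessThan)
  finally show ?thesis unfolding alg_cost_straight_line[OF assms] by (simp only: of_nat_le_iff)
qed

section \<open>The multilevel program\<close>

text \<open>One step of the recursion of \<open>horner\<close>. Register 1 receives the bit, register 2 holds the number
\<open>1/2\<close>, and register 3 contains the fine approximation.\<close>

definition fine_loop :: program where
  "fine_loop = [Random (Dir 1), Arith Plus (Dir 3) (Dir 3) (Dir 1), Arith Times (Dir 3) (Dir 3) (Dir 2)]"

text \<open>The same bit is used for the coarse approximation in register 4.\<close>

definition joint_loop :: program where
  "joint_loop = fine_loop @ [Arith Plus (Dir 4) (Dir 4) (Dir 1), Arith Times (Dir 4) (Dir 4) (Dir 2)]"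

text \<open>The coarse approximation starts only after the first \<open>K\<close> bits, so it is built from the last \<open>b\<close> of
the \<open>K + b\<close> bits and has its value as described in \<open>horner_suffix\<close>. The coordinates of
the fine point occupy the \<open>n\<close> registers from 10 on, those of the coarse point the \<open>n\<close> registers after
them.\<close>

definition coordinate_code :: "nat \<Rightarrow> nat \<Rightarrow> nat \<Rightarrow> nat \<Rightarrow> program" where
  "coordinate_code n K b i =
     [Const (Dir 3) (1/2)] @ concat (replicate K fine_loop) @
     [Const (Dir 4) (1/2)] @ concat (replicate b joint_loop) @
     [Eigenvalue (Dir 7) (Dir i), Elem Sqrt (Dir 7) (Dir 7),
      Elem NormalQuantile (Dir 3) (Dir 3), Arith Times (Dir (9 + i)) (Dir 7) (Dir 3),
      Elem NormalQuantile (Dir 4) (Dir 4), Arith Times (Dir (9 + n + i)) (Dir 7) (Dir 4)]"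

lemmas exec_simps = rd_def wr_def next_instr_def

lemma fold_fine_loops:
  fixes e :: "nat \<Rightarrow> 'h::real_inner" and l :: "nat \<Rightarrow> real" and f :: "'h \<Rightarrow> real" and \<omega> :: "nat \<Rightarrow> real" and K :: nat
  assumes "reg c 2 = 1/2"
  defines "c' \<equiv> fold (exec e l f \<omega>) (concat (replicate K fine_loop)) c"
  shows "calls c' = calls c + K \<and> reg c' 3 = horner (reg c 3) (shift_seq (calls c) \<omega>) K
    \<and> (\<forall>r. r \<noteq> 1 \<longrightarrow> r \<noteq> 3 \<longrightarrow> reg c' r = reg c r)"
  unfolding c'_def
proof (induction K)
  case (Suc K)
  define d where "d = fold (exec e l f \<omega>) (concat (replicate K fine_loop)) c"
  have "concat (replicate (Suc K) fine_loop) = concat (replicate K fine_loop) @ fine_loop"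
    by (simp flip: replicate_append_same)
  then have eq: "fold (exec e l f \<omega>) (concat (replicate (Suc K) fine_loop)) c = fold (exec e l f \<omega>) fine_loop d"
    by (simp add: d_def)
  have d: "calls d = calls c + K" "reg d 3 = horner (reg c 3) (shift_seq (calls c) \<omega>) K"
    "\<And>r. r \<noteq> 1 \<Longrightarrow> r \<noteq> 3 \<Longrightarrow> reg d r = reg c r"
    using Suc by (auto simp: d_def)
  have d2: "reg d 2 = 1/2" using d assms(1) by simp
  have sh: "shift_seq (calls c) \<omega> K = \<omega> (calls c + K)" by (simp add: shift_seq_def)
  show ?case unfolding eq by (simp add: fine_loop_def exec_simps sh d d2 assms(1))
qed simp

lemma fold_joint_loops:
  fixes e :: "nat \<Rightarrow> 'h::real_inner" and l :: "nat \<Rightarrow> real" and f :: "'h \<Rightarrow> real" and \<omega> :: "nat \<Rightarrow> real" and b :: nat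
  assumes "reg c 2 = 1/2"
  defines "c' \<equiv> fold (exec e l f \<omega>) (concat (replicate b joint_loop)) c"
  shows "calls c' = calls c + b \<and> reg c' 3 = horner (reg c 3) (shift_seq (calls c) \<omega>) b
    \<and> reg c' 4 = horner (reg c 4) (shift_seq (calls c) \<omega>) b
    \<and> (\<forall>r. r \<noteq> 1 \<longrightarrow> r \<noteq> 3 \<longrightarrow> r \<noteq> 4 \<longrightarrow> reg c' r = reg c r)"
  unfolding c'_def
proof (induction b)
  case (Suc K)
  define d where "d = fold (exec e l f \<omega>) (concat (replicate K joint_loop)) c"
  have "concat (replicate (Suc K) joint_loop) = concat (replicate K joint_loop) @ joint_loop"
    by (simp flip: replicate_append_same)
  then have eq: "fold (exec e l f \<omega>) (concat (replicate (Suc K) joint_loop)) c = fold (exec e l f \<omega>) joint_loop d"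
    by (simp add: d_def)
  have d: "calls d = calls c + K" "reg d 3 = horner (reg c 3) (shift_seq (calls c) \<omega>) K"
    "reg d 4 = horner (reg c 4) (shift_seq (calls c) \<omega>) K"
    "\<And>r. r \<noteq> 1 \<Longrightarrow> r \<noteq> 3 \<Longrightarrow> r \<noteq> 4 \<Longrightarrow> reg d r = reg c r"
    using Suc by (auto simp: d_def)
  have d2: "reg d 2 = 1/2" using d assms(1) by simp
  have sh: "shift_seq (calls c) \<omega> K = \<omega> (calls c + K)" by (simp add: shift_seq_def)
  show ?case unfolding eq by (simp add: joint_loop_def fine_loop_def exec_simps sh d d2 assms(1))
qed simp

lemma fold_coordinate_code:
  fixes e :: "nat \<Rightarrow> 'h::real_inner" and l :: "nat \<Rightarrow> real" and f :: "'h \<Rightarrow> real" and \<omega> :: "nat \<Rightarrow> real" and n K b i :: nat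
  assumes "reg c 2 = 1/2" "1 \<le> i" "i \<le> n"
  defines "c' \<equiv> fold (exec e l f \<omega>) (coordinate_code n K b i) c"
  shows "calls c' = calls c + (K + b)"
    and "reg c' (9 + i) = sqrt (l i) * normal_quantile (horner (1/2) (shift_seq (calls c) \<omega>) (K + b))"
    and "reg c' (9 + n + i) = sqrt (l i) * normal_quantile (horner (1/2) (shift_seq (calls c + K) \<omega>) b)"
    and "\<And>r. r \<notin> {1, 3, 4, 7, 9 + i, 9 + n + i} \<Longrightarrow> reg c' r = reg c r"
proof -
  define c1 where "c1 = exec e l f \<omega> (Const (Dir 3) (1/2)) c"
  define c2 where "c2 = fold (exec e l f \<omega>) (concat (replicate K fine_loop)) c1"
  define c3 where "c3 = exec e l f \<omega> (Const (Dir 4) (1/2)) c2"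
  define c4 where "c4 = fold (exec e l f \<omega>) (concat (replicate b joint_loop)) c3"
  have c': "c' = fold (exec e l f \<omega>) [Eigenvalue (Dir 7) (Dir i), Elem Sqrt (Dir 7) (Dir 7),
      Elem NormalQuantile (Dir 3) (Dir 3), Arith Times (Dir (9 + i)) (Dir 7) (Dir 3),
      Elem NormalQuantile (Dir 4) (Dir 4), Arith Times (Dir (9 + n + i)) (Dir 7) (Dir 4)] c4"
    by (simp only: c'_def coordinate_code_def c4_def c3_def c2_def c1_def fold_append comp_apply fold.simps id_apply)
  have r1: "reg c1 = (reg c)(3 := 1/2)" "calls c1 = calls c" by (auto simp: c1_def exec_simps)
  have r2: "calls c2 = calls c + K" "reg c2 3 = horner (1/2) (shift_seq (calls c) \<omega>) K"
     "\<And>r. r \<noteq> 1 \<Longrightarrow> r \<noteq> 3 \<Longrightarrow> reg c2 r = reg c r"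
    using fold_fine_loops[where c = c1 and e = e and l = l and f = f and \<omega> = \<omega> and K = K] assms(1) by (auto simp: r1 c2_def)
  have r3: "reg c3 = (reg c2)(4 := 1/2)" "calls c3 = calls c2" by (auto simp: c3_def exec_simps)
  have "reg c3 2 = 1/2" using assms(1) r3 r2(3) by simp
  from fold_joint_loops[OF this, where e = e and l = l and f = f and \<omega> = \<omega> and b = b]
  have r4: "calls c4 = calls c + K + b"
     "reg c4 3 = horner (horner (1/2) (shift_seq (calls c) \<omega>) K) (shift_seq K (shift_seq (calls c) \<omega>)) b"
     "reg c4 4 = horner (1/2) (shift_seq (calls c + K) \<omega>) b"
     "\<And>r. r \<noteq> 1 \<Longrightarrow> r \<noteq> 3 \<Longrightarrow> r \<noteq> 4 \<Longrightarrow> reg c4 r = reg c r"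
    using r2 by (auto simp: r3 c4_def)
  have r43: "reg c4 3 = horner (1/2) (shift_seq (calls c) \<omega>) (K + b)" unfolding r4(2) horner_add ..
  have n: "n \<noteq> 0" "i \<noteq> 0" using assms by auto
  show "calls c' = calls c + (K + b)"
    "reg c' (9 + i) = sqrt (l i) * normal_quantile (horner (1/2) (shift_seq (calls c) \<omega>) (K + b))"
    "reg c' (9 + n + i) = sqrt (l i) * normal_quantile (horner (1/2) (shift_seq (calls c + K) \<omega>) b)"
    "\<And>r. r \<notin> {1, 3, 4, 7, 9 + i, 9 + n + i} \<Longrightarrow> reg c' r = reg c r"
    unfolding c' using n by (auto simp: exec_simps r4(1,3) r43 intro: r4(4))
qed

text \<open>The number of bits for coordinate \<open>i\<close> on level \<open>l\<close>: \<open>K\<close> bits for each dyadic block from that of \<open>i\<close>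
up to the block \<open>l - 1\<close>. It vanishes for \<open>i \<ge> 2 ^ l\<close>; quantization with no bits gives the
median \<open>0\<close>, so truncation of the expansion is a special case of quantization.\<close>

definition precision :: "nat \<Rightarrow> nat \<Rightarrow> nat \<Rightarrow> nat" where
  "precision K l i = K * (l - floor_log i)"

definition bit_offset :: "nat \<Rightarrow> nat \<Rightarrow> nat \<Rightarrow> nat" where
  "bit_offset K l i = (\<Sum>j=1..<i. precision K l j)"

abbreviation bit_count :: "nat \<Rightarrow> nat \<Rightarrow> nat" where
  "bit_count K l \<equiv> bit_offset K l (2 ^ l)"

lemma floor_log_less: "i < 2 ^ l \<Longrightarrow> 1 \<le> i \<Longrightarrow> floor_log i < l"
  using floor_log_exp2_le[of i] by (metis less_le_trans linorder_not_less not_one_le_zero not_gr_zero order.strict_trans1 power_increasing_iff one_less_numeral_iff semiring_norm(76) power_strict_increasing_iff)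

lemma precision_split:
  assumes "1 \<le> i" "i < 2 ^ l" shows "precision K l i = K + precision K (l - 1) i"
proof -
  have "l - floor_log i = Suc (l - 1 - floor_log i)" using floor_log_less[OF assms(2,1)] by simp
  then show ?thesis by (simp add: precision_def)
qed

text \<open>Although the first coordinates receive many bits, there are few of them: passing to the next level
adds \<open>K\<close> bits to each of fewer than \<open>2 ^ (l + 1)\<close> coordinates.\<close>

lemma bit_count_le: "bit_count K l \<le> 2 * K * 2 ^ l"
proof (induction l)
  case 0
  then show ?case by (simp add: bit_offset_def)
next
  case (Suc l)
  have "bit_count K (Suc l) = (\<Sum>i=1..<2 ^ Suc l. K + precision K l i)"
    unfolding bit_offset_def by (intro sum.cong refl) (use precision_split[of _ "Suc l" K] in auto)
  also have "\<dots> = K * (2 ^ Suc l - 1) + (\<Sum>i=1..<2 ^ Suc l. precision K l i)"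
    by (simp add: sum.distrib mult.commute)
  also have "(\<Sum>i=1..<2 ^ Suc l. precision K l i) = (\<Sum>i=1..<2 ^ l. precision K l i)"
  proof (rule sum.mono_neutral_right)
    show "\<forall>i\<in>{1..<2 ^ Suc l} - {1..<2 ^ l}. precision K l i = 0"
    proof
      fix i :: nat assume "i \<in> {1..<2 ^ Suc l} - {1..<2 ^ l}"
      then have "2 ^ l \<le> i" by auto
      then have "floor_log (2 ^ l) \<le> floor_log i" by (rule monoD[OF floor_log_mono])
      then show "precision K l i = 0" by (simp add: precision_def)
    qed
  qed auto
  also have "\<dots> \<le> 2 * K * 2 ^ l" using Suc by (simp add: bit_offset_def)
  also have "K * (2 ^ Suc l - 1) + 2 * K * 2 ^ l \<le> 2 * K * 2 ^ Suc l"
  proof -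
    have "K * (2 ^ Suc l - 1) \<le> K * 2 ^ Suc l" by (intro mult_left_mono) auto
    then show ?thesis by simp
  qed
  finally show ?case by simp
qed

definition fine_coord :: "nat \<Rightarrow> nat \<Rightarrow> nat \<Rightarrow> (nat \<Rightarrow> real) \<Rightarrow> real" where
  "fine_coord K l i \<omega> = horner (1/2) (shift_seq (bit_offset K l i) \<omega>) (precision K l i)"

definition coarse_coord :: "nat \<Rightarrow> nat \<Rightarrow> nat \<Rightarrow> (nat \<Rightarrow> real) \<Rightarrow> real" where
  "coarse_coord K l i \<omega> = horner (1/2) (shift_seq (bit_offset K l i + K) \<omega>) (precision K (l - 1) i)"

definition gauss_point :: "(nat \<Rightarrow> real) \<Rightarrow> (nat \<Rightarrow> 'h::real_inner) \<Rightarrow> nat \<Rightarrow> (nat \<Rightarrow> real) \<Rightarrow> 'h" where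
  "gauss_point lam e n u = (\<Sum>i=1..n. (sqrt (lam i) * normal_quantile (u i)) *\<^sub>R e i)"

definition level_difference :: "(nat \<Rightarrow> real) \<Rightarrow> (nat \<Rightarrow> 'h::real_inner) \<Rightarrow> ('h \<Rightarrow> real)
    \<Rightarrow> nat \<Rightarrow> nat \<Rightarrow> (nat \<Rightarrow> real) \<Rightarrow> real" where
  "level_difference lam e f K l \<omega> =
     f (gauss_point lam e (2 ^ l - 1) (\<lambda>i. fine_coord K l i \<omega>)) -
     f (gauss_point lam e (2 ^ l - 1) (\<lambda>i. coarse_coord K l i \<omega>))"

text \<open>One sample of the difference of the integrand on the levels \<open>l\<close> and \<open>l - 1\<close>, multiplied by \<open>w\<close> and
added to register 0.\<close>

definition sample_code :: "nat \<Rightarrow> real \<times> nat \<Rightarrow> program" where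
  "sample_code K x = (case x of (w, l) \<Rightarrow> let n = 2 ^ l - 1 in
     concat (map (\<lambda>i. coordinate_code n K (precision K (l - 1) i) i) [1..<2 ^ l]) @
     [Eval (Dir 5) (Dir 10) (Dir n), Eval (Dir 6) (Dir (10 + n)) (Dir n),
      Arith Minus (Dir 5) (Dir 5) (Dir 6), Const (Dir 6) w,
      Arith Times (Dir 5) (Dir 6) (Dir 5), Arith Plus (Dir 0) (Dir 0) (Dir 5)])"

lemma fold_coordinates:
  fixes e :: "nat \<Rightarrow> 'h::real_inner" and lam :: "nat \<Rightarrow> real" and f :: "'h \<Rightarrow> real" and \<omega> :: "nat \<Rightarrow> real" and l m K :: nat
  assumes "reg c 2 = 1/2" "m \<le> 2 ^ l" "1 \<le> m"
  defines "n \<equiv> 2 ^ l - 1"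
  defines "c' \<equiv> fold (exec e lam f \<omega>) (concat (map (\<lambda>i. coordinate_code n K (precision K (l - 1) i) i) [1..<m])) c"
  shows "calls c' = calls c + bit_offset K l m \<and> reg c' 0 = reg c 0 \<and> reg c' 2 = 1/2 \<and>
    (\<forall>i. 1 \<le> i \<longrightarrow> i < m \<longrightarrow>
      reg c' (9 + i) = sqrt (lam i) * normal_quantile (fine_coord K l i (shift_seq (calls c) \<omega>)) \<and>
      reg c' (9 + n + i) = sqrt (lam i) * normal_quantile (coarse_coord K l i (shift_seq (calls c) \<omega>)))"
  using assms(3,2) unfolding c'_def
proof (induction m rule: dec_induct)
  case base
  then show ?case using assms(1) by (simp add: bit_offset_def)
next
  case (step m)
  define d where "d = fold (exec e lam f \<omega>) (concat (map (\<lambda>i. coordinate_code n K (precision K (l - 1) i) i) [1..<m])) c"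
  have IH: "calls d = calls c + bit_offset K l m" "reg d 0 = reg c 0" "reg d 2 = 1/2"
    "\<And>i. 1 \<le> i \<Longrightarrow> i < m \<Longrightarrow>
      reg d (9 + i) = sqrt (lam i) * normal_quantile (fine_coord K l i (shift_seq (calls c) \<omega>)) \<and>
      reg d (9 + n + i) = sqrt (lam i) * normal_quantile (coarse_coord K l i (shift_seq (calls c) \<omega>))"
    using step by (auto simp: d_def)
  have m: "m \<le> n" "m < 2 ^ l" using step.prems by (auto simp: n_def)
  define d' where "d' = fold (exec e lam f \<omega>) (coordinate_code n K (precision K (l - 1) m) m) d"
  have eq: "fold (exec e lam f \<omega>) (concat (map (\<lambda>i. coordinate_code n K (precision K (l - 1) i) i) [1..<Suc m])) c = d'"
    using step(1) by (simp add: d'_def d_def)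
  note s = fold_coordinate_code[OF IH(3) step(1) m(1), where e = e and l = lam and f = f and \<omega> = \<omega> and K = K
    and b = "precision K (l - 1) m", folded d'_def]
  have ps: "K + precision K (l - 1) m = precision K l m" using precision_split[OF step(1) m(2)] by simp
  have "bit_offset K l (Suc m) = bit_offset K l m + precision K l m"
    using step(1) by (simp add: bit_offset_def)
  then have 1: "calls d' = calls c + bit_offset K l (Suc m)" using s(1) IH(1) ps by simp
  have 2: "reg d' 0 = reg c 0" "reg d' 2 = 1/2" using s(4)[of 0] s(4)[of 2] IH by auto
  have 3: "reg d' (9 + i) = sqrt (lam i) * normal_quantile (fine_coord K l i (shift_seq (calls c) \<omega>)) \<and>
      reg d' (9 + n + i) = sqrt (lam i) * normal_quantile (coarse_coord K l i (shift_seq (calls c) \<omega>))"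
    if i: "1 \<le> i" "i < Suc m" for i
  proof (cases "i = m")
    case True
    then show ?thesis using s(2,3) IH(1) ps by (simp add: fine_coord_def coarse_coord_def add.assoc)
  next
    case False
    then have im: "i < m" using i by simp
    have "reg d' (9 + i) = reg d (9 + i)" by (rule s(4)) (use i im m in auto)
    moreover have "reg d' (9 + n + i) = reg d (9 + n + i)" by (rule s(4)) (use i im m in auto)
    ultimately show ?thesis using IH(4)[OF i(1) im] by simp
  qed
  show ?case unfolding eq using 1 2 3 by blast
qed

lemma fold_sample_code:
  fixes e :: "nat \<Rightarrow> 'h::real_inner" and lam :: "nat \<Rightarrow> real" and f :: "'h \<Rightarrow> real" and \<omega> :: "nat \<Rightarrow> real" and l K :: nat and w :: real
  assumes "reg c 2 = 1/2"
  defines "c' \<equiv> fold (exec e lam f \<omega>) (sample_code K (w, l)) c"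
  shows "calls c' = calls c + bit_count K l \<and> reg c' 2 = 1/2 \<and>
     reg c' 0 = reg c 0 + w * level_difference lam e f K l (shift_seq (calls c) \<omega>)"
proof -
  define n where "n = (2::nat) ^ l - 1"
  define d where "d = fold (exec e lam f \<omega>) (concat (map (\<lambda>i. coordinate_code n K (precision K (l - 1) i) i) [1..<2 ^ l])) c"
  have d: "calls d = calls c + bit_count K l" "reg d 0 = reg c 0" "reg d 2 = 1/2"
    "\<And>i. 1 \<le> i \<Longrightarrow> i < 2 ^ l \<Longrightarrow>
      reg d (9 + i) = sqrt (lam i) * normal_quantile (fine_coord K l i (shift_seq (calls c) \<omega>)) \<and>
      reg d (9 + n + i) = sqrt (lam i) * normal_quantile (coarse_coord K l i (shift_seq (calls c) \<omega>))"
    using fold_coordinates[OF assms(1), where m = "2 ^ l" and l = l and e = e and lam = lam and f = f and \<omega> = \<omega> and K = K] by (auto simp: d_def n_def)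
  have c': "c' = fold (exec e lam f \<omega>) [Eval (Dir 5) (Dir 10) (Dir n), Eval (Dir 6) (Dir (10 + n)) (Dir n),
      Arith Minus (Dir 5) (Dir 5) (Dir 6), Const (Dir 6) w,
      Arith Times (Dir 5) (Dir 6) (Dir 5), Arith Plus (Dir 0) (Dir 0) (Dir 5)] d"
    unfolding c'_def sample_code_def d_def n_def Let_def case_prod_conv fold_append comp_apply ..
  have p1: "sample_point e d (Dir 10) (Dir n) = gauss_point lam e n (\<lambda>i. fine_coord K l i (shift_seq (calls c) \<omega>))"
    unfolding sample_point_def gauss_point_def
  proof (intro sum.cong)
    fix i assume "i \<in> {1..n}"
    then have i: "1 \<le> i" "i < 2 ^ l" by (auto simp: n_def)
    have "resolve d (Dir 10) + i - 1 = 9 + i" using i by simp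
    then show "reg d (resolve d (Dir 10) + i - 1) *\<^sub>R e i
       = (sqrt (lam i) * normal_quantile (fine_coord K l i (shift_seq (calls c) \<omega>))) *\<^sub>R e i"
      using d(4)[OF i] by simp
  qed simp
  define d1 where "d1 = exec e lam f \<omega> (Eval (Dir 5) (Dir 10) (Dir n)) d"
  have p2: "sample_point e d1 (Dir (10 + n)) (Dir n) = gauss_point lam e n (\<lambda>i. coarse_coord K l i (shift_seq (calls c) \<omega>))"
    unfolding sample_point_def gauss_point_def
  proof (intro sum.cong)
    fix i assume "i \<in> {1..n}"
    then have i: "1 \<le> i" "i < 2 ^ l" by (auto simp: n_def)
    have "resolve d1 (Dir (10 + n)) + i - 1 = 9 + n + i" using i by simp
    moreover have "reg d1 (9 + n + i) = reg d (9 + n + i)" by (simp add: d1_def exec_simps)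
    ultimately show "reg d1 (resolve d1 (Dir (10 + n)) + i - 1) *\<^sub>R e i
       = (sqrt (lam i) * normal_quantile (coarse_coord K l i (shift_seq (calls c) \<omega>))) *\<^sub>R e i"
      using d(4)[OF i] by (simp only:)
  qed simp
  have c'': "c' = fold (exec e lam f \<omega>) [Eval (Dir 6) (Dir (10 + n)) (Dir n),
      Arith Minus (Dir 5) (Dir 5) (Dir 6), Const (Dir 6) w,
      Arith Times (Dir 5) (Dir 6) (Dir 5), Arith Plus (Dir 0) (Dir 0) (Dir 5)] d1"
    unfolding c' d1_def by simp
  have r1: "reg d1 = (reg d)(5 := f (gauss_point lam e n (\<lambda>i. fine_coord K l i (shift_seq (calls c) \<omega>))))" "calls d1 = calls d"
    unfolding d1_def using p1 by (auto simp: exec_simps)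
  define d2 where "d2 = exec e lam f \<omega> (Eval (Dir 6) (Dir (10 + n)) (Dir n)) d1"
  have r2: "reg d2 = (reg d1)(6 := f (gauss_point lam e n (\<lambda>i. coarse_coord K l i (shift_seq (calls c) \<omega>))))" "calls d2 = calls d"
    unfolding d2_def using p2 r1 by (auto simp: exec_simps)
  have "c' = fold (exec e lam f \<omega>) [
      Arith Minus (Dir 5) (Dir 5) (Dir 6), Const (Dir 6) w,
      Arith Times (Dir 5) (Dir 6) (Dir 5), Arith Plus (Dir 0) (Dir 0) (Dir 5)] d2"
    unfolding c'' d2_def by simp
  then show ?thesis using d r1 r2 by (simp add: exec_simps level_difference_def n_def)
qed

text \<open>Real registers initially contain 0, so the first evaluation puts \<open>f 0\<close>, the value on level 0, into the
output register.\<close>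

definition multilevel_program :: "nat \<Rightarrow> (real \<times> nat) list \<Rightarrow> program" where
  "multilevel_program K xs = [Const (Dir 2) (1/2), Eval (Dir 0) (Dir 10) (Dir 1)] @ concat (map (sample_code K) xs)"

fun multilevel_sum where
  "multilevel_sum lam e f K [] \<omega> = 0"
| "multilevel_sum lam e f K (x # xs) \<omega> = fst x * level_difference lam e f K (snd x) \<omega> +
     multilevel_sum lam e f K xs (shift_seq (bit_count K (snd x)) \<omega>)"

lemma fold_samples:
  assumes "reg c 2 = 1/2"
  shows "reg (fold (exec e lam f \<omega>) (concat (map (sample_code K) xs)) c) 0
     = reg c 0 + multilevel_sum lam e f K xs (shift_seq (calls c) \<omega>)"
  using assms
proof (induction xs arbitrary: c)
  case (Cons x xs)
  obtain w l where x: "x = (w, l)" by (cases x)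
  define d where "d = fold (exec e lam f \<omega>) (sample_code K (w, l)) c"
  have d: "calls d = calls c + bit_count K l" "reg d 2 = 1/2"
     "reg d 0 = reg c 0 + w * level_difference lam e f K l (shift_seq (calls c) \<omega>)"
    using fold_sample_code[OF Cons.prems, where e = e and lam = lam and f = f and \<omega> = \<omega> and K = K and w = w and l = l] by (auto simp: d_def)
  have "fold (exec e lam f \<omega>) (concat (map (sample_code K) (x # xs))) c
      = fold (exec e lam f \<omega>) (concat (map (sample_code K) xs)) d" by (simp add: x d_def)
  then show ?case using Cons.IH[OF d(2)] d by (simp add: x)
qed simp

lemma straight_line_coordinate_code: "straight_line (coordinate_code n K b i)"
proof -
  have "straight_line fine_loop" "straight_line joint_loop"
    by (auto simp: fine_loop_def joint_loop_def straight_line_def)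
  moreover have "sqrt \<in> borel_measurable borel" by measurable
  ultimately show ?thesis
    by (auto simp: coordinate_code_def) (auto simp: straight_line_def normal_quantile_measurable)
qed

lemma straight_line_sample_code: "straight_line (sample_code K x)"
proof (cases x)
  case (Pair w l)
  show ?thesis unfolding Pair sample_code_def Let_def case_prod_conv straight_line_append straight_line_concat
    by (auto simp: straight_line_coordinate_code) (auto simp: straight_line_def)
qed

lemma straight_line_multilevel: "straight_line (multilevel_program K xs)"
  unfolding multilevel_program_def straight_line_append straight_line_concat
  by (auto simp: straight_line_sample_code) (auto simp: straight_line_def)

lemma alg_output_multilevel:
  "alg_output e lam (multilevel_program K xs) f \<omega> = f 0 + multilevel_sum lam e f K xs \<omega>"
proof -
  define c where "c = fold (exec e lam f \<omega>) [Const (Dir 2) (1/2), Eval (Dir 0) (Dir 10) (Dir 1)] initial"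
  have c: "reg c 2 = 1/2" "calls c = 0" "reg c 0 = f 0"
    by (auto simp: c_def exec_simps initial_def sample_point_def)
  have "alg_output e lam (multilevel_program K xs) f \<omega> = reg (fold (exec e lam f \<omega>) (concat (map (sample_code K) xs)) c) 0"
    unfolding alg_output_straight_line[OF straight_line_multilevel] by (simp add: multilevel_program_def c_def)
  then show ?thesis using fold_samples[OF c(1)] c by simp
qed

lemma static_cost_sample_code:
  assumes "1 \<le> l"
  shows "(\<Sum>i\<leftarrow>sample_code K (w, l). static_cost i) \<le> (14 + 10 * K) * 2 ^ l"
proof -
  define n where "n = (2::nat) ^ l - 1"
  have n1: "1 \<le> n" using assms power_increasing[of 1 l "2::nat"] by (simp add: n_def)
  have concat: "(\<Sum>i\<leftarrow>concat Ps. static_cost i) = (\<Sum>P\<leftarrow>Ps. \<Sum>i\<leftarrow>P. static_cost i)" for Ps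
    by (induction Ps) auto
  have rep: "(\<Sum>i\<leftarrow>concat (replicate k P). static_cost i) = k * (\<Sum>i\<leftarrow>P. static_cost i)" for k P
    by (induction k) auto
  have coord: "(\<Sum>i\<leftarrow>coordinate_code n K b i. static_cost i) = 8 + 3 * K + 5 * b" for b i
    by (simp add: coordinate_code_def rep) (simp add: fine_loop_def joint_loop_def static_cost_def)
  have "(\<Sum>i\<leftarrow>sample_code K (w, l). static_cost i) = (\<Sum>i\<leftarrow>[1..<2 ^ l]. 8 + 3 * K + 5 * precision K (l - 1) i) + 2 * n + 4"
    using n1 unfolding sample_code_def Let_def case_prod_conv n_def[symmetric]
    by (simp add: concat coord comp_def) (simp add: static_cost_def)
  also have "(\<Sum>i\<leftarrow>[1..<2 ^ l]. 8 + 3 * K + 5 * precision K (l - 1) i) = (\<Sum>i=1..<2 ^ l. 8 + 3 * K + 5 * precision K (l - 1) i)"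
    by (simp add: interv_sum_list_conv_sum_set_nat)
  also have "\<dots> \<le> (\<Sum>i=1..<2 ^ l. 8 + 5 * precision K l i)"
    by (intro sum_mono) (auto simp: precision_split)
  also have "\<dots> = 8 * n + 5 * bit_count K l"
    by (simp add: sum.distrib bit_offset_def sum_distrib_left n_def)
  also have "8 * n + 5 * bit_count K l + 2 * n + 4 \<le> (14 + 10 * K) * 2 ^ l"
  proof -
    define z :: nat where "z = 2 ^ l"
    have z: "n \<le> z" "1 \<le> z" by (auto simp: n_def z_def)
    have "bit_count K l \<le> 2 * (K * z)" using bit_count_le[of K l] by (simp add: z_def mult.assoc)
    moreover have "(14 + 10 * K) * z = 14 * z + 10 * (K * z)" by (simp add: algebra_simps)
    ultimately show ?thesis unfolding z_def[symmetric] using z by linarith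
  qed
  finally show ?thesis by simp
qed

lemma static_cost_multilevel:
  assumes "\<And>x. x \<in> set xs \<Longrightarrow> 1 \<le> snd x"
  shows "(\<Sum>i\<leftarrow>multilevel_program K xs. static_cost i) \<le> 2 + (14 + 10 * K) * (\<Sum>x\<leftarrow>xs. 2 ^ snd x)"
proof -
  have "(\<Sum>i\<leftarrow>concat (map (sample_code K) xs). static_cost i) \<le> (14 + 10 * K) * (\<Sum>x\<leftarrow>xs. 2 ^ snd x)"
    using assms
  proof (induction xs)
    case (Cons x xs)
    have "(\<Sum>i\<leftarrow>sample_code K x. static_cost i) \<le> (14 + 10 * K) * 2 ^ snd x"
      using static_cost_sample_code[of "snd x" K "fst x"] Cons.prems[of x] by simp
    moreover have "(\<Sum>i\<leftarrow>concat (map (sample_code K) xs). static_cost i) \<le> (14 + 10 * K) * (\<Sum>x\<leftarrow>xs. 2 ^ snd x)"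
      by (rule Cons.IH) (use Cons.prems in auto)
    ultimately show ?case by (simp add: algebra_simps)
  qed simp
  then show ?thesis by (simp add: multilevel_program_def static_cost_def)
qed

section \<open>Measurability of outputs and costs\<close>

text \<open>Addresses must not depend on the random bits, and the number of calls of the generator determines
which bit is read next; both are the same for all bit sequences when there are no jumps.\<close>

definition measurable_state :: "((nat \<Rightarrow> real) \<Rightarrow> config) \<Rightarrow> bool" where
  "measurable_state C \<longleftrightarrow> (\<exists>k I. (\<forall>\<omega>. calls (C \<omega>) = k \<and> idx (C \<omega>) = I)) \<and>
     (\<forall>r. (\<lambda>\<omega>. reg (C \<omega>) r) \<in> borel_measurable bit_sequences)"

lemma bit_measurable [measurable]: "(\<lambda>\<omega>. \<omega> k) \<in> borel_measurable bit_sequences"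
  by (simp cong: measurable_cong_sets add: sets_bit_sequences)

lemma sample_point_measurable:
  fixes e :: "nat \<Rightarrow> 'h::{real_inner,polish_space}"
  assumes "measurable_state C"
  shows "(\<lambda>\<omega>. sample_point e (C \<omega>) b m) \<in> borel_measurable bit_sequences"
proof -
  obtain k I where I: "\<And>\<omega>. calls (C \<omega>) = k \<and> idx (C \<omega>) = I" using assms by (auto simp: measurable_state_def)
  have [measurable]: "(\<lambda>\<omega>. reg (C \<omega>) r) \<in> borel_measurable bit_sequences" for r
    using assms by (simp add: measurable_state_def)
  have "\<exists>n. \<forall>\<omega>. resolve (C \<omega>) a = n" for a using I by (cases a) auto
  then obtain n where n: "\<And>a \<omega>. resolve (C \<omega>) a = n a" by metis
  show ?thesis unfolding sample_point_def n by measurable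
qed

lemma binop_measurable:
  fixes u v :: "_ \<Rightarrow> real"
  assumes "u \<in> borel_measurable N" "v \<in> borel_measurable N"
  shows "(\<lambda>x. binop_real g (u x) (v x)) \<in> borel_measurable N"
  using assms by (cases g) auto

lemma measurable_state_exec:
  fixes e :: "nat \<Rightarrow> 'h::{real_inner,polish_space}"
  assumes C: "measurable_state C" and sl: "straight_line [i]" and f: "f \<in> borel_measurable borel"
  shows "measurable_state (\<lambda>\<omega>. exec e l f \<omega> i (C \<omega>))"
proof -
  obtain k I where I: "\<And>\<omega>. calls (C \<omega>) = k" "\<And>\<omega>. idx (C \<omega>) = I"
    using C by (auto simp: measurable_state_def)
  have [measurable]: "(\<lambda>\<omega>. reg (C \<omega>) r) \<in> borel_measurable bit_sequences" for r
    using C by (simp add: measurable_state_def)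
  have "\<exists>n. \<forall>\<omega>. resolve (C \<omega>) a = n" for a using I by (cases a) auto
  then obtain n where n: "\<And>a \<omega>. resolve (C \<omega>) a = n a" by metis
  have rd: "(\<lambda>\<omega>. rd (C \<omega>) a) \<in> borel_measurable bit_sequences" for a
    unfolding rd_def n by measurable
  have wr: "measurable_state (\<lambda>\<omega>. wr a (v \<omega>) (C \<omega>))"
    if "v \<in> borel_measurable bit_sequences" for a v
  proof -
    have "(\<lambda>\<omega>. reg (wr a (v \<omega>) (C \<omega>)) r) \<in> borel_measurable bit_sequences" for r
      using that by (cases "r = n a") (auto simp: wr_def next_instr_def n)
    then show ?thesis unfolding measurable_state_def by (auto simp: wr_def next_instr_def I)
  qed
  have idx: "measurable_state (\<lambda>\<omega>. idx_wr j q (C \<omega>))" for j q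
    unfolding measurable_state_def by (auto simp: idx_wr_def next_instr_def I)
  show ?thesis
  proof (cases i)
    case (Elem g a b)
    have "elemfun_sem g \<in> borel_measurable borel" using sl Elem by (simp add: straight_line_def)
    then show ?thesis using Elem by (simp add: wr measurable_compose[OF rd])
  next
    case (Random a)
    have "measurable_state (\<lambda>\<omega>. wr a (\<omega> k) (C \<omega>))" by (rule wr) measurable
    then show ?thesis using Random unfolding measurable_state_def by (auto simp: I wr_def next_instr_def)
  next
    case (Eval a b m)
    then show ?thesis using sample_point_measurable[OF C, of e b m] f by (simp add: wr measurable_compose[OF _ f])
  qed (use sl in \<open>auto simp: straight_line_def I n wr rd idx binop_measurable\<close>)
qed

lemma measurable_state_fold:
  fixes e :: "nat \<Rightarrow> 'h::{real_inner,polish_space}"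
  assumes "measurable_state C" "straight_line P" "f \<in> borel_measurable borel"
  shows "measurable_state (\<lambda>\<omega>. fold (exec e l f \<omega>) P (C \<omega>))"
  using assms
proof (induction P arbitrary: C)
  case (Cons i P)
  have i: "straight_line [i]" and P: "straight_line P" using Cons.prems(2) by (auto simp: straight_line_def)
  have "measurable_state (\<lambda>\<omega>. exec e l f \<omega> i (C \<omega>))"
    by (rule measurable_state_exec[OF Cons.prems(1) i Cons.prems(3)])
  from Cons.IH[OF this P Cons.prems(3)] show ?case by simp
qed simp

lemma measurable_state_initial: "measurable_state (\<lambda>_. initial)"
  by (simp add: measurable_state_def initial_def)

context gaussian_series
begin

text \<open>A description of the finite-dimensional subspaces by a closed condition, from which their
measurability follows.\<close>

lemma in_span_e_iff: "x \<in> span (e ` {1..n}) \<longleftrightarrow> x - (\<Sum>i=1..n. (x \<bullet> e i) *\<^sub>R e i) = 0"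
proof
  assume "x \<in> span (e ` {1..n})"
  then show "x - (\<Sum>i=1..n. (x \<bullet> e i) *\<^sub>R e i) = 0"
  proof (induction rule: span_induct)
    case base
    show ?case by (auto simp: subspace_def inner_add_left scaleR_left_distrib sum.distrib scaleR_sum_right[symmetric] simp flip: scaleR_scaleR)
  next
    case (step x)
    then obtain j where j: "j \<in> {1..n}" "x = e j" by auto
    have "(\<Sum>i=1..n. (e j \<bullet> e i) *\<^sub>R e i) = (\<Sum>i=1..n. if i = j then e j else 0)"
      by (intro sum.cong refl) (use j in \<open>auto simp: orth\<close>)
    then show ?case using j by simp
  qed
next
  assume "x - (\<Sum>i=1..n. (x \<bullet> e i) *\<^sub>R e i) = 0"
  moreover have "(\<Sum>i=1..n. (x \<bullet> e i) *\<^sub>R e i) \<in> span (e ` {1..n})"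
    by (intro span_sum span_mul span_base) auto
  ultimately show "x \<in> span (e ` {1..n})" by simp
qed

lemma span_e_measurable: "span (e ` {1..n}) \<in> sets borel"
proof -
  have "{x \<in> space borel. x - (\<Sum>i=1..n. (x \<bullet> e i) *\<^sub>R e i) = 0} \<in> sets borel" by measurable
  moreover have "span (e ` {1..n}) = {x \<in> space borel. x - (\<Sum>i=1..n. (x \<bullet> e i) *\<^sub>R e i) = 0}"
    using in_span_e_iff by auto
  ultimately show ?thesis by simp
qed

text \<open>The cost of an evaluation depends on the random point. The formula makes it a measurable function
of this point.\<close>

lemma eval_cost_eq_sum:
  assumes "x \<in> span (e ` {1..m})" "1 \<le> m"
  shows "eval_cost e x = 1 + (\<Sum>n\<in>{1..<m}. if x \<in> span (e ` {1..n}) then 0 else 1)"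
proof -
  note c = eval_cost_bounds[OF assms]
  have "x \<in> span (e ` {1..n}) \<longleftrightarrow> eval_cost e x \<le> n" if "1 \<le> n" for n
  proof
    assume "x \<in> span (e ` {1..n})"
    from eval_cost_bounds(2)[OF this that] show "eval_cost e x \<le> n" .
  next
    assume "eval_cost e x \<le> n"
    then have "span (e ` {1..eval_cost e x}) \<subseteq> span (e ` {1..n})" by (intro span_mono image_mono) auto
    then show "x \<in> span (e ` {1..n})" using c(3) by blast
  qed
  then have "(\<Sum>n\<in>{1..<m}. if x \<in> span (e ` {1..n}) then 0 else 1 :: nat) = (\<Sum>n\<in>{1..<m}. if n < eval_cost e x then 1 else 0)"
    by (intro sum.cong refl) (auto simp: not_le)
  also have "\<dots> = (\<Sum>n\<in>{1..<eval_cost e x}. 1)"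
    using c by (intro sum.mono_neutral_cong_right) auto
  finally show ?thesis using c by simp
qed

lemma instr_cost_measurable:
  assumes C: "measurable_state C" and sl: "straight_line [i]"
  shows "(\<lambda>\<omega>. of_nat (instr_cost e i (C \<omega>)) :: ennreal) \<in> borel_measurable bit_sequences"
proof (cases i)
  case (Eval a b m)
  then obtain k where m: "m = Dir k" using sl by (cases m) (auto simp: straight_line_def)
  define K where "K = max 1 k"
  have sp: "sample_point e c b (Dir k) \<in> span (e ` {1..K})" for c
    using sample_point_in_span[of e c b "Dir k"] by (simp add: K_def)
  have eq: "of_nat (instr_cost e i (C \<omega>))
     = (1 + (\<Sum>n\<in>{1..<K}. if sample_point e (C \<omega>) b (Dir k) \<in> span (e ` {1..n}) then 0 else 1) :: ennreal)" for \<omega>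
  proof -
    have "instr_cost e i (C \<omega>) = 1 + (\<Sum>n\<in>{1..<K}. if sample_point e (C \<omega>) b (Dir k) \<in> span (e ` {1..n}) then 0 else 1)"
      unfolding Eval m instr_cost.simps by (rule eval_cost_eq_sum[OF sp]) (simp add: K_def)
    then show ?thesis by (simp add: of_nat_sum if_distrib cong: if_cong)
  qed
  note [measurable] = sample_point_measurable[OF C, of e b "Dir k"] span_e_measurable
  show ?thesis unfolding eq by measurable
qed auto

lemma straight_line_in_algorithms:
  assumes P: "straight_line P"
  shows "P \<in> algorithms random_bit e l'"
  unfolding algorithms_def
proof safe
  fix f :: "'h \<Rightarrow> real" assume "f \<in> Lip1"
  then have f: "f \<in> borel_measurable borel" by (rule integrable_Lip1)
  have st: "measurable_state (\<lambda>\<omega>. fold (exec e l' f \<omega>) Q initial)" if "straight_line Q" for Q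
    using measurable_state_fold[OF measurable_state_initial that f] .
  show "alg_output e l' P f \<in> borel_measurable bit_sequences"
    using st[OF P] unfolding alg_output_straight_line[OF P, abs_def] measurable_state_def by blast
  show "alg_cost e l' P f \<in> borel_measurable bit_sequences"
    unfolding alg_cost_straight_line[OF P, abs_def] of_nat_sum
  proof (rule borel_measurable_sum)
    fix k assume k: "k \<in> {..<length P}"
    have 1: "straight_line (take k P)" "straight_line [P ! k]"
      using P k by (auto simp: straight_line_def dest: in_set_takeD)
    have "config_at e l' P f \<omega> k = fold (exec e l' f \<omega>) (take k P) initial" for \<omega>
      by (rule fold_config_at[OF P]) (use k in simp)
    then show "(\<lambda>\<omega>. of_nat (instr_cost e (P ! k) (config_at e l' P f \<omega> k)) :: ennreal) \<in> borel_measurable bit_sequences"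
      using instr_cost_measurable[OF st[OF 1(1)] 1(2)] by simp
  qed
qed

section \<open>The law of a sample on a level\<close>

lemma gauss_point_measurable:
  assumes "{1..n} \<subseteq> I"
  shows "gauss_point l e n \<in> measurable (Pi\<^sub>M I (\<lambda>_. borel)) borel"
  unfolding gauss_point_def[abs_def]
proof (intro borel_measurable_sum borel_measurable_scaleR borel_measurable_times)
  fix i assume "i \<in> {1..n}"
  then have [measurable]: "(\<lambda>u. u i) \<in> borel_measurable (Pi\<^sub>M I (\<lambda>_. borel :: real measure))"
    using assms by (intro measurable_component_singleton) auto
  show "(\<lambda>u. normal_quantile (u i)) \<in> borel_measurable (Pi\<^sub>M I (\<lambda>_. borel))" by measurable
qed auto

lemma gauss_point_cong: "(\<And>i. 1 \<le> i \<Longrightarrow> i \<le> n \<Longrightarrow> u i = v i) \<Longrightarrow> gauss_point l e n u = gauss_point l e n v"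
  unfolding gauss_point_def by (intro sum.cong refl) auto

text \<open>The counterpart on the space of \<open>X\<close> of the point computed by the program, coupled with \<open>X\<close> through the
variables \<open>Y i\<close>.\<close>

definition level_point :: "nat \<Rightarrow> nat \<Rightarrow> 'a \<Rightarrow> 'h" where
  "level_point K lev \<omega> = gauss_point l e (2 ^ lev - 1) (\<lambda>i. dyadic_mid (precision K lev i) (unif i \<omega>))"

lemma level_point_measurable [measurable]: "level_point K lev \<in> borel_measurable M"
proof -
  have "(\<lambda>\<omega>. normal_quantile (dyadic_mid (precision K lev i) (unif i \<omega>))) \<in> borel_measurable M" if "1 \<le> i" for i
    using that by measurable
  then show ?thesis unfolding level_point_def[abs_def] gauss_point_def
    by (intro borel_measurable_sum borel_measurable_scaleR borel_measurable_times) auto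
qed

lemma precision_eq_0: "2 ^ lev \<le> i \<Longrightarrow> precision K lev i = 0"
proof -
  assume "2 ^ lev \<le> i"
  then have "floor_log (2 ^ lev) \<le> floor_log i" by (rule monoD[OF floor_log_mono])
  then show "precision K lev i = 0" by (simp add: precision_def)
qed

lemma level_point_extend:
  assumes "2 ^ lev - 1 \<le> n"
  shows "level_point K lev \<omega> = gauss_point l e n (\<lambda>i. dyadic_mid (precision K lev i) (unif i \<omega>))"
  unfolding level_point_def gauss_point_def
proof (rule sum.mono_neutral_left)
  show "\<forall>i\<in>{1..n} - {1..2 ^ lev - 1}. (sqrt (l i) * normal_quantile (dyadic_mid (precision K lev i) (unif i \<omega>))) *\<^sub>R e i = 0"
  proof
    fix i assume "i \<in> {1..n} - {1..2 ^ lev - 1}"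
    then have "2 ^ lev \<le> i" by auto
    then have "normal_quantile (dyadic_mid (precision K lev i) (unif i \<omega>)) = 0"
      using quantized_0[of i \<omega>] by (simp add: precision_eq_0 quantized_def)
    then show "(sqrt (l i) * normal_quantile (dyadic_mid (precision K lev i) (unif i \<omega>))) *\<^sub>R e i = 0" by simp
  qed
qed (use assms in auto)

lemma level_point_0: "level_point K 0 \<omega> = 0"
  by (simp add: level_point_def gauss_point_def)

lemma bit_blocks_disjoint: "disjoint_family_on (\<lambda>i. {bit_offset K lev i..<bit_offset K lev i + precision K lev i}) {1..n}"
proof -
  have step: "bit_offset K lev i + precision K lev i \<le> bit_offset K lev j" if "1 \<le> i" "i < j" for i j
  proof -
    have "bit_offset K lev i + precision K lev i = bit_offset K lev (Suc i)"
      using that by (simp add: bit_offset_def)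
    also have "\<dots> \<le> bit_offset K lev j"
      unfolding bit_offset_def using that by (intro sum_mono2) auto
    finally show ?thesis .
  qed
  show ?thesis
    unfolding disjoint_family_on_def
  proof (intro ballI impI)
    fix i j assume ij: "i \<in> {1..n}" "j \<in> {1..n}" "i \<noteq> j"
    show "{bit_offset K lev i..<bit_offset K lev i + precision K lev i} \<inter> {bit_offset K lev j..<bit_offset K lev j + precision K lev j} = {}"
      using step[of i j] step[of j i] ij by (cases i j rule: linorder_cases) auto
  qed
qed

text \<open>Almost surely all bits are 0 or 1; then the coarse coordinates are quantizations of the fine
ones, and the difference is a function of the vector of fine coordinates. On the space of \<open>X\<close> it is
the same function of a vector with the same law.\<close>

lemma distr_level_difference:
  fixes f :: "'h \<Rightarrow> real"
  assumes f: "f \<in> borel_measurable borel" and lev: "1 \<le> lev"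
  shows "distr bit_sequences borel (level_difference l e f K lev)
    = distr M borel (\<lambda>\<omega>. f (level_point K lev \<omega>) - f (level_point K (lev - 1) \<omega>))"
    and "level_difference l e f K lev \<in> borel_measurable bit_sequences"
proof -
  define n where "n = (2::nat) ^ lev - 1"
  have n1: "1 \<le> n" using lev power_increasing[of 1 lev "2::nat"] by (simp add: n_def)
  let ?I = "{1..n}"
  let ?P = "Pi\<^sub>M ?I (\<lambda>_. borel :: real measure)"
  define \<Psi> where "\<Psi> u = f (gauss_point l e n u) - f (gauss_point l e n (\<lambda>i. dyadic_mid (precision K (lev - 1) i) (u i)))" for u
  have mid: "(\<lambda>u. \<lambda>i\<in>?I. dyadic_mid (precision K (lev - 1) i) (u i)) \<in> measurable ?P ?P"
    by (intro measurable_restrict) auto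
  have \<Psi>m: "\<Psi> \<in> borel_measurable ?P"
  proof -
    have 1: "(\<lambda>u. f (gauss_point l e n u)) \<in> borel_measurable ?P"
      by (rule measurable_compose[OF gauss_point_measurable f]) simp
    have "(\<lambda>u. f (gauss_point l e n (\<lambda>i\<in>?I. dyadic_mid (precision K (lev - 1) i) (u i)))) \<in> borel_measurable ?P"
      by (rule measurable_compose[OF mid measurable_compose[OF gauss_point_measurable f]]) simp
    also have "(\<lambda>u. f (gauss_point l e n (\<lambda>i\<in>?I. dyadic_mid (precision K (lev - 1) i) (u i))))
       = (\<lambda>u. f (gauss_point l e n (\<lambda>i. dyadic_mid (precision K (lev - 1) i) (u i))))"
      by (intro ext arg_cong[where f = f] gauss_point_cong) auto
    finally show ?thesis unfolding \<Psi>_def[abs_def] by (rule borel_measurable_diff[OF 1])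
  qed
  have fm: "(\<lambda>\<omega>. \<lambda>i\<in>?I. horner (1/2) (shift_seq (s i) \<omega>) (b i)) \<in> measurable bit_sequences ?P" for s b
    by (intro measurable_restrict) measurable
  define V where "V \<omega> = (\<lambda>i\<in>?I. horner (1/2) (shift_seq (bit_offset K lev i) \<omega>) (precision K lev i))" for \<omega>
  define W where "W \<omega> = (\<lambda>i\<in>?I. dyadic_mid (precision K lev i) (unif i \<omega>))" for \<omega>
  have Vm: "V \<in> measurable bit_sequences ?P" unfolding V_def[abs_def] by (rule fm)
  have Wm: "W \<in> measurable M ?P" unfolding W_def[abs_def] by (intro measurable_restrict) measurable
  have law: "distr bit_sequences ?P V = distr M ?P W"
    unfolding V_def[abs_def] W_def[abs_def]
    by (rule distr_horner_vector_eq[OF _ _ bit_blocks_disjoint]) (use n1 in auto)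
  show meas: "level_difference l e f K lev \<in> borel_measurable bit_sequences"
  proof -
    have 1: "(\<lambda>\<omega>. f (gauss_point l e n (V \<omega>))) \<in> borel_measurable bit_sequences"
      by (rule measurable_compose[OF Vm measurable_compose[OF gauss_point_measurable f]]) simp
    have 2: "(\<lambda>\<omega>. f (gauss_point l e n (\<lambda>i\<in>?I. horner (1/2) (shift_seq (bit_offset K lev i + K) \<omega>) (precision K (lev - 1) i)))) \<in> borel_measurable bit_sequences"
      by (rule measurable_compose[OF fm measurable_compose[OF gauss_point_measurable f]]) simp
    have "level_difference l e f K lev = (\<lambda>\<omega>. f (gauss_point l e n (V \<omega>)) -
      f (gauss_point l e n (\<lambda>i\<in>?I. horner (1/2) (shift_seq (bit_offset K lev i + K) \<omega>) (precision K (lev - 1) i))))"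
      unfolding level_difference_def[abs_def] n_def[symmetric]
      by (intro ext arg_cong2[where f = minus] arg_cong[where f = f] gauss_point_cong)
         (auto simp: V_def fine_coord_def coarse_coord_def)
    then show ?thesis using borel_measurable_diff[OF 1 2] by simp
  qed
  have ae: "AE \<omega> in bit_sequences. level_difference l e f K lev \<omega> = \<Psi> (V \<omega>)"
    using AE_bits
  proof eventually_elim
    case (elim \<omega>)
    have "coarse_coord K lev i \<omega> = dyadic_mid (precision K (lev - 1) i) (V \<omega> i)" if i: "1 \<le> i" "i \<le> n" for i
    proof -
      have "precision K lev i = K + precision K (lev - 1) i" using i by (intro precision_split) (auto simp: n_def)
      moreover have "horner (1/2) (shift_seq K (shift_seq (bit_offset K lev i) \<omega>)) (precision K (lev - 1) i)
         = dyadic_mid (precision K (lev - 1) i) (horner (1/2) (shift_seq (bit_offset K lev i) \<omega>) (K + precision K (lev - 1) i))"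
        by (rule horner_suffix) (use elim in \<open>auto simp: shift_seq_def\<close>)
      ultimately show ?thesis using i by (simp add: coarse_coord_def V_def)
    qed
    moreover have "fine_coord K lev i \<omega> = V \<omega> i" if "1 \<le> i" "i \<le> n" for i
      using that by (simp add: fine_coord_def V_def)
    ultimately show ?case
      unfolding level_difference_def \<Psi>_def n_def[symmetric]
      by (intro arg_cong2[where f = minus] arg_cong[where f = f] gauss_point_cong) auto
  qed
  have pw: "\<Psi> (W \<omega>) = f (level_point K lev \<omega>) - f (level_point K (lev - 1) \<omega>)" for \<omega>
  proof -
    have "level_point K (lev - 1) \<omega> = gauss_point l e n (\<lambda>i. dyadic_mid (precision K (lev - 1) i) (unif i \<omega>))"
      by (rule level_point_extend) (auto simp: n_def intro!: diff_le_mono power_increasing)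
    moreover have "precision K (lev - 1) i \<le> precision K lev i" for i
      by (auto simp: precision_def intro!: mult_left_mono)
    ultimately show ?thesis
      unfolding \<Psi>_def level_point_def[of K lev] n_def[symmetric]
      by (intro arg_cong2[where f = minus] arg_cong[where f = f])
         (auto simp: W_def dyadic_mid_dyadic_mid intro!: gauss_point_cong)
  qed
  have "distr bit_sequences borel (level_difference l e f K lev) = distr bit_sequences borel (\<lambda>\<omega>. \<Psi> (V \<omega>))"
    using ae meas measurable_compose[OF Vm \<Psi>m] by (intro distr_cong_AE) auto
  also have "\<dots> = distr (distr bit_sequences ?P V) borel \<Psi>" using Vm \<Psi>m by (subst distr_distr) (auto simp: comp_def)
  also have "\<dots> = distr M borel (\<lambda>\<omega>. \<Psi> (W \<omega>))" unfolding law using Wm \<Psi>m by (subst distr_distr) (auto simp: comp_def)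
  finally show "distr bit_sequences borel (level_difference l e f K lev)
    = distr M borel (\<lambda>\<omega>. f (level_point K lev \<omega>) - f (level_point K (lev - 1) \<omega>))" unfolding pw .
qed

lemma level_difference_local:
  assumes "1 \<le> lev" "\<And>k. k < bit_count K lev \<Longrightarrow> \<omega> k = \<omega>' k"
  shows "level_difference l e f K lev \<omega> = level_difference l e f K lev \<omega>'"
proof -
  have le: "bit_offset K lev i + precision K lev i \<le> bit_count K lev" if "1 \<le> i" "i < 2 ^ lev" for i
  proof -
    have "bit_offset K lev i + precision K lev i = bit_offset K lev (Suc i)" using that by (simp add: bit_offset_def)
    also have "\<dots> \<le> bit_count K lev" unfolding bit_offset_def using that by (intro sum_mono2) auto
    finally show ?thesis .
  qed
  have "fine_coord K lev i \<omega> = fine_coord K lev i \<omega>'" "coarse_coord K lev i \<omega> = coarse_coord K lev i \<omega>'"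
    if i: "1 \<le> i" "i \<le> 2 ^ lev - 1" for i
  proof -
    have i2: "i < 2 ^ lev" using i by (metis One_nat_def Suc_le_lessD Suc_pred le_imp_less_Suc zero_less_numeral zero_less_power)
    note l = le[OF i(1) i2] precision_split[OF i(1) i2, of K]
    show "fine_coord K lev i \<omega> = fine_coord K lev i \<omega>'" "coarse_coord K lev i \<omega> = coarse_coord K lev i \<omega>'"
      unfolding fine_coord_def coarse_coord_def shift_seq_def[abs_def]
      by (intro horner_cong assms(2); use l in simp)+
  qed
  then show ?thesis unfolding level_difference_def
    by (intro arg_cong2[where f = minus] arg_cong[where f = f] gauss_point_cong) auto
qed

end

section \<open>Bias and variance of the multilevel program\<close>

lemma sum_dyadic_blocks:
  fixes h :: "nat \<Rightarrow> real"
  shows "(\<Sum>i=1..2 ^ J - 1. h i) = (\<Sum>j<J. \<Sum>i\<in>{2 ^ j..<2 ^ Suc j}. h i)"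
proof (induction J)
  case (Suc J)
  have "{1..(2::nat) ^ Suc J - 1} = {1..2 ^ J - 1} \<union> {2 ^ J..<2 ^ Suc J}" by auto
  moreover have "{1..(2::nat) ^ J - 1} \<inter> {2 ^ J..<2 ^ Suc J} = {}" by auto
  ultimately have "(\<Sum>i=1..2 ^ Suc J - 1. h i) = (\<Sum>i=1..2 ^ J - 1. h i) + (\<Sum>i\<in>{2 ^ J..<2 ^ Suc J}. h i)"
    by (simp only: sum.union_disjoint finite_atLeastAtMost finite_atLeastLessThan)
  then show ?case using Suc by simp
qed simp

lemma floor_log_block: "2 ^ j \<le> i \<Longrightarrow> i < 2 ^ Suc j \<Longrightarrow> floor_log i = j"
  by (rule floor_log_eqI) auto

lemma pow2_mult_dyadic_rate: "2 ^ j * dyadic_rate b a j = dyadic_rate (b - 1) a j"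
proof -
  have "2 ^ j * (2::real) powr (- (b * real j)) = 2 powr (real j + (- (b * real j)))"
    by (simp only: powr_add) (simp add: powr_realpow)
  also have "real j + (- (b * real j)) = - ((b - 1) * real j)" by (simp add: algebra_simps)
  finally show ?thesis by (simp add: dyadic_rate_def)
qed

lemma norm_add_squared_le: "(norm (x + y))\<^sup>2 \<le> 2 * (norm x)\<^sup>2 + 2 * (norm (y :: 'z::real_normed_vector))\<^sup>2"
proof -
  have "(norm (x + y))\<^sup>2 \<le> (norm x + norm y)\<^sup>2" by (intro power_mono norm_triangle_ineq) auto
  also have "\<dots> \<le> 2 * (norm x)\<^sup>2 + 2 * (norm y)\<^sup>2"
    using sum_squares_bound[of "norm x" "norm y"] by (simp add: power2_sum)
  finally show ?thesis .
qed

lemma ennreal_sqrt_le: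
  assumes "q = ennreal r" "0 \<le> r" "r \<le> s"
  shows "ennreal_sqrt q \<le> ennreal (sqrt s)"
  using assms by (simp add: ennreal_sqrt_def ennreal_leI)

context gaussian_series
begin

lemma integrable_norm_add_squared:
  fixes u v :: "'a \<Rightarrow> 'h"
  assumes [measurable]: "u \<in> borel_measurable M" "v \<in> borel_measurable M"
    and i: "integrable M (\<lambda>\<omega>. (norm (u \<omega>))\<^sup>2)" "integrable M (\<lambda>\<omega>. (norm (v \<omega>))\<^sup>2)"
  shows "integrable M (\<lambda>\<omega>. (norm (u \<omega> + v \<omega>))\<^sup>2)"
    and "expectation (\<lambda>\<omega>. (norm (u \<omega> + v \<omega>))\<^sup>2)
      \<le> 2 * expectation (\<lambda>\<omega>. (norm (u \<omega>))\<^sup>2) + 2 * expectation (\<lambda>\<omega>. (norm (v \<omega>))\<^sup>2)"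
proof -
  let ?G = "\<lambda>\<omega>. 2 * (norm (u \<omega>))\<^sup>2 + 2 * (norm (v \<omega>))\<^sup>2"
  have G: "integrable M ?G" using i by auto
  show int: "integrable M (\<lambda>\<omega>. (norm (u \<omega> + v \<omega>))\<^sup>2)"
  proof (rule Bochner_Integration.integrable_bound[OF G])
    show "AE \<omega> in M. norm ((norm (u \<omega> + v \<omega>))\<^sup>2) \<le> norm (?G \<omega>)"
      using norm_add_squared_le by (intro AE_I2) simp
  qed measurable
  have "expectation (\<lambda>\<omega>. (norm (u \<omega> + v \<omega>))\<^sup>2) \<le> expectation ?G"
    by (intro integral_mono int G norm_add_squared_le)
  then show "expectation (\<lambda>\<omega>. (norm (u \<omega> + v \<omega>))\<^sup>2)
      \<le> 2 * expectation (\<lambda>\<omega>. (norm (u \<omega>))\<^sup>2) + 2 * expectation (\<lambda>\<omega>. (norm (v \<omega>))\<^sup>2)"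
    using i by simp
qed

lemma level_error_eq:
  assumes "lev \<le> J"
  shows "integrable M (\<lambda>\<omega>. (norm (partial_sum (2 ^ J - 1) \<omega> - level_point K lev \<omega>))\<^sup>2)"
    and "expectation (\<lambda>\<omega>. (norm (partial_sum (2 ^ J - 1) \<omega> - level_point K lev \<omega>))\<^sup>2)
      = (\<Sum>i=1..2 ^ J - 1. l i * expectation (\<lambda>\<omega>. (Y i \<omega> - quantized (precision K lev i) i \<omega>)\<^sup>2))"
proof -
  define n where "n = (2::nat) ^ J - 1"
  have "2 ^ lev - 1 \<le> n" using assms by (auto simp: n_def intro!: diff_le_mono power_increasing)
  note ext = level_point_extend[OF this]
  have eq: "(norm (partial_sum n \<omega> - level_point K lev \<omega>))\<^sup>2
      = (\<Sum>i=1..n. l i * (Y i \<omega> - quantized (precision K lev i) i \<omega>)\<^sup>2)" for \<omega>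
  proof -
    have "partial_sum n \<omega> - level_point K lev \<omega> = (\<Sum>i=1..n. (sqrt (l i) * (Y i \<omega> - quantized (precision K lev i) i \<omega>)) *\<^sub>R e i)"
      unfolding ext partial_sum_def gauss_point_def quantized_def sum_subtractf[symmetric]
      by (intro sum.cong refl) (simp add: algebra_simps)
    then have "(norm (partial_sum n \<omega> - level_point K lev \<omega>))\<^sup>2
       = (\<Sum>i=1..n. (sqrt (l i) * (Y i \<omega> - quantized (precision K lev i) i \<omega>))\<^sup>2)"
      by (simp only:) (rule norm_sum_e_squared; auto)
    also have "\<dots> = (\<Sum>i=1..n. l i * (Y i \<omega> - quantized (precision K lev i) i \<omega>)\<^sup>2)"
      by (intro sum.cong refl) (use l_pos in \<open>auto simp: power_mult_distrib less_imp_le\<close>)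
    finally show ?thesis .
  qed
  have int: "integrable M (\<lambda>\<omega>. l i * (Y i \<omega> - quantized (precision K lev i) i \<omega>)\<^sup>2)" if "i \<in> {1..n}" for i
    by (intro integrable_mult_right quantization_error_bound) (use that in auto)
  show "integrable M (\<lambda>\<omega>. (norm (partial_sum (2 ^ J - 1) \<omega> - level_point K lev \<omega>))\<^sup>2)"
    unfolding n_def[symmetric] eq by (rule Bochner_Integration.integrable_sum[OF int])
  show "expectation (\<lambda>\<omega>. (norm (partial_sum (2 ^ J - 1) \<omega> - level_point K lev \<omega>))\<^sup>2)
      = (\<Sum>i=1..2 ^ J - 1. l i * expectation (\<lambda>\<omega>. (Y i \<omega> - quantized (precision K lev i) i \<omega>)\<^sup>2))"
    unfolding n_def[symmetric] eq by (subst Bochner_Integration.integral_sum[OF int]) auto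
qed

text \<open>The coordinates of block \<open>j\<close> contribute \<open>2 ^ j\<close> times the size of the eigenvalues times
\<open>2 powr (-K * (lev - j) / 2)\<close> for \<open>j < lev\<close>, and without the last factor for the truncated blocks
\<open>j \<ge> lev\<close>. The condition on \<open>K\<close> makes the block \<open>j = lev\<close> dominate from both sides.\<close>

lemma level_error_bound:
  assumes C0: "\<And>j i. 2 ^ j \<le> i \<Longrightarrow> i < 2 ^ Suc j \<Longrightarrow> l i \<le> C0 * dyadic_rate \<beta> \<alpha> j" "0 < C0"
    and \<beta>: "1 < \<beta>" and K: "\<beta> - 1 < real K / 2"
  shows "\<exists>C>0. \<forall>lev J. lev \<le> J \<longrightarrow>
     expectation (\<lambda>\<omega>. (norm (partial_sum (2 ^ J - 1) \<omega> - level_point K lev \<omega>))\<^sup>2) \<le> C * dyadic_rate (\<beta> - 1) \<alpha> lev"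
proof -
  let ?\<psi> = "dyadic_rate (\<beta> - 1) \<alpha>"
  obtain C1 where C1: "C1 > 0" "\<And>lev. (\<Sum>j<lev. ?\<psi> j * 2 powr (- (real K / 2 * real (lev - j)))) \<le> C1 * ?\<psi> lev"
    using sum_dyadic_rate_damped[OF K] by metis
  obtain C2 where C2: "C2 > 0" "\<And>lev J. (\<Sum>j\<in>{lev..<J}. ?\<psi> j) \<le> C2 * ?\<psi> lev"
    using sum_dyadic_rate_tail[of "\<beta> - 1" \<alpha>] \<beta> by (metis diff_gt_0_iff_gt)
  have "expectation (\<lambda>\<omega>. (norm (partial_sum (2 ^ J - 1) \<omega> - level_point K lev \<omega>))\<^sup>2) \<le> (28 * C0 * (C1 + C2)) * ?\<psi> lev"
    if J: "lev \<le> J" for lev J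
  proof -
    let ?t = "\<lambda>j. ?\<psi> j * 2 powr (- (real K / 2 * real (lev - j)))"
    have block: "(\<Sum>i\<in>{2 ^ j..<2 ^ Suc j}. l i * expectation (\<lambda>\<omega>. (Y i \<omega> - quantized (precision K lev i) i \<omega>)\<^sup>2))
        \<le> 28 * C0 * ?t j" for j
    proof -
      have "l i * expectation (\<lambda>\<omega>. (Y i \<omega> - quantized (precision K lev i) i \<omega>)\<^sup>2)
          \<le> (C0 * dyadic_rate \<beta> \<alpha> j) * (28 * 2 powr (- (real K / 2 * real (lev - j))))"
        if i: "i \<in> {2 ^ j..<2 ^ Suc j}" for i
      proof (rule mult_mono)
        have i1: "1 \<le> i" using i one_le_power[of "2::nat" j] by simp
        have fl: "floor_log i = j" using i by (intro floor_log_block) auto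
        show "l i \<le> C0 * dyadic_rate \<beta> \<alpha> j" using i by (intro C0) auto
        have "- (real (precision K lev i) / 2) = - (real K / 2 * real (lev - j))"
          by (simp add: precision_def fl)
        then show "expectation (\<lambda>\<omega>. (Y i \<omega> - quantized (precision K lev i) i \<omega>)\<^sup>2)
            \<le> 28 * 2 powr (- (real K / 2 * real (lev - j)))"
          using quantization_error_bound(2)[OF i1, of "precision K lev i"] by (simp only:)
        show "0 \<le> C0 * dyadic_rate \<beta> \<alpha> j" using C0(2) dyadic_rate_pos[of \<beta> \<alpha> j] by simp
      qed simp
      then have "(\<Sum>i\<in>{2 ^ j..<2 ^ Suc j}. l i * expectation (\<lambda>\<omega>. (Y i \<omega> - quantized (precision K lev i) i \<omega>)\<^sup>2))
         \<le> (\<Sum>i\<in>{(2::nat) ^ j..<2 ^ Suc j}. (C0 * dyadic_rate \<beta> \<alpha> j) * (28 * 2 powr (- (real K / 2 * real (lev - j)))))"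
        by (rule sum_mono)
      also have "\<dots> = 28 * C0 * ((2 ^ j * dyadic_rate \<beta> \<alpha> j) * 2 powr (- (real K / 2 * real (lev - j))))" by simp
      finally show ?thesis unfolding pow2_mult_dyadic_rate .
    qed
    have "expectation (\<lambda>\<omega>. (norm (partial_sum (2 ^ J - 1) \<omega> - level_point K lev \<omega>))\<^sup>2)
       \<le> (\<Sum>j<J. 28 * C0 * ?t j)"
      unfolding level_error_eq(2)[OF J] sum_dyadic_blocks by (intro sum_mono block)
    also have "\<dots> = 28 * C0 * (\<Sum>j<J. ?t j)" by (simp add: sum_distrib_left)
    also have "(\<Sum>j<J. ?t j) = (\<Sum>j<lev. ?t j) + (\<Sum>j\<in>{lev..<J}. ?t j)"
    proof -
      have J': "{..<J} = {..<lev} \<union> {lev..<J}" using J by auto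
      show ?thesis unfolding J' by (rule sum.union_disjoint) (simp_all add: ivl_disj_int)
    qed
    also have "(\<Sum>j\<in>{lev..<J}. ?t j) = (\<Sum>j\<in>{lev..<J}. ?\<psi> j)" by (intro sum.cong refl) auto
    also have "28 * C0 * ((\<Sum>j<lev. ?t j) + (\<Sum>j\<in>{lev..<J}. ?\<psi> j)) \<le> 28 * C0 * (C1 * ?\<psi> lev + C2 * ?\<psi> lev)"
      using C0(2) C1 C2 by (intro mult_left_mono add_mono) auto
    finally show ?thesis by (simp add: algebra_simps)
  qed
  then show ?thesis using C0(2) C1(1) C2(1) by (intro exI[of _ "28 * C0 * (C1 + C2)"]) auto
qed

text \<open>Lipschitz continuity reduces everything to the distance between \<open>X\<close> and the level points. The
distance to \<open>X\<close> itself is reached through a partial sum that is closer to \<open>X\<close> than \<open>\<psi> lev\<close> in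
mean square.\<close>

lemma multilevel_error_bounds:
  assumes C: "0 < C" "\<And>lev J. lev \<le> J \<Longrightarrow>
     expectation (\<lambda>\<omega>. (norm (partial_sum (2 ^ J - 1) \<omega> - level_point K lev \<omega>))\<^sup>2) \<le> C * \<psi> lev"
    and \<psi>: "\<And>lev. 0 < \<psi> lev" "\<And>lev. \<psi> (lev - 1) \<le> D * \<psi> lev" and f: "f \<in> Lip1"
  shows "(expectation (\<lambda>\<omega>. f (X \<omega>)) - expectation (\<lambda>\<omega>. f (level_point K lev \<omega>)))\<^sup>2 \<le> (2 + 2 * C) * \<psi> lev"
    and "integrable M (\<lambda>\<omega>. f (level_point K lev \<omega>))"
    and "integrable M (\<lambda>\<omega>. (f (level_point K lev \<omega>) - f (level_point K (lev - 1) \<omega>))\<^sup>2)"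
    and "expectation (\<lambda>\<omega>. (f (level_point K lev \<omega>) - f (level_point K (lev - 1) \<omega>))\<^sup>2) \<le> 2 * C * (1 + D) * \<psi> lev"
proof -
  have fL: "\<bar>f x - f y\<bar> \<le> norm (x - y)" for x y
    using f lipschitz_onD[of 1 UNIV f x y] by (simp add: Lip1_def dist_norm)
  note [measurable] = integrable_Lip1(1)[OF f]
  have XL: "integrable M (\<lambda>\<omega>. (norm (X \<omega> - level_point K lev \<omega>))\<^sup>2)
     \<and> expectation (\<lambda>\<omega>. (norm (X \<omega> - level_point K lev \<omega>))\<^sup>2) \<le> (2 + 2 * C) * \<psi> lev"
  proof -
    have "eventually (\<lambda>n. (\<integral>\<^sup>+\<omega>. ennreal ((norm (X \<omega> - partial_sum n \<omega>))\<^sup>2) \<partial>M) < ennreal (\<psi> lev)) sequentially"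
      using partial_sum_converges \<psi>(1)[of lev] by (intro order_tendstoD) auto
    then obtain n0 where n0: "\<And>n. n0 \<le> n \<Longrightarrow> (\<integral>\<^sup>+\<omega>. ennreal ((norm (X \<omega> - partial_sum n \<omega>))\<^sup>2) \<partial>M) < ennreal (\<psi> lev)"
      by (auto simp: eventually_sequentially)
    \<comment> \<open>The partial sum must contain all coordinates of the level and be close to \<open>X\<close>.\<close>
    define J where "J = max lev (Suc n0)"
    define n where "n = (2::nat) ^ J - 1"
    have J: "lev \<le> J" by (simp add: J_def)
    have "n0 \<le> n"
    proof -
      have "n0 < J" by (simp add: J_def)
      also have "J < 2 ^ J" by (rule less_exp)
      finally show ?thesis by (simp add: n_def)
    qed
    from n0[OF this] have nn: "(\<integral>\<^sup>+\<omega>. ennreal ((norm (X \<omega> - partial_sum n \<omega>))\<^sup>2) \<partial>M) < ennreal (\<psi> lev)" .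
    have i1: "integrable M (\<lambda>\<omega>. (norm (X \<omega> - partial_sum n \<omega>))\<^sup>2)"
      by (rule integrableI_bounded) (use nn in \<open>auto intro: order.strict_trans\<close>)
    have "ennreal (expectation (\<lambda>\<omega>. (norm (X \<omega> - partial_sum n \<omega>))\<^sup>2)) < ennreal (\<psi> lev)"
      using nn by (subst nn_integral_eq_integral[symmetric, OF i1]) auto
    then have e1: "expectation (\<lambda>\<omega>. (norm (X \<omega> - partial_sum n \<omega>))\<^sup>2) \<le> \<psi> lev"
      using \<psi>(1)[of lev] by (simp add: ennreal_less_iff)
    have i2: "integrable M (\<lambda>\<omega>. (norm (partial_sum n \<omega> - level_point K lev \<omega>))\<^sup>2)"
      unfolding n_def by (rule level_error_eq(1)[OF J])
    have e2: "expectation (\<lambda>\<omega>. (norm (partial_sum n \<omega> - level_point K lev \<omega>))\<^sup>2) \<le> C * \<psi> lev"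
      unfolding n_def by (rule C(2)[OF J])
    have m: "(\<lambda>\<omega>. X \<omega> - partial_sum n \<omega>) \<in> borel_measurable M" "(\<lambda>\<omega>. partial_sum n \<omega> - level_point K lev \<omega>) \<in> borel_measurable M"
      by measurable
    note s = integrable_norm_add_squared[OF m i1 i2]
    have "expectation (\<lambda>\<omega>. (norm (X \<omega> - level_point K lev \<omega>))\<^sup>2) \<le> 2 * \<psi> lev + 2 * (C * \<psi> lev)"
      using s(2) e1 e2 by simp
    then show ?thesis using s(1) by (simp add: algebra_simps)
  qed
  have i1: "integrable M (\<lambda>\<omega>. norm (X \<omega> - level_point K lev \<omega>))"
    by (rule square_integrable_imp_integrable[OF _ conjunct1[OF XL]]) measurable
  show fi: "integrable M (\<lambda>\<omega>. f (level_point K lev \<omega>))"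
  proof (rule Bochner_Integration.integrable_bound)
    show "integrable M (\<lambda>\<omega>. norm (X \<omega> - level_point K lev \<omega>) + \<bar>f (X \<omega>)\<bar>)"
      using i1 integrable_Lip1(2)[OF f] by auto
    show "AE \<omega> in M. norm (f (level_point K lev \<omega>)) \<le> norm (norm (X \<omega> - level_point K lev \<omega>) + \<bar>f (X \<omega>)\<bar>)"
    proof (rule AE_I2)
      fix \<omega> show "norm (f (level_point K lev \<omega>)) \<le> norm (norm (X \<omega> - level_point K lev \<omega>) + \<bar>f (X \<omega>)\<bar>)"
        using fL[of "X \<omega>" "level_point K lev \<omega>"] by simp
    qed
  qed measurable
  have "\<bar>expectation (\<lambda>\<omega>. f (X \<omega>)) - expectation (\<lambda>\<omega>. f (level_point K lev \<omega>))\<bar>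
      = \<bar>expectation (\<lambda>\<omega>. f (X \<omega>) - f (level_point K lev \<omega>))\<bar>"
    using fi integrable_Lip1(2)[OF f] by simp
  also have "\<dots> \<le> expectation (\<lambda>\<omega>. \<bar>f (X \<omega>) - f (level_point K lev \<omega>)\<bar>)"
    by (rule integral_abs_bound)
  also have "\<dots> \<le> expectation (\<lambda>\<omega>. norm (X \<omega> - level_point K lev \<omega>))"
    using fi integrable_Lip1(2)[OF f] i1 fL by (intro integral_mono) auto
  finally have 1: "\<bar>expectation (\<lambda>\<omega>. f (X \<omega>)) - expectation (\<lambda>\<omega>. f (level_point K lev \<omega>))\<bar>
     \<le> expectation (\<lambda>\<omega>. norm (X \<omega> - level_point K lev \<omega>))" .
  have "(expectation (\<lambda>\<omega>. norm (X \<omega> - level_point K lev \<omega>)))\<^sup>2 \<le> expectation (\<lambda>\<omega>. (norm (X \<omega> - level_point K lev \<omega>))\<^sup>2)"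
    using variance_eq[OF i1 conjunct1[OF XL]] variance_positive[of "\<lambda>\<omega>. norm (X \<omega> - level_point K lev \<omega>)"] by simp
  moreover have "(expectation (\<lambda>\<omega>. f (X \<omega>)) - expectation (\<lambda>\<omega>. f (level_point K lev \<omega>)))\<^sup>2
     \<le> (expectation (\<lambda>\<omega>. norm (X \<omega> - level_point K lev \<omega>)))\<^sup>2"
    using power_mono[OF 1 abs_ge_zero, of 2] by (simp only: power2_abs)
  ultimately show "(expectation (\<lambda>\<omega>. f (X \<omega>)) - expectation (\<lambda>\<omega>. f (level_point K lev \<omega>)))\<^sup>2 \<le> (2 + 2 * C) * \<psi> lev"
    using conjunct2[OF XL] by (meson order_trans)
  have m: "(\<lambda>\<omega>. level_point K lev \<omega> - partial_sum (2 ^ lev - 1) \<omega>) \<in> borel_measurable M"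
    "(\<lambda>\<omega>. partial_sum (2 ^ lev - 1) \<omega> - level_point K (lev - 1) \<omega>) \<in> borel_measurable M" by measurable
  have i3: "integrable M (\<lambda>\<omega>. (norm (level_point K lev \<omega> - partial_sum (2 ^ lev - 1) \<omega>))\<^sup>2)"
    using level_error_eq(1)[OF order_refl, of lev K] by (simp add: norm_minus_commute)
  have i4: "integrable M (\<lambda>\<omega>. (norm (partial_sum (2 ^ lev - 1) \<omega> - level_point K (lev - 1) \<omega>))\<^sup>2)"
    by (rule level_error_eq(1)) simp
  note s = integrable_norm_add_squared[OF m i3 i4]
  have dif: "(f (level_point K lev \<omega>) - f (level_point K (lev - 1) \<omega>))\<^sup>2 \<le> (norm (level_point K lev \<omega> - level_point K (lev - 1) \<omega>))\<^sup>2" for \<omega>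
    using power_mono[OF fL[of "level_point K lev \<omega>" "level_point K (lev - 1) \<omega>"], of 2] by simp
  have s1: "integrable M (\<lambda>\<omega>. (norm (level_point K lev \<omega> - level_point K (lev - 1) \<omega>))\<^sup>2)" using s(1) by simp
  show i5: "integrable M (\<lambda>\<omega>. (f (level_point K lev \<omega>) - f (level_point K (lev - 1) \<omega>))\<^sup>2)"
  proof (rule Bochner_Integration.integrable_bound[OF s1])
    show "AE \<omega> in M. norm ((f (level_point K lev \<omega>) - f (level_point K (lev - 1) \<omega>))\<^sup>2) \<le> norm ((norm (level_point K lev \<omega> - level_point K (lev - 1) \<omega>))\<^sup>2)"
      using dif by (intro AE_I2) simp
  qed measurable
  have "expectation (\<lambda>\<omega>. (f (level_point K lev \<omega>) - f (level_point K (lev - 1) \<omega>))\<^sup>2)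
     \<le> expectation (\<lambda>\<omega>. (norm (level_point K lev \<omega> - level_point K (lev - 1) \<omega>))\<^sup>2)"
    by (intro integral_mono i5 s1 dif)
  also have "\<dots> \<le> 2 * (C * \<psi> lev) + 2 * (C * \<psi> (lev - 1))"
    using s(2) C(2)[of lev lev] C(2)[of "lev - 1" lev] by (simp add: norm_minus_commute)
  also have "\<dots> \<le> 2 * (C * \<psi> lev) + 2 * (C * (D * \<psi> lev))"
    using C(1) \<psi>(2)[of lev] by (intro add_left_mono mult_left_mono) auto
  finally show "expectation (\<lambda>\<omega>. (f (level_point K lev \<omega>) - f (level_point K (lev - 1) \<omega>))\<^sup>2) \<le> 2 * C * (1 + D) * \<psi> lev"
    by (simp add: algebra_simps)
qed

definition samples :: "nat \<Rightarrow> (nat \<Rightarrow> nat) \<Rightarrow> (real \<times> nat) list" where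
  "samples L N = concat (map (\<lambda>lev. replicate (N lev) (1 / real (N lev), lev)) [1..<Suc L])"

lemma sum_list_samples:
  fixes g :: "real \<times> nat \<Rightarrow> 'b::semiring_1"
  shows "(\<Sum>x\<leftarrow>samples L N. g x) = (\<Sum>lev=1..L. of_nat (N lev) * g (1 / real (N lev), lev))"
proof -
  have "(\<Sum>x\<leftarrow>concat (map h [1..<Suc L]). g x) = (\<Sum>lev=1..L. \<Sum>x\<leftarrow>h lev. g x)" for h
    by (induction L) auto
  then show ?thesis unfolding samples_def by (simp add: sum_list_replicate)
qed

lemma snd_samples: "x \<in> set (samples L N) \<Longrightarrow> 1 \<le> snd x"
  by (auto simp: samples_def)

text \<open>The squared error is the sum of squared bias and variance. The expectations of the level differences
telescope, so the bias is that of level \<open>L\<close>; the variances add up by independence, and the average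
over \<open>N lev\<close> copies divides the second moment by \<open>N lev\<close>.\<close>

lemma multilevel_worst_error:
  assumes C: "0 < C" "\<And>lev J. lev \<le> J \<Longrightarrow>
     expectation (\<lambda>\<omega>. (norm (partial_sum (2 ^ J - 1) \<omega> - level_point K lev \<omega>))\<^sup>2) \<le> C * \<psi> lev"
    and \<psi>: "\<And>lev. 0 < \<psi> lev" "\<And>lev. \<psi> (lev - 1) \<le> D * \<psi> lev"
    and N: "\<And>lev. 1 \<le> lev \<Longrightarrow> 1 \<le> N lev"
  shows "worst_error random_bit e l (distr M borel X) (multilevel_program K (samples L N))
    \<le> ennreal (sqrt ((2 + 2 * C) * \<psi> L + (\<Sum>lev=1..L. 2 * C * (1 + D) * \<psi> lev / real (N lev))))"
  unfolding worst_error_def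
proof (rule SUP_least)
  fix f :: "'h \<Rightarrow> real" assume f: "f \<in> Lip1"
  note fm = integrable_Lip1(1)[OF f]
  note mb = multilevel_error_bounds[OF C \<psi> f]
  let ?A = "multilevel_sum l e f K (samples L N)"
  let ?D = "\<lambda>x \<omega>. fst x * level_difference l e f K (snd x) \<omega>"
  let ?d = "\<lambda>lev \<omega>. f (level_point K lev \<omega>) - f (level_point K (lev - 1) \<omega>)"
  have tr: "bits.expectation (\<lambda>\<omega>. h (level_difference l e f K lev \<omega>)) = expectation (\<lambda>\<omega>. h (?d lev \<omega>))"
    "integrable bit_sequences (\<lambda>\<omega>. h (level_difference l e f K lev \<omega>)) \<longleftrightarrow> integrable M (\<lambda>\<omega>. h (?d lev \<omega>))"
    if "1 \<le> lev" "h \<in> borel_measurable borel" for lev and h :: "real \<Rightarrow> real"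
  proof -
    note d = distr_level_difference[OF fm that(1), of K]
    have dm: "?d lev \<in> borel_measurable M" using fm by measurable
    show "bits.expectation (\<lambda>\<omega>. h (level_difference l e f K lev \<omega>)) = expectation (\<lambda>\<omega>. h (?d lev \<omega>))"
      using integral_distr[OF d(2) that(2)] integral_distr[OF dm that(2)] d(1) by simp
    show "integrable bit_sequences (\<lambda>\<omega>. h (level_difference l e f K lev \<omega>)) \<longleftrightarrow> integrable M (\<lambda>\<omega>. h (?d lev \<omega>))"
      using integrable_distr_eq[OF d(2) that(2)] integrable_distr_eq[OF dm that(2)] d(1) by simp
  qed
  have blocks: "?A \<in> borel_measurable bit_sequences \<and> integrable bit_sequences (\<lambda>\<omega>. (?A \<omega>)\<^sup>2)
    \<and> bits.expectation ?A = (\<Sum>x\<leftarrow>samples L N. bits.expectation (?D x))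
    \<and> bits.variance ?A \<le> (\<Sum>x\<leftarrow>samples L N. bits.expectation (\<lambda>\<omega>. (?D x \<omega>)\<^sup>2))"
  proof (rule sum_independent_blocks[where B = "\<lambda>x. bit_count K (snd x)"])
    fix x assume "x \<in> set (samples L N)"
    then have x: "1 \<le> snd x" by (rule snd_samples)
    show "?D x \<in> borel_measurable bit_sequences"
      using distr_level_difference(2)[OF fm x] by (rule borel_measurable_times[OF borel_measurable_const])
    show "integrable bit_sequences (\<lambda>\<omega>. (?D x \<omega>)\<^sup>2)"
      unfolding power_mult_distrib using tr(2)[OF x, of "\<lambda>y. y\<^sup>2"] mb(3)[of "snd x"] by simp
    show "?D x \<omega> = ?D x \<omega>'" if "\<And>k. k < bit_count K (snd x) \<Longrightarrow> \<omega> k = \<omega>' k" for \<omega> \<omega>'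
      using level_difference_local[OF x that] by simp
  qed auto
  then have Am: "?A \<in> borel_measurable bit_sequences" and Asq: "integrable bit_sequences (\<lambda>\<omega>. (?A \<omega>)\<^sup>2)"
    and Ae: "bits.expectation ?A = (\<Sum>x\<leftarrow>samples L N. bits.expectation (?D x))"
    and Av: "bits.variance ?A \<le> (\<Sum>x\<leftarrow>samples L N. bits.expectation (\<lambda>\<omega>. (?D x \<omega>)\<^sup>2))" by blast+
  have N0: "real (N lev) \<noteq> 0" if "1 \<le> lev" for lev using N[OF that] by simp
  have mean: "f 0 + bits.expectation ?A = expectation (\<lambda>\<omega>. f (level_point K L \<omega>))"
  proof -
    have "bits.expectation ?A = (\<Sum>lev=1..L. real (N lev) * (1 / real (N lev) * expectation (?d lev)))"
      unfolding Ae sum_list_samples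
      by (intro sum.cong refl) (use tr(1)[of _ "\<lambda>y. y"] in simp)
    also have "\<dots> = (\<Sum>lev=1..L. expectation (\<lambda>\<omega>. f (level_point K lev \<omega>)) - expectation (\<lambda>\<omega>. f (level_point K (lev - 1) \<omega>)))"
      by (intro sum.cong refl) (use mb(2) N0 in auto)
    also have "\<dots> = expectation (\<lambda>\<omega>. f (level_point K L \<omega>)) - expectation (\<lambda>\<omega>. f (level_point K 0 \<omega>))"
      by (induction L) auto
    finally show ?thesis using prob_space by (simp add: level_point_0)
  qed
  have var: "bits.variance ?A \<le> (\<Sum>lev=1..L. 2 * C * (1 + D) * \<psi> lev / real (N lev))"
  proof (rule order_trans[OF Av])
    have "real (N lev) * bits.expectation (\<lambda>\<omega>. (?D (1 / real (N lev), lev) \<omega>)\<^sup>2) \<le> 2 * C * (1 + D) * \<psi> lev / real (N lev)"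
      if "lev \<in> {1..L}" for lev
    proof -
      have lev: "1 \<le> lev" using that by simp
      have "real (N lev) * bits.expectation (\<lambda>\<omega>. (?D (1 / real (N lev), lev) \<omega>)\<^sup>2)
         = expectation (\<lambda>\<omega>. (?d lev \<omega>)\<^sup>2) / real (N lev)"
        unfolding power_mult_distrib using tr(1)[OF lev, of "\<lambda>y. y\<^sup>2"] N0[OF lev] by (simp add: power2_eq_square)
      then show ?thesis using mb(4)[of lev] by (simp add: divide_right_mono)
    qed
    then show "(\<Sum>x\<leftarrow>samples L N. bits.expectation (\<lambda>\<omega>. (?D x \<omega>)\<^sup>2)) \<le> (\<Sum>lev=1..L. 2 * C * (1 + D) * \<psi> lev / real (N lev))"
      unfolding sum_list_samples by (intro sum_mono) auto
  qed
  let ?S = "expectation (\<lambda>\<omega>. f (X \<omega>))"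
  let ?b = "?S - (f 0 + bits.expectation ?A)"
  have Aint: "integrable bit_sequences ?A" by (rule bits.square_integrable_imp_integrable[OF Am Asq])
  have out: "(\<integral>x. f x \<partial>distr M borel X) - alg_output e l (multilevel_program K (samples L N)) f \<omega> = ?b - (?A \<omega> - bits.expectation ?A)" for \<omega>
    by (simp add: alg_output_multilevel integrable_Lip1(4)[OF f])
  have c2: "integrable bit_sequences (\<lambda>\<omega>. (?A \<omega> - bits.expectation ?A)\<^sup>2)"
    unfolding power2_diff using Asq Aint by auto
  have err: "integrable bit_sequences (\<lambda>\<omega>. (?b - (?A \<omega> - bits.expectation ?A))\<^sup>2)"
    "bits.expectation (\<lambda>\<omega>. (?b - (?A \<omega> - bits.expectation ?A))\<^sup>2) = ?b\<^sup>2 + bits.variance ?A"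
  proof -
    have eq: "(?b - (?A \<omega> - bits.expectation ?A))\<^sup>2 = ?b\<^sup>2 + (?A \<omega> - bits.expectation ?A)\<^sup>2 - 2 * ?b * (?A \<omega> - bits.expectation ?A)" for \<omega>
      by (rule power2_diff)
    have i: "integrable bit_sequences (\<lambda>\<omega>. ?A \<omega> - bits.expectation ?A)" using Aint by auto
    show "integrable bit_sequences (\<lambda>\<omega>. (?b - (?A \<omega> - bits.expectation ?A))\<^sup>2)"
      unfolding eq
      by (rule Bochner_Integration.integrable_diff[OF Bochner_Integration.integrable_add[OF bits.integrable_const c2] integrable_mult_right[OF i]])
    have z: "bits.expectation (\<lambda>\<omega>. ?A \<omega> - bits.expectation ?A) = 0"
      using Aint bits.prob_space by simp
    have "bits.expectation (\<lambda>\<omega>. (?b - (?A \<omega> - bits.expectation ?A))\<^sup>2)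
       = bits.expectation (\<lambda>\<omega>. ?b\<^sup>2 + (?A \<omega> - bits.expectation ?A)\<^sup>2) - bits.expectation (\<lambda>\<omega>. 2 * ?b * (?A \<omega> - bits.expectation ?A))"
      unfolding eq
      by (rule Bochner_Integration.integral_diff[OF Bochner_Integration.integrable_add[OF bits.integrable_const c2] integrable_mult_right[OF i]])
    also have "bits.expectation (\<lambda>\<omega>. 2 * ?b * (?A \<omega> - bits.expectation ?A)) = 2 * ?b * bits.expectation (\<lambda>\<omega>. ?A \<omega> - bits.expectation ?A)"
      by (rule integral_mult_right_zero)
    also have "bits.expectation (\<lambda>\<omega>. ?b\<^sup>2 + (?A \<omega> - bits.expectation ?A)\<^sup>2) = ?b\<^sup>2 + bits.variance ?A"
      using c2 bits.prob_space by (subst Bochner_Integration.integral_add) auto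
    finally show "bits.expectation (\<lambda>\<omega>. (?b - (?A \<omega> - bits.expectation ?A))\<^sup>2) = ?b\<^sup>2 + bits.variance ?A"
      unfolding z by simp
  qed
  have "(\<integral>\<^sup>+\<omega>. ennreal (\<bar>(\<integral>x. f x \<partial>distr M borel X) - alg_output e l (multilevel_program K (samples L N)) f \<omega>\<bar>\<^sup>2) \<partial>bit_sequences)
     = ennreal (?b\<^sup>2 + bits.variance ?A)"
    unfolding out power2_abs using nn_integral_eq_integral[OF err(1)] err(2) by simp
  moreover have "0 \<le> ?b\<^sup>2 + bits.variance ?A" using bits.variance_positive[of ?A] by simp
  moreover have "?b\<^sup>2 + bits.variance ?A \<le> (2 + 2 * C) * \<psi> L + (\<Sum>lev=1..L. 2 * C * (1 + D) * \<psi> lev / real (N lev))"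
    using var mb(1)[of L] unfolding mean by linarith
  ultimately show "ennreal_sqrt (\<integral>\<^sup>+\<omega>. ennreal (\<bar>(\<integral>x. f x \<partial>distr M borel X) - alg_output e l (multilevel_program K (samples L N)) f \<omega>\<bar>\<^sup>2) \<partial>bit_sequences)
     \<le> ennreal (sqrt ((2 + 2 * C) * \<psi> L + (\<Sum>lev=1..L. 2 * C * (1 + D) * \<psi> lev / real (N lev))))"
    by (rule ennreal_sqrt_le)
qed

lemma multilevel_worst_cost:
  "worst_cost random_bit e l (multilevel_program K (samples L N))
     \<le> of_nat (2 + (14 + 10 * K) * (\<Sum>lev=1..L. N lev * 2 ^ lev))"
  unfolding worst_cost_def
proof (rule SUP_least)
  fix f :: "'h \<Rightarrow> real"
  let ?P = "multilevel_program K (samples L N)"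
  have "(\<Sum>i\<leftarrow>?P. static_cost i) \<le> 2 + (14 + 10 * K) * (\<Sum>lev=1..L. N lev * 2 ^ lev)"
    using static_cost_multilevel[of "samples L N" K] snd_samples by (simp add: sum_list_samples)
  then have "alg_cost e l ?P f \<omega> \<le> of_nat (2 + (14 + 10 * K) * (\<Sum>lev=1..L. N lev * 2 ^ lev))" for \<omega>
    using alg_cost_straight_line_le[OF straight_line_multilevel, of e l K "samples L N" f \<omega>]
    by (meson of_nat_mono order_trans)
  then have "(\<integral>\<^sup>+\<omega>. alg_cost e l ?P f \<omega> \<partial>bit_sequences)
     \<le> (\<integral>\<^sup>+\<omega>. of_nat (2 + (14 + 10 * K) * (\<Sum>lev=1..L. N lev * 2 ^ lev)) \<partial>bit_sequences)"
    by (intro nn_integral_mono)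
  also have "\<dots> = of_nat (2 + (14 + 10 * K) * (\<Sum>lev=1..L. N lev * 2 ^ lev))"
    using bits.emeasure_space_1 by simp
  finally show "(\<integral>\<^sup>+\<omega>. alg_cost e l ?P f \<omega> \<partial>bit_sequences)
     \<le> of_nat (2 + (14 + 10 * K) * (\<Sum>lev=1..L. N lev * 2 ^ lev))" .
qed

lemma minimal_error_res_multilevel:
  assumes "worst_error random_bit e l (distr M borel X) (multilevel_program K (samples L N)) \<le> E"
    and "2 + (14 + 10 * K) * (\<Sum>lev=1..L. N lev * 2 ^ lev) \<le> n"
  shows "minimal_error_res e l (distr M borel X) n \<le> E"
proof -
  have "worst_cost random_bit e l (multilevel_program K (samples L N)) \<le> of_nat n"
    using multilevel_worst_cost[of K L N] assms(2) by (meson of_nat_mono order_trans)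
  then have "minimal_error_res e l (distr M borel X) n
     \<le> worst_error random_bit e l (distr M borel X) (multilevel_program K (samples L N))"
    unfolding minimal_error_res_def minimal_error_def
    by (intro INF_lower) (simp add: straight_line_in_algorithms straight_line_multilevel)
  then show ?thesis using assms(1) by (rule order_trans)
qed

end

section \<open>Choice of the sample sizes\<close>

text \<open>For \<open>a > 0\<close> the terms are compared with the increments of \<open>x powr (1 - a) / (1 - a)\<close> by the mean value
theorem; for \<open>a \<le> 0\<close> the last term is the largest one, which accounts for the second summand.\<close>

lemma sum_powr_le:
  assumes "a < 1"
  shows "(\<Sum>k=1..L. (1 + real k) powr (- a)) \<le> 1 / (1 - a) * (1 + real L) powr (1 - a) + real L * (1 + real L) powr (- a)"
proof (cases "a \<le> 0")
  case True
  have "(\<Sum>k=1..L. (1 + real k) powr (- a)) \<le> (\<Sum>k=1..L. (1 + real L) powr (- a))"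
    using True by (intro sum_mono powr_mono2) auto
  moreover have "0 \<le> 1 / (1 - a) * (1 + real L) powr (1 - a)" using assms by simp
  ultimately show ?thesis by simp
next
  case False
  have "(\<Sum>k=1..L. (1 + real k) powr (- a)) \<le> 1 / (1 - a) * (1 + real L) powr (1 - a)"
  proof (induction L)
    case (Suc L)
    have "\<exists>z. 1 + real L < z \<and> z < 1 + real (Suc L) \<and>
       (1 + real (Suc L)) powr (1 - a) - (1 + real L) powr (1 - a) = (1 + real (Suc L) - (1 + real L)) * ((1 - a) * z powr (- a))"
    proof (rule MVT2)
      fix x assume "1 + real L \<le> x"
      then have "0 < x" by simp
      then show "((\<lambda>x. x powr (1 - a)) has_real_derivative (1 - a) * x powr (- a)) (at x)"
        by (auto intro!: derivative_eq_intros)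
    qed simp
    then obtain z where z: "1 + real L < z" "z < 1 + real (Suc L)"
      "(1 + real (Suc L)) powr (1 - a) - (1 + real L) powr (1 - a) = (1 - a) * z powr (- a)" by auto
    have "(1 + real (Suc L)) powr (- a) \<le> z powr (- a)"
      using z False by (intro powr_mono2') auto
    then have "(1 - a) * (1 + real (Suc L)) powr (- a) \<le> (1 - a) * z powr (- a)"
      using assms by (intro mult_left_mono) auto
    then have "(1 - a) * (1 + real (Suc L)) powr (- a) \<le> (1 + real (Suc L)) powr (1 - a) - (1 + real L) powr (1 - a)"
      using z(3) by simp
    then have "(1 + real (Suc L)) powr (- a) \<le> ((1 + real (Suc L)) powr (1 - a) - (1 + real L) powr (1 - a)) / (1 - a)"
      using assms by (simp only: pos_le_divide_eq mult.commute)
    then show ?case using Suc by (simp add: diff_divide_distrib)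
  qed (use assms in simp)
  then show ?thesis by (simp add: add_increasing2)
qed

text \<open>The sum has bounded partial sums for \<open>\<beta> > 2\<close> and is dominated by its last term for \<open>\<beta> < 2\<close>. For
\<open>\<beta> = 2\<close> it is the sum of \<open>(1 + k) powr (-\<alpha>/2)\<close>, with polynomial, logarithmic or no growth in the
number of levels, which is of order \<open>ln n\<close>.\<close>

lemma level_sum_bound:
  fixes \<alpha> \<beta> :: real
  shows "\<exists>C>0. \<forall>n\<ge>3. real n powr (-1/2) * (\<Sum>k=1..floor_log n. dyadic_rate ((\<beta> - 2) / 2) (\<alpha> / 2) k)
    \<le> C * (real n powr (- min (1/2) ((\<beta> - 1)/2)) *
         (if \<beta> > 2 then 1
          else if \<beta> = 2 \<and> \<alpha> \<noteq> 2 then ln (real n) powr (max 0 (1 - \<alpha>/2))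
          else if \<beta> = 2 \<and> \<alpha> = 2 then ln (ln (real n))
          else ln (real n) powr (- \<alpha>/2)))"
proof -
  define a where "a = \<alpha> / 2"
  let ?T = "\<lambda>L. \<Sum>k=1..L. dyadic_rate ((\<beta> - 2) / 2) a k"
  have ln1: "1 \<le> ln (real n)" if "3 \<le> n" for n :: nat
  proof -
    have "exp 1 \<le> real n" using e_less_272 that by linarith
    then show ?thesis using that by (simp add: ln_ge_iff)
  qed
  have L: "1 * ln (real n) \<le> 1 + real (floor_log n)" "1 + real (floor_log n) \<le> 3 * ln (real n)"
    "2 ^ floor_log n \<le> real n" if n: "3 \<le> n" for n
  proof -
    have p: "2 ^ floor_log n \<le> n" "n < 2 * 2 ^ floor_log n"
      using floor_log_exp2_le[of n] floor_log_exp2_gt[of n] n by auto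
    have r: "2 ^ floor_log n \<le> real n" "real n \<le> 2 ^ Suc (floor_log n)"
      using p by (metis of_nat_le_iff of_nat_numeral of_nat_power,
        metis less_imp_le of_nat_le_iff of_nat_numeral of_nat_power power_Suc)
    show "2 ^ floor_log n \<le> real n" by (rule r(1))
    have "ln (real n) \<le> ln (2 ^ Suc (floor_log n))" using r n by (subst ln_le_cancel_iff) auto
    also have "\<dots> = (1 + real (floor_log n)) * ln 2" by (simp only: ln_realpow) simp
    also have "\<dots> \<le> (1 + real (floor_log n)) * 1" using ln_2_less_1 by (intro mult_left_mono) auto
    finally show "1 * ln (real n) \<le> 1 + real (floor_log n)" by simp
    have "real (floor_log n) * ln 2 = ln (2 ^ floor_log n)" by (simp add: ln_realpow)
    also have "\<dots> \<le> ln (real n)" using r n by (subst ln_le_cancel_iff) auto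
    finally have "real (floor_log n) * ln 2 \<le> ln (real n)" .
    moreover have "real (floor_log n) * (2/3) \<le> real (floor_log n) * ln 2"
      using ln2_ge_two_thirds by (intro mult_left_mono) auto
    ultimately show "1 + real (floor_log n) \<le> 3 * ln (real n)" using ln1[OF n] by linarith
  qed
  consider (gt) "\<beta> > 2" | (log) "\<beta> = 2" "\<alpha> < 2" | (loglog) "\<beta> = 2" "\<alpha> = 2" | (const) "\<beta> = 2" "\<alpha> > 2" | (lt) "\<beta> < 2"
    by linarith
  then show ?thesis
  proof cases
    case gt
    obtain C where C: "C > 0" "\<And>n. (\<Sum>k<n. dyadic_rate ((\<beta> - 2) / 2) a k) \<le> C"
      using sum_dyadic_rate_bounded[of "(\<beta> - 2) / 2" a] gt by auto
    have main: "?T L \<le> C" for L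
    proof -
      have "?T L \<le> (\<Sum>k<Suc L. dyadic_rate ((\<beta> - 2) / 2) a k)"
        by (intro sum_mono2) (auto intro: less_imp_le[OF dyadic_rate_pos])
      then show ?thesis using C(2)[of "Suc L"] by simp
    qed
    have "real n powr (-1/2) * ?T (floor_log n) \<le> C * (real n powr (-1/2) * 1)" for n
      using mult_left_mono[OF main, of "real n powr (-1/2)"] by (simp add: mult_ac)
    moreover have "- min (1/2) ((\<beta> - 1)/2) = -1/2" using gt by simp
    ultimately show ?thesis using gt C(1) by (intro exI[of _ C]) (simp add: a_def[symmetric])
  next
    case log
    have a: "a < 1" using log by (simp add: a_def)
    define C where "C = (1 / (1 - a) + 1) * (1 powr (1 - a) + 3 powr (1 - a))"
    have C0: "0 < C" unfolding C_def using a by (intro mult_pos_pos add_pos_pos) auto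
    have main: "?T (floor_log n) \<le> C * ln (real n) powr (1 - a)" if n: "3 \<le> n" for n
    proof -
      have "?T (floor_log n) = (\<Sum>k=1..floor_log n. (1 + real k) powr (- a))"
        using log by (simp add: dyadic_rate_def)
      also have "\<dots> \<le> 1 / (1 - a) * (1 + real (floor_log n)) powr (1 - a) + real (floor_log n) * (1 + real (floor_log n)) powr (- a)"
        by (rule sum_powr_le[OF a])
      also have "\<dots> \<le> 1 / (1 - a) * (1 + real (floor_log n)) powr (1 - a) + (1 + real (floor_log n)) powr (1 - a)"
      proof -
        have "real (floor_log n) * (1 + real (floor_log n)) powr (- a) \<le> (1 + real (floor_log n)) * (1 + real (floor_log n)) powr (- a)"
          by (intro mult_right_mono) auto
        also have "\<dots> = (1 + real (floor_log n)) powr (1 - a)" by (simp add: powr_mult_base)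
        finally show ?thesis by simp
      qed
      also have "\<dots> = (1 / (1 - a) + 1) * (1 + real (floor_log n)) powr (1 - a)" by (simp add: algebra_simps)
      also have "\<dots> \<le> (1 / (1 - a) + 1) * ((1 powr (1 - a) + 3 powr (1 - a)) * ln (real n) powr (1 - a))"
        using a L[OF n] ln1[OF n] by (intro mult_left_mono powr_comparable) auto
      finally show ?thesis by (simp add: C_def)
    qed
    have "real n powr (-1/2) * ?T (floor_log n) \<le> C * (real n powr (-1/2) * ln (real n) powr (1 - a))" if "3 \<le> n" for n
      using mult_left_mono[OF main[OF that], of "real n powr (-1/2)"] by (simp add: mult_ac)
    moreover have "max 0 (1 - \<alpha>/2) = 1 - a" using a by (simp add: a_def)
    ultimately show ?thesis using log C0 by (intro exI[of _ C]) (simp add: a_def[symmetric])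
  next
    case loglog
    define c where "c = ln (ln (3::real))"
    have c: "0 < c"
    proof -
      have "exp 1 < (3::real)" using e_less_272 by simp
      then have "ln (exp 1) < ln (3::real)" by (subst ln_less_cancel_iff) auto
      then have "1 < ln (3::real)" by simp
      then show ?thesis unfolding c_def by (rule ln_gt_zero)
    qed
    define C where "C = ln 3 / c + 1"
    have C0: "0 < C" unfolding C_def using c by (intro add_nonneg_pos) auto
    have main: "?T (floor_log n) \<le> C * ln (ln (real n))" if n: "3 \<le> n" for n
    proof -
      have "?T (floor_log n) = (\<Sum>k=1..floor_log n. 1 / real (Suc k))"
        using loglog by (simp add: dyadic_rate_def a_def powr_minus_divide add.commute)
      also have "\<dots> = (\<Sum>N\<in>{1<..Suc (floor_log n)}. 1 / real N)"
        by (rule sum.reindex_bij_witness[of _ "\<lambda>N. N - 1" Suc]) auto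
      also have "\<dots> \<le> ln (real (Suc (floor_log n))) - ln (real 1)" by (rule sum_inverse_le_ln) auto
      also have "\<dots> \<le> ln (3 * ln (real n))" using L(2)[OF n] ln1[OF n] by (simp add: add.commute)
      also have "\<dots> = ln 3 + ln (ln (real n))" using ln1[OF n] by (subst ln_mult) auto
      also have "ln 3 \<le> ln 3 / c * ln (ln (real n))"
      proof -
        have "ln (3::real) \<le> ln (real n)" using n by (subst ln_le_cancel_iff) auto
        then have "c \<le> ln (ln (real n))" unfolding c_def using c ln1[of 3] by (subst ln_le_cancel_iff) auto
        then have "ln 3 / c * c \<le> ln 3 / c * ln (ln (real n))" using c by (intro mult_left_mono) auto
        then show ?thesis using c by simp
      qed
      finally show ?thesis by (simp add: C_def algebra_simps)
    qed
    have "real n powr (-1/2) * ?T (floor_log n) \<le> C * (real n powr (-1/2) * ln (ln (real n)))" if "3 \<le> n" for n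
      using mult_left_mono[OF main[OF that], of "real n powr (-1/2)"] by (simp add: mult_ac)
    then show ?thesis using loglog C0 by (intro exI[of _ C]) (simp add: a_def)
  next
    case const
    have sm: "summable (\<lambda>k. real k powr (- a))" using const by (subst summable_real_powr_iff) (simp add: a_def)
    define C where "C = suminf (\<lambda>k. real k powr (- a)) + 1"
    have C0: "0 < C" unfolding C_def using sm by (intro add_nonneg_pos suminf_nonneg) auto
    have main: "?T L \<le> C" for L
    proof -
      have "?T L = (\<Sum>k=1..L. real (Suc k) powr (- a))" using const by (simp add: dyadic_rate_def add.commute)
      also have "\<dots> = (\<Sum>k\<in>Suc ` {1..L}. real k powr (- a))"
        by (subst sum.reindex) (simp_all only: inj_Suc comp_def)
      also have "\<dots> \<le> suminf (\<lambda>k. real k powr (- a))" using sm by (intro sum_le_suminf) auto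
      finally show ?thesis by (simp add: C_def)
    qed
    have "real n powr (-1/2) * ?T (floor_log n) \<le> C * (real n powr (-1/2) * 1)" for n
      using mult_left_mono[OF main, of "real n powr (-1/2)"] by (simp add: mult_ac)
    moreover have "ln (real n) powr (max 0 (1 - \<alpha>/2)) = 1" if "3 \<le> n" for n
      using const ln1[OF that] by (simp add: max_def)
    ultimately show ?thesis using const C0 by (intro exI[of _ C]) (simp add: a_def[symmetric])
  next
    case lt
    define b where "b = (\<beta> - 2) / 2"
    obtain C1 where C1: "C1 > 0" "\<And>n. (\<Sum>k<n. dyadic_rate (- b) (- \<bar>a\<bar>) k) \<le> C1"
      using sum_dyadic_rate_bounded[of "- b" "- \<bar>a\<bar>"] lt by (auto simp: b_def)
    have geo: "?T L \<le> C1 * dyadic_rate b a L" for L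
    proof -
      have "?T L \<le> (\<Sum>k=1..L. dyadic_rate b a L * dyadic_rate (- b) (- \<bar>a\<bar>) (L - k))"
        unfolding b_def[symmetric]
      proof (intro sum_mono)
        fix k assume "k \<in> {1..L}"
        then show "dyadic_rate b a k \<le> dyadic_rate b a L * dyadic_rate (- b) (- \<bar>a\<bar>) (L - k)"
          using dyadic_rate_le_add[of b a k "L - k"] by simp
      qed
      also have "\<dots> = dyadic_rate b a L * (\<Sum>k=1..L. dyadic_rate (- b) (- \<bar>a\<bar>) (L - k))" by (simp add: sum_distrib_left)
      also have "(\<Sum>k=1..L. dyadic_rate (- b) (- \<bar>a\<bar>) (L - k)) = (\<Sum>k<L. dyadic_rate (- b) (- \<bar>a\<bar>) k)"
        by (rule sum.reindex_bij_witness[of _ "\<lambda>k. L - k" "\<lambda>k. L - k"]) auto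
      also have "dyadic_rate b a L * \<dots> \<le> dyadic_rate b a L * C1"
        using C1(2) dyadic_rate_pos[of b a L] by (intro mult_left_mono) auto
      finally show ?thesis by (simp add: mult.commute)
    qed
    define C2 where "C2 = 1 powr (- a) + 3 powr (- a)"
    have C2: "0 < C2" unfolding C2_def by (intro add_pos_pos) auto
    have main: "real n powr (-1/2) * ?T (floor_log n) \<le> (C1 * C2) * (real n powr (- (\<beta> - 1)/2) * ln (real n) powr (- a))"
      if n: "3 \<le> n" for n
    proof -
      have "2 powr (- (b * real (floor_log n))) = (2 ^ floor_log n) powr (- b)"
        by (simp add: powr_realpow[symmetric] powr_powr mult.commute)
      also have "\<dots> \<le> real n powr (- b)" using L(3)[OF n] lt by (intro powr_mono2) (auto simp: b_def)
      finally have 1: "2 powr (- (b * real (floor_log n))) \<le> real n powr (- b)" .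
      have 2: "(1 + real (floor_log n)) powr (- a) \<le> C2 * ln (real n) powr (- a)"
        unfolding C2_def using L[OF n] ln1[OF n] by (intro powr_comparable) auto
      have "dyadic_rate b a (floor_log n) \<le> real n powr (- b) * (C2 * ln (real n) powr (- a))"
        unfolding dyadic_rate_def using 1 2 by (intro mult_mono) auto
      then have "?T (floor_log n) \<le> C1 * (real n powr (- b) * (C2 * ln (real n) powr (- a)))"
        using geo[of "floor_log n"] C1(1) by (meson mult_left_mono less_imp_le order_trans)
      then have "real n powr (-1/2) * ?T (floor_log n) \<le> real n powr (-1/2) * (C1 * (real n powr (- b) * (C2 * ln (real n) powr (- a))))"
        by (rule mult_left_mono) simp
      also have "\<dots> = (C1 * C2) * ((real n powr (-1/2) * real n powr (- b)) * ln (real n) powr (- a))"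
        by (simp only: mult_ac)
      also have "real n powr (-1/2) * real n powr (- b) = real n powr (- (\<beta> - 1)/2)"
      proof -
        have "- 1/2 + - b = - (\<beta> - 1)/2" by (simp add: b_def field_simps)
        then show ?thesis by (simp only: powr_add[symmetric])
      qed
      finally show ?thesis .
    qed
    have "min (1/2) ((\<beta> - 1)/2) = (\<beta> - 1)/2" using lt by (intro min_absorb2) simp
    then have e: "- min (1/2) ((\<beta> - 1)/2) = - (\<beta> - 1)/2" by (simp only: minus_divide_left)
    show ?thesis
    proof (intro exI[of _ "C1 * C2"] conjI allI impI)
      show "0 < C1 * C2" using C1 C2 by simp
      fix n :: nat assume n: "3 \<le> n"
      show "real n powr (-1/2) * (\<Sum>k=1..floor_log n. dyadic_rate ((\<beta> - 2) / 2) (\<alpha> / 2) k)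
    \<le> C1 * C2 * (real n powr (- min (1/2) ((\<beta> - 1)/2)) *
         (if \<beta> > 2 then 1
          else if \<beta> = 2 \<and> \<alpha> \<noteq> 2 then ln (real n) powr (max 0 (1 - \<alpha>/2))
          else if \<beta> = 2 \<and> \<alpha> = 2 then ln (ln (real n))
          else ln (real n) powr (- \<alpha>/2)))"
        using main[OF n] lt unfolding e a_def by simp
    qed
  qed
qed

context gaussian_series
begin

text \<open>With \<open>T\<close> the sum of the numbers \<open>\<tau> k = sqrt (\<psi> k * 2 ^ k)\<close>, the sample sizes
\<open>N k = 2 ^ L / T * (\<tau> k / 2 ^ k)\<close>, rounded up, give cost of order \<open>2 ^ L\<close> and variance of order
\<open>T\<^sup>2 / 2 ^ L\<close>; the squared bias \<open>\<psi> L\<close> is at most \<open>T\<^sup>2 / 2 ^ L\<close>, because \<open>\<tau> L\<close> is a summand of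
\<open>T\<close>. For small \<open>n\<close> the program that returns \<open>f 0\<close> is sufficient.\<close>

lemma minimal_error_res_level_sum:
  assumes "0 < c" "(\<lambda>i. l i * real i powr \<beta> * ln (real i) powr \<alpha>) \<longlonglongrightarrow> c" "1 < \<beta>"
  shows "\<exists>C>0. \<forall>n\<ge>3. minimal_error_res e l (distr M borel X) n
     \<le> ennreal (C * (real n powr (-1/2) * (\<Sum>k=1..floor_log n. dyadic_rate ((\<beta> - 2) / 2) (\<alpha> / 2) k)))"
proof -
  let ?\<psi> = "dyadic_rate (\<beta> - 1) \<alpha>"
  let ?\<tau> = "dyadic_rate ((\<beta> - 2) / 2) (\<alpha> / 2)"
  define T where "T L = (\<Sum>k=1..L. ?\<tau> k)" for L
  obtain C0 where C0: "C0 > 0" "\<And>j i. 2 ^ j \<le> i \<Longrightarrow> i < 2 ^ Suc j \<Longrightarrow> l i \<le> C0 * dyadic_rate \<beta> \<alpha> j"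
    using power_law_dyadic_bounds[OF l_pos assms(1,2)] by metis
  \<comment> \<open>Large enough for \<open>\<beta> - 1 < K / 2\<close>.\<close>
  define K where "K = nat \<lceil>2 * \<beta>\<rceil>"
  have K: "\<beta> - 1 < real K / 2" unfolding K_def by linarith
  obtain C where C: "C > 0" "\<And>lev J. lev \<le> J \<Longrightarrow>
     expectation (\<lambda>\<omega>. (norm (partial_sum (2 ^ J - 1) \<omega> - level_point K lev \<omega>))\<^sup>2) \<le> C * ?\<psi> lev"
    using level_error_bound[OF C0(2,1) assms(3) K] by blast
  define D where "D = max 1 (dyadic_rate (- (\<beta> - 1)) (- \<bar>\<alpha>\<bar>) 1)"
  have D: "?\<psi> (lev - 1) \<le> D * ?\<psi> lev" for lev
  proof (cases "lev = 0")
    case True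
    then show ?thesis using dyadic_rate_pos[of "\<beta> - 1" \<alpha> 0] by (simp add: D_def)
  next
    case False
    then have "?\<psi> (lev - 1) \<le> ?\<psi> lev * dyadic_rate (- (\<beta> - 1)) (- \<bar>\<alpha>\<bar>) 1"
      using dyadic_rate_le_add[of "\<beta> - 1" \<alpha> "lev - 1" 1] by simp
    also have "\<dots> \<le> ?\<psi> lev * D" using dyadic_rate_pos[of "\<beta> - 1" \<alpha> lev] by (intro mult_left_mono) (auto simp: D_def)
    finally show ?thesis by (simp add: mult.commute)
  qed
  have D1: "1 \<le> D" by (simp add: D_def)
  define E where "E = 2 + 2 * C + 2 * C * (1 + D)"
  have E0: "0 < E" using C D1 by (simp add: E_def add_pos_nonneg)
  \<comment> \<open>With the sample sizes below, \<open>L\<close> levels cost at most \<open>A * 2 ^ L\<close>.\<close>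
  define A where "A = 2 + (14 + 10 * K) * 3"
  have A0: "0 < A" by (simp add: A_def)
  have we: "worst_error random_bit e l (distr M borel X) (multilevel_program K (samples L N))
      \<le> ennreal (sqrt ((2 + 2 * C) * ?\<psi> L + (\<Sum>lev=1..L. 2 * C * (1 + D) * ?\<psi> lev / real (N lev))))"
    if "\<And>lev. 1 \<le> N lev" for N L
  proof (rule multilevel_worst_error[where \<psi> = ?\<psi>])
    show "expectation (\<lambda>\<omega>. (norm (partial_sum (2 ^ J - 1) \<omega> - level_point K lev \<omega>))\<^sup>2) \<le> C * ?\<psi> lev"
      if "lev \<le> J" for lev J using that by (rule C(2))
  qed (use C(1) dyadic_rate_pos D that in auto)
  have sq: "?\<psi> k * 2 ^ k = (?\<tau> k)\<^sup>2" for k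
  proof -
    have "(?\<tau> k)\<^sup>2 = 2 powr (- ((\<beta> - 2) * real k)) * (1 + real k) powr (- \<alpha>)"
      by (simp add: dyadic_rate_def power_mult_distrib powr_squared)
    also have "2 powr (- ((\<beta> - 2) * real k)) = 2 powr (- ((\<beta> - 1) * real k)) * (2::real) ^ k"
      by (simp add: powr_realpow[symmetric] powr_add[symmetric] algebra_simps)
    finally show ?thesis by (simp add: dyadic_rate_def)
  qed
  have \<tau>: "0 < ?\<tau> k" for k by (rule dyadic_rate_pos)
  have Tmono: "T k \<le> T m" if "k \<le> m" for k m
    unfolding T_def using that by (intro sum_mono2) (auto intro: less_imp_le[OF dyadic_rate_pos])
  have T1: "0 < T 1" using \<tau>[of 1] by (simp add: T_def)
  have main: "minimal_error_res e l (distr M borel X) n \<le> ennreal (sqrt (E * ((T L)\<^sup>2 / 2 ^ L)))"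
    if L: "1 \<le> L" and n: "A * 2 ^ L \<le> n" for L n
  proof -
    have TL: "0 < T L" using Tmono[OF L] T1 by simp
    define N where "N k = nat \<lceil>2 ^ L / T L * (?\<tau> k / 2 ^ k)\<rceil>" for k
    have pos: "0 < 2 ^ L / T L * (?\<tau> k / 2 ^ k)" for k using TL \<tau>[of k] by simp
    have Nge: "2 ^ L / T L * (?\<tau> k / 2 ^ k) \<le> real (N k)" for k unfolding N_def by linarith
    have Nle: "real (N k) \<le> 2 ^ L / T L * (?\<tau> k / 2 ^ k) + 1" for k
      unfolding N_def using pos[of k] by linarith
    have N1: "1 \<le> N k" for k using Nge[of k] pos[of k] by linarith
    have "(\<Sum>k=1..L. real (N k) * 2 ^ k) \<le> (\<Sum>k=1..L. 2 ^ L / T L * ?\<tau> k + 2 ^ k)"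
    proof (rule sum_mono)
      fix k
      have "real (N k) * 2 ^ k \<le> (2 ^ L / T L * (?\<tau> k / 2 ^ k) + 1) * 2 ^ k"
        by (intro mult_right_mono Nle) auto
      also have "\<dots> = 2 ^ L / T L * ?\<tau> k + 2 ^ k" by (simp add: distrib_right)
      finally show "real (N k) * 2 ^ k \<le> 2 ^ L / T L * ?\<tau> k + 2 ^ k" .
    qed
    also have "\<dots> = 2 ^ L / T L * T L + (\<Sum>k=1..L. 2 ^ k)"
      by (simp add: sum.distrib T_def sum_distrib_left)
    also have "(\<Sum>k=1..L. (2::real) ^ k) \<le> 2 * 2 ^ L"
    proof (induction L)
      case (Suc L)
      then show ?case by simp
    qed simp
    also have "2 ^ L / T L * T L + 2 * 2 ^ L = 3 * 2 ^ L" using TL by simp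
    finally have "real (\<Sum>k=1..L. N k * 2 ^ k) \<le> real (3 * 2 ^ L)" by simp
    then have "(\<Sum>k=1..L. N k * 2 ^ k) \<le> 3 * 2 ^ L" by (simp only: of_nat_le_iff)
    then have "(14 + 10 * K) * (\<Sum>k=1..L. N k * 2 ^ k) \<le> (14 + 10 * K) * (3 * 2 ^ L)" by (rule mult_left_mono) simp
    moreover have "(1::nat) \<le> 2 ^ L" by simp
    ultimately have "2 + (14 + 10 * K) * (\<Sum>k=1..L. N k * 2 ^ k) \<le> 2 * 2 ^ L + (14 + 10 * K) * (3 * 2 ^ L)" by linarith
    also have "\<dots> = A * 2 ^ L" by (simp add: A_def algebra_simps)
    also have "\<dots> \<le> n" by (rule n)
    finally have cost: "2 + (14 + 10 * K) * (\<Sum>k=1..L. N k * 2 ^ k) \<le> n" .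
    have var: "?\<psi> k / real (N k) \<le> T L / 2 ^ L * ?\<tau> k" for k
    proof -
      have "?\<psi> k / real (N k) \<le> ?\<psi> k / (2 ^ L / T L * (?\<tau> k / 2 ^ k))"
        by (rule frac_le[OF less_imp_le[OF dyadic_rate_pos] order_refl pos Nge])
      also have "\<dots> = T L / 2 ^ L * ((?\<psi> k * 2 ^ k) / ?\<tau> k)" by simp
      also have "\<dots> = T L / 2 ^ L * ?\<tau> k" unfolding sq using \<tau>[of k] by (simp add: power2_eq_square)
      finally show ?thesis .
    qed
    have "(\<Sum>k=1..L. 2 * C * (1 + D) * ?\<psi> k / real (N k)) = 2 * C * (1 + D) * (\<Sum>k=1..L. ?\<psi> k / real (N k))"
      by (simp add: sum_distrib_left)
    also have "\<dots> \<le> 2 * C * (1 + D) * (\<Sum>k=1..L. T L / 2 ^ L * ?\<tau> k)"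
      using C(1) D1 by (intro mult_left_mono sum_mono var) auto
    also have "(\<Sum>k=1..L. T L / 2 ^ L * ?\<tau> k) = (T L)\<^sup>2 / 2 ^ L"
    proof -
      have "(\<Sum>k=1..L. T L / 2 ^ L * ?\<tau> k) = T L / 2 ^ L * T L"
        unfolding T_def[of L] by (simp only: sum_distrib_left)
      then show ?thesis by (simp add: power2_eq_square)
    qed
    finally have v: "(\<Sum>k=1..L. 2 * C * (1 + D) * ?\<psi> k / real (N k)) \<le> 2 * C * (1 + D) * ((T L)\<^sup>2 / 2 ^ L)" .
    have "?\<psi> L \<le> (T L)\<^sup>2 / 2 ^ L"
    proof -
      have "?\<tau> L \<le> T L" unfolding T_def using L \<tau> by (intro member_le_sum) (auto intro: less_imp_le)
      then have "?\<psi> L * 2 ^ L \<le> (T L)\<^sup>2" unfolding sq using \<tau>[of L] by (intro power_mono) auto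
      then show ?thesis by (simp add: pos_le_divide_eq)
    qed
    then have "(2 + 2 * C) * ?\<psi> L \<le> (2 + 2 * C) * ((T L)\<^sup>2 / 2 ^ L)" using C(1) by (intro mult_left_mono) auto
    then have "(2 + 2 * C) * ?\<psi> L + (\<Sum>k=1..L. 2 * C * (1 + D) * ?\<psi> k / real (N k)) \<le> E * ((T L)\<^sup>2 / 2 ^ L)"
      using add_mono[OF _ v] by (simp only: E_def distrib_right[of "2 + 2 * C"])
    then have "worst_error random_bit e l (distr M borel X) (multilevel_program K (samples L N)) \<le> ennreal (sqrt (E * ((T L)\<^sup>2 / 2 ^ L)))"
      using we[OF N1, of L] by (meson ennreal_leI order_trans real_sqrt_le_mono)
    then show ?thesis by (rule minimal_error_res_multilevel[OF _ cost])
  qed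
  have triv: "minimal_error_res e l (distr M borel X) n \<le> ennreal (sqrt ((2 + 2 * C) * ?\<psi> 0))" if "3 \<le> n" for n
  proof (rule minimal_error_res_multilevel[where K = K and L = 0 and N = "\<lambda>_. 1"])
    show "worst_error random_bit e l (distr M borel X) (multilevel_program K (samples 0 (\<lambda>_. 1))) \<le> ennreal (sqrt ((2 + 2 * C) * ?\<psi> 0))"
      using we[of "\<lambda>_. 1" 0] by simp
  qed (use that in simp)
  define C1 where "C1 = sqrt E * sqrt (2 * A) + sqrt ((2 + 2 * C) * ?\<psi> 0) * sqrt (2 * A) / T 1"
  have C1: "0 < C1"
    unfolding C1_def using E0 A0 C(1) T1 dyadic_rate_pos[of "\<beta> - 1" \<alpha> 0]
    by (intro add_pos_pos mult_pos_pos divide_pos_pos) auto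
  have "minimal_error_res e l (distr M borel X) n \<le> ennreal (C1 * (real n powr (-1/2) * T (floor_log n)))"
    if n: "3 \<le> n" for n
  proof -
    have n0: "0 < real n" using n by simp
    have pw: "real n powr (-1/2) = 1 / sqrt (real n)" using n0 by (simp add: powr_minus_divide powr_half_sqrt)
    have fl1: "1 \<le> floor_log n"
    proof -
      have "floor_log 2 \<le> floor_log n" using n by (intro monoD[OF floor_log_mono]) simp
      then show ?thesis using floor_log_block[of 1 2] by simp
    qed
    have T1n: "T 1 \<le> T (floor_log n)" by (rule Tmono[OF fl1])
    show ?thesis
    proof (cases "2 * A \<le> n")
      case True
      define q where "q = n div A"
      have q2: "2 \<le> q" unfolding q_def using True A0 by (simp add: less_eq_div_iff_mult_less_eq)
      define L where "L = floor_log q"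
      have L1: "1 \<le> L"
      proof -
        have "floor_log 2 \<le> floor_log q" using q2 by (intro monoD[OF floor_log_mono]) simp
        then show ?thesis using floor_log_block[of 1 2] by (simp add: L_def)
      qed
      have p: "2 ^ L \<le> q" "q < 2 * 2 ^ L"
        using floor_log_exp2_le[of q] floor_log_exp2_gt[of q] q2 by (auto simp: L_def)
      have "A * 2 ^ L \<le> A * q" using p(1) by (rule mult_left_mono) simp
      also have "A * q \<le> n" by (simp add: q_def)
      finally have cost: "A * 2 ^ L \<le> n" .
      have "n < A * (2 * 2 ^ L)"
      proof -
        have "q + 1 \<le> 2 * 2 ^ L" using p(2) by simp
        then have "A * (q + 1) \<le> A * (2 * 2 ^ L)" by (rule mult_left_mono) simp
        moreover have "n < A * (q + 1)" unfolding q_def using A0 dividend_less_times_div[of A n] by (simp add: algebra_simps)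
        ultimately show ?thesis by (rule less_le_trans[rotated])
      qed
      then have "real n \<le> real (A * (2 * 2 ^ L))" by (simp only: of_nat_le_iff)
      then have nA: "real n \<le> 2 * real A * 2 ^ L" by simp
      have "q \<le> n" by (simp add: q_def)
      then have "L \<le> floor_log n" unfolding L_def by (rule monoD[OF floor_log_mono])
      then have TLn: "T L \<le> T (floor_log n)" by (rule Tmono)
      have TL0: "0 < T L" using Tmono[OF L1] T1 by simp
      have "sqrt (E * ((T L)\<^sup>2 / 2 ^ L)) = sqrt E * (T L / sqrt (2 ^ L))"
        using TL0 by (simp add: real_sqrt_mult real_sqrt_divide)
      also have "\<dots> \<le> sqrt E * (T (floor_log n) * (sqrt (2 * A) / sqrt (real n)))"
      proof (intro mult_left_mono)
        have "sqrt (real n) \<le> sqrt (2 * A) * sqrt (2 ^ L)"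
          using nA by (simp add: real_sqrt_mult[symmetric])
        then have "1 / sqrt (2 ^ L) \<le> sqrt (2 * A) / sqrt (real n)" using n0 by (simp add: field_simps)
        then have "T L * (1 / sqrt (2 ^ L)) \<le> T (floor_log n) * (sqrt (2 * A) / sqrt (real n))"
          using TLn TL0 by (intro mult_mono) auto
        then show "T L / sqrt (2 ^ L) \<le> T (floor_log n) * (sqrt (2 * A) / sqrt (real n))" by simp
      qed (use E0 in simp)
      also have "\<dots> = (sqrt E * sqrt (2 * A)) * (real n powr (-1/2) * T (floor_log n))" unfolding pw by simp
      also have "\<dots> \<le> C1 * (real n powr (-1/2) * T (floor_log n))"
        unfolding C1_def using C(1) T1 T1n dyadic_rate_pos[of "\<beta> - 1" \<alpha> 0] by (intro mult_right_mono) auto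
      finally show ?thesis using main[OF L1 cost] by (meson ennreal_leI order_trans)
    next
      case False
      then have "sqrt (real n) \<le> sqrt (2 * A)" by simp
      then have 1: "1 \<le> sqrt (2 * A) * real n powr (-1/2)" unfolding pw using n0 by simp
      have 2: "1 \<le> T (floor_log n) / T 1" using T1n T1 by simp
      have "1 * 1 \<le> (sqrt (2 * A) * real n powr (-1/2)) * (T (floor_log n) / T 1)"
        using 1 2 by (intro mult_mono) auto
      then have "sqrt ((2 + 2 * C) * ?\<psi> 0) * 1 \<le> sqrt ((2 + 2 * C) * ?\<psi> 0) * ((sqrt (2 * A) * real n powr (-1/2)) * (T (floor_log n) / T 1))"
        using C(1) dyadic_rate_pos[of "\<beta> - 1" \<alpha> 0] by (intro mult_left_mono) auto
      also have "\<dots> = (sqrt ((2 + 2 * C) * ?\<psi> 0) * sqrt (2 * A) / T 1) * (real n powr (-1/2) * T (floor_log n))" by simp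
      also have "\<dots> \<le> C1 * (real n powr (-1/2) * T (floor_log n))"
        unfolding C1_def using E0 T1 T1n by (intro mult_right_mono) auto
      finally show ?thesis using triv[OF n] by (simp del: ennreal_le_iff) (meson ennreal_leI order_trans)
    qed
  qed
  then show ?thesis using C1 unfolding T_def by blast
qed

end

theorem corollary1:
  fixes M :: "'a measure"
    and X :: "'a \<Rightarrow> 'h::{real_inner,polish_space}"
    and l :: "nat \<Rightarrow> real"
    and Y :: "nat \<Rightarrow> 'a \<Rightarrow> real"
    and e :: "nat \<Rightarrow> 'h"
    and \<mu> :: "'h measure"
    and \<alpha> \<beta> :: real
  assumes "prob_space M"
    and "centered_gaussian M X"
    and "\<mu> = distr M borel X"
    and "infinite_dim_support \<mu>"
    and "karhunen_loeve M X l Y e"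
    and "\<beta> > 1"
    and "\<exists>L>0. (\<lambda>i. l i * real i powr \<beta> * ln (real i) powr \<alpha>) \<longlonglongrightarrow> L"
  shows
    "uniformly_preceq {3..} (minimal_error_res e l \<mu>)
       (\<lambda>n. ennreal (real n powr (- min (1/2) ((\<beta> - 1)/2)) *
         (if \<beta> > 2 then 1
          else if \<beta> = 2 \<and> \<alpha> \<noteq> 2 then ln (real n) powr (max 0 (1 - \<alpha>/2))
          else if \<beta> = 2 \<and> \<alpha> = 2 then ln (ln (real n))
          else ln (real n) powr (- \<alpha>/2))))
     \<and> (\<beta> \<le> 2 \<longrightarrow>
         uniformly_preceq {3..}
           (\<lambda>n. ennreal (real n powr (- (\<beta> - 1)/2) * ln (real n) powr (- \<alpha>/2)))
           (minimal_error_MC e l \<mu>))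
     \<and> (\<beta> > 2 \<longrightarrow>
         limsup (\<lambda>n. minimal_error_MC e l \<mu> n *
           ennreal (real n powr (1/2) * ln (real n) powr ((1 + \<beta>)/2) * ln (ln (real n)) powr (\<alpha>/2)))
         > 0)"
proof -
  interpret prob_space M by fact
  interpret gaussian_series M X l Y e
    by unfold_locales (use assms in \<open>auto simp: centered_gaussian_def\<close>)
  obtain c where c: "c > 0" "(\<lambda>i. l i * real i powr \<beta> * ln (real i) powr \<alpha>) \<longlonglongrightarrow> c"
    using assms(7) by blast
  define T where "T n = real n powr (-1/2) * (\<Sum>k=1..floor_log n. dyadic_rate ((\<beta> - 2) / 2) (\<alpha> / 2) k)" for n
  define R where "R n = real n powr (- min (1/2) ((\<beta> - 1)/2)) *
         (if \<beta> > 2 then 1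
          else if \<beta> = 2 \<and> \<alpha> \<noteq> 2 then ln (real n) powr (max 0 (1 - \<alpha>/2))
          else if \<beta> = 2 \<and> \<alpha> = 2 then ln (ln (real n))
          else ln (real n) powr (- \<alpha>/2))" for n
  have "\<exists>C>0. \<forall>n\<ge>3. minimal_error_res e l \<mu> n \<le> ennreal (C * T n)"
    unfolding T_def assms(3) by (rule minimal_error_res_level_sum[OF c assms(6)])
  then obtain C1 where C1: "C1 > 0" "\<And>n. 3 \<le> n \<Longrightarrow> minimal_error_res e l \<mu> n \<le> ennreal (C1 * T n)"
    by blast
  have "\<exists>C>0. \<forall>n\<ge>3. T n \<le> C * R n"
    unfolding T_def R_def by (rule level_sum_bound)
  then obtain C2 where C2: "C2 > 0" "\<And>n. 3 \<le> n \<Longrightarrow> T n \<le> C2 * R n"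
    by blast
  have "uniformly_preceq {3..} (minimal_error_res e l \<mu>) (\<lambda>n. ennreal (R n))"
    unfolding uniformly_preceq_def
  proof (intro exI[of _ "C1 * C2"] conjI ballI)
    show "0 < C1 * C2" using C1 C2 by simp
    fix n :: nat assume "n \<in> {3..}"
    then have n: "3 \<le> n" by simp
    have "C1 * T n \<le> C1 * (C2 * R n)" using C1(1) C2(2)[OF n] by (intro mult_left_mono) auto
    then have "minimal_error_res e l \<mu> n \<le> ennreal (C1 * C2 * R n)"
      using C1(2)[OF n] by (metis (no_types, lifting) ennreal_leI mult.assoc order_trans)
    also have "\<dots> = ennreal (C1 * C2) * ennreal (R n)" by (rule ennreal_mult') (use C1 C2 in simp)
    finally show "minimal_error_res e l \<mu> n \<le> ennreal (C1 * C2) * ennreal (R n)" .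
  qed
  then show ?thesis
    using minimal_error_MC_lower_bound[OF c] minimal_error_MC_limsup[OF c assms(6)]
    unfolding R_def assms(3) by blast
qed

end
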